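(* Let $\Gamma$ be a distance-regular graph with vertex set $X$ and diameter $d\geqslant 3$ which is $Q$-polynomial with respect to the ordering $\{E_i\}_{i=0}^d$ of its primitive idempotents, and let $Y$ be a descendent of $\Gamma$ (with respect to this ordering) with width $w$. Suppose $1<w<d$. Then $Y$ is convex if and only if there are scalars $q,\alpha,\beta$ such that $\Gamma$ has classical parameters $(d,q,\alpha,\beta)$ with $\{E_i\}_{i=0}^d$ the corresponding standard $Q$-polynomial ordering.
   Context: All graphs are finite, simple and undirected. Let $\Gamma$ be a connected graph with vertex set $X$, path-length distance $\partial$ and diameter $d$; write $\Gamma_i(x)=\{y\in X:\partial(x,y)=i\}$, $\Gamma(x)=\Gamma_1(x)$, and let $A_i\in\mathbb{C}^{X\times X}$ be the adjacency matrix of the distance-$i$ graph ($A_0=I$). $\Gamma$ is distance-regular if there are integers $b_i,c_i$ such that $|\Gamma_{i+1}(x)\cap\Gamma(y)|=b_i$ and $|\Gamma_{i-1}(x)\cap\Gamma(y)|=c_i$ whenever $\partial(x,y)=i$ $(0\leqslant i\leqslant d)$. Then the Bose--Mesner algebra $\boldsymbol{A}=\langle A_0,\dots,A_d\rangle$ (complex span) is a commutative semisimple algebra with a basis of primitive idempotents $E_0=|X|^{-1}J,E_1,\dots,E_d$. $\Gamma$ is $Q$-polynomial with respect to the ordering $\{E_i\}_{i=0}^d$ if there are scalars $a_i^*,b_i^*,c_i^*$ with $b_d^*=c_0^*=0$, $b_{i-1}^*c_i^*\neq 0$ $(1\leqslant i\leqslant d)$ and $E_1\circ E_i=|X|^{-1}(b_{i-1}^*E_{i-1}+a_i^*E_i+c_{i+1}^*E_{i+1})$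 $(0\leqslant i\leqslant d)$, where $\circ$ is the entrywise product, $E_{-1}=E_{d+1}=0$ and $b_{-1}^*=c_{d+1}^*=0$. In this case write $|X|E_1=\sum_{i=0}^d\theta_i^*A_i$. For a nonempty $Y\subseteq X$ with characteristic vector $\hat Y$, the width is $w=\max\{i:\hat Y^{\mathsf T}A_i\hat Y\neq 0\}$ and the dual width is $w^*=\max\{i:\hat Y^{\mathsf T}E_i\hat Y\neq 0\}$. One always has $w+w^*\geqslant d$; $Y$ is a descendent of $\Gamma$ if $w+w^*=d$. $Y$ is convex (geodetically closed) if for all $x,y\in Y$, every $z\in X$ with $\partial(x,z)+\partial(z,y)=\partial(x,y)$ lies in $Y$. Put $[i]_q=1+q+\dots+q^{i-1}$. $\Gamma$ has classical parameters $(d,q,\alpha,\beta)$ if $b_i=([d]_q-[i]_q)(\beta-\alpha[i]_q)$ and $c_i=[i]_q(1+\alpha[i-1]_q)$ for $0\leqslant i\leqslant d$. Then $q$ is an integer $\neq 0,-1$, and $\Gamma$ has a $Q$-polynomial ordering $\{E_i\}_{i=0}^d$, called standard, for which $\theta_i^*=\xi^*[d-i]_q+\zeta^*$ $(0\leqslant i\leqslant d)$ for some scalars $\xi^*,\zeta^*$ with $\xi^*\neq 0$. *)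

theory Defs
  imports "HOL-Analysis.Analysis"
begin

text \<open>
  The vertex set \<open>X\<close> is the whole of a finite type, so that matrices indexed by \<open>X\<close> are
  the library's \<open>complex^'a^'a\<close>. A graph is given by its adjacency relation.
\<close>

subsection \<open>Graphs and distance-regularity\<close>

definition simple_graph :: "('a \<Rightarrow> 'a \<Rightarrow> bool) \<Rightarrow> bool" where
  "simple_graph adj \<longleftrightarrow> symp adj \<and> irreflp adj"

definition connected_graph :: "('a \<Rightarrow> 'a \<Rightarrow> bool) \<Rightarrow> bool" where
  "connected_graph adj \<longleftrightarrow> (\<forall>x y. rtranclp adj x y)"

text \<open>\<open>(adj ^^ n) x y\<close> says that there is a walk of length \<open>n\<close> from \<open>x\<close> to \<open>y\<close>.\<close>

definition graph_dist :: "('a \<Rightarrow> 'a \<Rightarrow> bool) \<Rightarrow> 'a \<Rightarrow> 'a \<Rightarrow> nat" where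
  "graph_dist adj x y = (LEAST n. (adj ^^ n) x y)"

definition graph_diameter :: "('a::finite \<Rightarrow> 'a \<Rightarrow> bool) \<Rightarrow> nat" where
  "graph_diameter adj = Max {graph_dist adj x y | x y. True}"

text \<open>Stating the second condition with \<open>Suc\<close> makes \<open>\<Gamma>\<^sub>-\<^sub>1(x)\<close> empty, so \<open>c 0 = 0\<close>.\<close>

definition intersection_array ::
    "('a::finite \<Rightarrow> 'a \<Rightarrow> bool) \<Rightarrow> (nat \<Rightarrow> nat) \<Rightarrow> (nat \<Rightarrow> nat) \<Rightarrow> bool" where
  "intersection_array adj b c \<longleftrightarrow>
     (\<forall>i x y. graph_dist adj x y = i \<longrightarrow>
        card {z. graph_dist adj x z = Suc i \<and> adj y z} = b i \<and>
        card {z. Suc (graph_dist adj x z) = i \<and> adj y z} = c i)"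

definition distance_regular :: "('a::finite \<Rightarrow> 'a \<Rightarrow> bool) \<Rightarrow> bool" where
  "distance_regular adj \<longleftrightarrow>
     simple_graph adj \<and> connected_graph adj \<and> (\<exists>b c. intersection_array adj b c)"

definition geodetically_closed :: "('a \<Rightarrow> 'a \<Rightarrow> bool) \<Rightarrow> 'a set \<Rightarrow> bool" where
  "geodetically_closed adj Y \<longleftrightarrow>
     (\<forall>x\<in>Y. \<forall>y\<in>Y. \<forall>z. graph_dist adj x z + graph_dist adj z y = graph_dist adj x y \<longrightarrow> z \<in> Y)"

subsection \<open>The Bose--Mesner algebra and its primitive idempotents\<close>

definition smult_mat :: "complex \<Rightarrow> complex^'n^'m \<Rightarrow> complex^'n^'m" where
  "smult_mat k M = (\<chi> i j. k * M $ i $ j)"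

definition hadamard :: "complex^'n^'m \<Rightarrow> complex^'n^'m \<Rightarrow> complex^'n^'m" where
  "hadamard M N = (\<chi> i j. M $ i $ j * N $ i $ j)"

definition all_ones_mat :: "complex^'n^'m" where
  "all_ones_mat = (\<chi> i j. 1)"

definition dist_mat :: "('a::finite \<Rightarrow> 'a \<Rightarrow> bool) \<Rightarrow> nat \<Rightarrow> complex^'a^'a" where
  "dist_mat adj i = (\<chi> x y. if graph_dist adj x y = i then 1 else 0)"

definition bose_mesner :: "('a::finite \<Rightarrow> 'a \<Rightarrow> bool) \<Rightarrow> (complex^'a^'a) set" where
  "bose_mesner adj =
     {(\<Sum>i\<le>graph_diameter adj. smult_mat (k i) (dist_mat adj i)) | k. True}"

definition idempotents :: "(complex^'n^'n) set \<Rightarrow> (complex^'n^'n) set" where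
  "idempotents \<A> = {M \<in> \<A>. M ** M = M}"

text \<open>An idempotent is primitive if it is nonzero and is not a sum of two nonzero
  orthogonal idempotents of the algebra.\<close>

definition primitive_idempotents :: "(complex^'n^'n) set \<Rightarrow> (complex^'n^'n) set" where
  "primitive_idempotents \<A> =
     {M \<in> idempotents \<A>. M \<noteq> 0 \<and>
        \<not> (\<exists>F\<in>idempotents \<A>. \<exists>G\<in>idempotents \<A>.
              F \<noteq> 0 \<and> G \<noteq> 0 \<and> F ** G = 0 \<and> G ** F = 0 \<and> M = F + G)}"

text \<open>Only the values \<open>E 0, \<dots>, E d\<close>, where \<open>d\<close> is the diameter, are meaningful.\<close>

definition primitive_idempotent_ordering ::
    "('a::finite \<Rightarrow> 'a \<Rightarrow> bool) \<Rightarrow> (nat \<Rightarrow> complex^'a^'a) \<Rightarrow> bool" where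
  "primitive_idempotent_ordering adj E \<longleftrightarrow>
     bij_betw E {..graph_diameter adj} (primitive_idempotents (bose_mesner adj)) \<and>
     E 0 = smult_mat (1 / of_nat CARD('a)) all_ones_mat"

subsection \<open>The Q-polynomial property\<close>

text \<open>The conditionals implement \<open>E\<^sub>-\<^sub>1 = E\<^sub>d\<^sub>+\<^sub>1 = 0\<close>.\<close>

definition q_polynomial ::
    "('a::finite \<Rightarrow> 'a \<Rightarrow> bool) \<Rightarrow> (nat \<Rightarrow> complex^'a^'a) \<Rightarrow> bool" where
  "q_polynomial adj E \<longleftrightarrow>
     primitive_idempotent_ordering adj E \<and>
     (let d = graph_diameter adj in
      \<exists>as bs cs :: nat \<Rightarrow> complex.
        bs d = 0 \<and> cs 0 = 0 \<and>
        (\<forall>i\<in>{1..d}. bs (i - 1) * cs i \<noteq> 0) \<and>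
        (\<forall>i\<le>d. hadamard (E 1) (E i) =
           smult_mat (1 / of_nat CARD('a))
             ((if i = 0 then 0 else smult_mat (bs (i - 1)) (E (i - 1)))
              + smult_mat (as i) (E i)
              + (if i = d then 0 else smult_mat (cs (i + 1)) (E (i + 1))))))"

text \<open>\<open>dual_eigenvalues adj E \<theta>\<close> says that \<open>\<theta> 0, \<dots>, \<theta> d\<close> is the dual eigenvalue sequence
  \<open>\<theta>\<^sub>i\<^sup>*\<close> of the ordering.\<close>

definition dual_eigenvalues ::
    "('a::finite \<Rightarrow> 'a \<Rightarrow> bool) \<Rightarrow> (nat \<Rightarrow> complex^'a^'a) \<Rightarrow> (nat \<Rightarrow> complex) \<Rightarrow> bool" where
  "dual_eigenvalues adj E \<theta> \<longleftrightarrow>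
     smult_mat (of_nat CARD('a)) (E 1) =
       (\<Sum>i\<le>graph_diameter adj. smult_mat (\<theta> i) (dist_mat adj i))"

subsection \<open>Width, dual width and descendents\<close>

definition char_vec :: "'a::finite set \<Rightarrow> complex^'a" where
  "char_vec Y = (\<chi> x. if x \<in> Y then 1 else 0)"

text \<open>The number \<open>v\<^sup>T M v\<close>, without complex conjugation.\<close>

definition quad_form :: "complex^'n^'n \<Rightarrow> complex^'n \<Rightarrow> complex" where
  "quad_form M v = (\<Sum>x\<in>UNIV. v $ x * (M *v v) $ x)"

definition width :: "('a::finite \<Rightarrow> 'a \<Rightarrow> bool) \<Rightarrow> 'a set \<Rightarrow> nat" where
  "width adj Y =
     Max {i. i \<le> graph_diameter adj \<and> quad_form (dist_mat adj i) (char_vec Y) \<noteq> 0}"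

definition dual_width ::
    "('a::finite \<Rightarrow> 'a \<Rightarrow> bool) \<Rightarrow> (nat \<Rightarrow> complex^'a^'a) \<Rightarrow> 'a set \<Rightarrow> nat" where
  "dual_width adj E Y =
     Max {i. i \<le> graph_diameter adj \<and> quad_form (E i) (char_vec Y) \<noteq> 0}"

definition descendent ::
    "('a::finite \<Rightarrow> 'a \<Rightarrow> bool) \<Rightarrow> (nat \<Rightarrow> complex^'a^'a) \<Rightarrow> 'a set \<Rightarrow> bool" where
  "descendent adj E Y \<longleftrightarrow>
     Y \<noteq> {} \<and> width adj Y + dual_width adj E Y = graph_diameter adj"

subsection \<open>Classical parameters\<close>

definition q_number :: "complex \<Rightarrow> nat \<Rightarrow> complex" where
  "q_number q i = (\<Sum>j<i. q ^ j)"

text \<open>At \<open>i = 0\<close> the truncated \<open>i - 1\<close> is harmless because of the factor \<open>q_number q 0 = 0\<close>.\<close>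

definition classical_parameters ::
    "('a::finite \<Rightarrow> 'a \<Rightarrow> bool) \<Rightarrow> nat \<Rightarrow> complex \<Rightarrow> complex \<Rightarrow> complex \<Rightarrow> bool" where
  "classical_parameters adj d q \<alpha> \<beta> \<longleftrightarrow>
     d = graph_diameter adj \<and>
     (\<exists>b c. intersection_array adj b c \<and>
        (\<forall>i\<le>d. of_nat (b i) = (q_number q d - q_number q i) * (\<beta> - \<alpha> * q_number q i) \<and>
               of_nat (c i) = q_number q i * (1 + \<alpha> * q_number q (i - 1))))"

text \<open>The standard Q-polynomial ordering attached to classical parameters with base \<open>q\<close>.
  There is at most one: \<open>|X| E\<^sub>1\<close> is fixed up to an affine change of the \<open>\<theta>\<^sub>i\<^sup>*\<close>, and a
  primitive idempotent other than \<open>E\<^sub>0\<close> and \<open>E\<^sub>1\<close> is not in the span of these two.\<close>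

definition standard_ordering ::
    "('a::finite \<Rightarrow> 'a \<Rightarrow> bool) \<Rightarrow> complex \<Rightarrow> (nat \<Rightarrow> complex^'a^'a) \<Rightarrow> bool" where
  "standard_ordering adj q E \<longleftrightarrow>
     q_polynomial adj E \<and>
     (\<exists>\<xi> \<zeta>. \<xi> \<noteq> 0 \<and>
        dual_eigenvalues adj E (\<lambda>i. \<xi> * q_number q (graph_diameter adj - i) + \<zeta>))"

end

theory Submission imports Defs "HOL-Computational_Algebra.Polynomial" begin

text \<open>
  Write \<open>\<theta>\<^sub>i\<close> for the dual eigenvalues of \<open>\<Gamma>\<close>. Since \<open>E\<^sub>i\<close> is a polynomial of degree \<open>i\<close> in
  \<open>E\<^sub>1\<close> for the entrywise product, multiplication by \<open>A\<close> preserves the polynomials in \<open>\<theta>\<close> of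
  bounded degree. In degrees 1 and 2 this says that \<open>C\<^sub>i = c\<^sub>i (\<theta>\<^sub>i\<^sub>-\<^sub>1 - \<theta>\<^sub>i)\<close> and
  \<open>B\<^sub>i = b\<^sub>i (\<theta>\<^sub>i - \<theta>\<^sub>i\<^sub>+\<^sub>1)\<close> satisfy a linear and a quadratic relation in \<open>\<theta>\<^sub>i\<close>, and it forces the points
  \<open>(\<theta>\<^sub>i, \<theta>\<^sub>i\<^sub>+\<^sub>1)\<close> onto a symmetric conic.

  For a descendent \<open>Y\<close> of width \<open>w\<close>, \<open>E\<^sub>j diag(Y) E\<^sub>h = 0\<close> whenever \<open>j - h > d - w\<close>. This determines the sizes
  of the spheres of \<open>Y\<close> up to a scalar, as \<open>k\<^sub>i \<Prod>\<^bsub>w<l\<le>d\<^esub> (\<theta>\<^sub>i - \<theta>\<^sub>l)\<close>, and shows that the averaged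
  intersection numbers of \<open>Y\<close> satisfy a linear relation of the same kind. Detailed balance and the linear
  relation determine these numbers up to a scalar, so they can be compared with the formal solutions
  obtained from \<open>(B, C)\<close> by removing the nodes \<open>\<theta>\<^sub>d, \<dots>, \<theta>\<^bsub>w+1\<^esub>\<close> one or two at a time. Convexity says that
  the \<open>c\<^sub>i\<close> of \<open>Y\<close> and of \<open>\<Gamma>\<close> agree for \<open>1 \<le> i \<le> w\<close>. Comparing \<open>i = 1\<close> with \<open>i = 2\<close> makes
  three points of the conic collinear, so the conic contains a line and the differences
  \<open>\<theta>\<^sub>i - \<theta>\<^sub>i\<^sub>+\<^sub>1\<close> form a geometric progression; this is equivalent to classical parameters with the
  standard ordering. Conversely a geometric progression makes all comparison factors equal.
\<close>

section \<open>Tridiagonal systems over a sequence on a conic\<close>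

text \<open>For fixed \<open>x\<close> a monic quadratic in \<open>y\<close> whose roots add up to
  \<open>\<beta> * x + \<gamma>\<close>, and conversely by symmetry. In the theory of Leonard
  systems it vanishes at consecutive dual eigenvalues.\<close>

definition conic :: "'a::field \<Rightarrow> 'a \<Rightarrow> 'a \<Rightarrow> 'a \<Rightarrow> 'a \<Rightarrow> 'a" where
  "conic \<beta> \<gamma> \<rho> x y = x\<^sup>2 + y\<^sup>2 - \<beta> * x * y - \<gamma> * (x + y) - \<rho>"

lemma linear_factor_bounded_degree:
  fixes p :: "'a::field poly"
  assumes "degree p \<le> Suc m" "poly p t = 0"
  obtains r where "degree r \<le> m" "\<And>x. poly p x = (x - t) * poly r x"
proof -
  obtain r where r: "p = [:- t, 1:] * r" using assms(2) by (auto simp: poly_eq_0_iff_dvd elim: dvdE)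
  have "degree r \<le> m"
  proof (cases "r = 0")
    case False
    hence "degree p = Suc (degree r)" unfolding r by (subst degree_mult_eq) auto
    thus ?thesis using assms(1) by simp
  qed simp
  moreover have "poly p x = (x - t) * poly r x" for x by (simp add: r algebra_simps)
  ultimately show ?thesis using that by blast
qed

section \<open>Tridiagonal systems and their uniqueness up to scale\<close>

definition detailed_balance :: "nat \<Rightarrow> (nat \<Rightarrow> 'a::field) \<Rightarrow> (nat \<Rightarrow> 'a) \<Rightarrow> (nat \<Rightarrow> 'a) \<Rightarrow> bool" where
  "detailed_balance e wt B C \<longleftrightarrow> (\<forall>i<e. wt i * B i = wt (Suc i) * C (Suc i))"

text \<open>\<open>B\<close> and \<open>C\<close> stand for the off-diagonal entries of a
  tridiagonal matrix with constant row sums, multiplied by the adjacent gaps of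
  \<open>\<theta>\<close>. Applying the matrix to \<open>\<theta>\<close> gives \<open>C - B\<close>
  plus the row sum times \<open>\<theta>\<close>, so the relation says that affine functions of
  \<open>\<theta>\<close> are preserved.\<close>

definition affine_system :: "nat \<Rightarrow> (nat \<Rightarrow> 'a::field) \<Rightarrow> (nat \<Rightarrow> 'a) \<Rightarrow> (nat \<Rightarrow> 'a) \<Rightarrow> bool" where
  "affine_system e \<theta> B C \<longleftrightarrow> C 0 = 0 \<and> B e = 0 \<and>
     (\<exists>p. degree p \<le> 1 \<and> (\<forall>i\<le>e. C i - B i = poly p (\<theta> i)))"

text \<open>Invariance in degree 2: since
  \<open>y\<^sup>2 - x\<^sup>2 = (y - x)\<^sup>2 + 2 * x * (y - x)\<close>, the image of
  \<open>\<theta>\<^sup>2\<close> differs from the left side here only by terms that the affine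
  relation controls.\<close>

definition quadratic_system :: "nat \<Rightarrow> (nat \<Rightarrow> 'a::field) \<Rightarrow> (nat \<Rightarrow> 'a) \<Rightarrow> (nat \<Rightarrow> 'a) \<Rightarrow> bool" where
  "quadratic_system e \<theta> B C \<longleftrightarrow> affine_system e \<theta> B C \<and>
     (\<exists>p. degree p \<le> 2 \<and> (\<forall>i\<le>e. C i * (\<theta> (i - 1) - \<theta> i) + B i * (\<theta> i - \<theta> (Suc i)) = poly p (\<theta> i)))"

lemma affine_poly:
  fixes p :: "'a::field poly"
  assumes "degree p \<le> 1"
  shows "p = [:coeff p 0, coeff p 1:]"
proof (rule poly_eqI)
  fix n
  show "coeff p n = coeff [:coeff p 0, coeff p 1:] n"
    using assms by (cases n; cases "n - 1") (auto simp: coeff_pCons intro!: coeff_eq_0 split: nat.split)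
qed

text \<open>Detailed balance makes the weighted sum of the affine relation telescope: the part below
  \<open>h\<close> is \<open>- wt h * C h\<close>, and the full sum vanishes because
  \<open>B e = 0\<close>. So the affine polynomial vanishes at the weighted mean and only its slope
  is free. The conclusion is cross-multiplied because the slope may be 0.\<close>

lemma affine_system_unique:
  fixes \<theta> :: "nat \<Rightarrow> 'a::field"
  assumes "affine_system e \<theta> B C" "detailed_balance e wt B C"
    and "affine_system e \<theta> B' C'" "detailed_balance e wt B' C'"
    and wt: "\<And>i. i \<le> e \<Longrightarrow> wt i \<noteq> 0" "(\<Sum>i\<le>e. wt i) \<noteq> 0" and h: "1 \<le> h" "h \<le> e"
  shows "C h * C' 1 = C' h * C 1"
proof -
  define m where "m = (\<Sum>i\<le>e. wt i * \<theta> i) / (\<Sum>i\<le>e. wt i)"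
  have key: "\<exists>s. \<forall>h\<le>e. wt h * C h = s * (\<Sum>i<h. wt i * (\<theta> i - m))"
    if sys: "affine_system e \<theta> B C" and bal: "detailed_balance e wt B C" for B C
  proof -
    obtain p where p: "degree p \<le> 1" "\<And>i. i \<le> e \<Longrightarrow> C i - B i = poly p (\<theta> i)" "C 0 = 0" "B e = 0"
      using sys unfolding affine_system_def by blast
    have part: "(\<Sum>i<h. wt i * poly p (\<theta> i)) = - (wt h * C h)" if "h \<le> e" for h
      using that
    proof (induction h)
      case 0 thus ?case using p by simp
    next
      case (Suc h)
      have "wt h * B h = wt (Suc h) * C (Suc h)" using bal Suc.prems unfolding detailed_balance_def by auto
      moreover have "wt h * poly p (\<theta> h) = wt h * C h - wt h * B h"
        using p(2)[of h] Suc.prems by (simp add: right_diff_distrib[symmetric])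
      ultimately show ?case using Suc by simp
    qed
    define a b where "a = coeff p 0" and "b = coeff p 1"
    have ab: "p = [:a, b:]" unfolding a_def b_def by (rule affine_poly[OF p(1)])
    have "(\<Sum>i\<le>e. wt i * poly p (\<theta> i)) = (\<Sum>i<e. wt i * poly p (\<theta> i)) + wt e * poly p (\<theta> e)"
      by (simp flip: lessThan_Suc_atMost)
    also have "\<dots> = - (wt e * B e)" using part[of e] by (simp add: p(2)[of e, symmetric] algebra_simps)
    finally have "(\<Sum>i\<le>e. wt i * poly p (\<theta> i)) = 0" using p by simp
    hence "a * (\<Sum>i\<le>e. wt i) + b * (\<Sum>i\<le>e. wt i * \<theta> i) = 0"
      by (simp add: ab sum.distrib sum_distrib_left algebra_simps)
    hence "a = - b * m" unfolding m_def using wt(2) by (simp add: field_simps eq_neg_iff_add_eq_0)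
    hence "poly p (\<theta> i) = b * (\<theta> i - m)" for i by (simp add: ab algebra_simps)
    hence "(\<Sum>i<h. wt i * poly p (\<theta> i)) = b * (\<Sum>i<h. wt i * (\<theta> i - m))" for h
      by (simp add: sum_distrib_left mult.left_commute)
    hence "wt h * C h = (- b) * (\<Sum>i<h. wt i * (\<theta> i - m))" if "h \<le> e" for h
      using part[OF that] by simp
    thus ?thesis by blast
  qed
  obtain s where s: "\<And>h. h \<le> e \<Longrightarrow> wt h * C h = s * (\<Sum>i<h. wt i * (\<theta> i - m))"
    using key[OF assms(1,2)] by blast
  obtain s' where s': "\<And>h. h \<le> e \<Longrightarrow> wt h * C' h = s' * (\<Sum>i<h. wt i * (\<theta> i - m))"
    using key[OF assms(3,4)] by blast
  have "(wt h * C h) * (wt 1 * C' 1) = (wt h * C' h) * (wt 1 * C 1)"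
    using s[of h] s'[of h] s[of 1] s'[of 1] h by (simp add: mult_ac)
  thus ?thesis using wt(1)[of h] wt(1)[of 1] h by simp
qed

lemma cancel_denominator:
  fixes x :: "'a::field"
  assumes "x \<noteq> 0"
  shows "(w * x) * (b * (y / x)) = (w * b) * y"
  using assms by simp

lemma exchange_in_balance:
  fixes w :: "'a::field"
  assumes "w * b = w' * c"
  shows "w * x * b * y = w' * y * c * x"
proof -
  have "w * x * b * y = (w * b) * (x * y)" by (simp add: mult_ac)
  also have "\<dots> = w' * y * c * x" unfolding assms by (simp add: mult_ac)
  finally show ?thesis .
qed

section \<open>Removal of nodes from a system over a sequence on a conic\<close>

locale conic_sequence =
  fixes d :: nat and \<theta> :: "nat \<Rightarrow> 'a::field" and \<beta> \<gamma> \<rho> :: 'a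
  assumes distinct: "i \<le> d \<Longrightarrow> j \<le> d \<Longrightarrow> \<theta> i = \<theta> j \<Longrightarrow> i = j"
    and on_conic: "i < d \<Longrightarrow> conic \<beta> \<gamma> \<rho> (\<theta> i) (\<theta> (Suc i)) = 0"
begin

text \<open>Both outer nodes are roots of the quadratic that the conic attaches to the middle node;
  being distinct they are all its roots, and Vieta gives their sum.\<close>

lemma recurrence:
  assumes "Suc i < d"
  shows "\<theta> i + \<theta> (Suc (Suc i)) = \<beta> * \<theta> (Suc i) + \<gamma>"
proof -
  have "conic \<beta> \<gamma> \<rho> (\<theta> i) (\<theta> (Suc i)) = 0" "conic \<beta> \<gamma> \<rho> (\<theta> (Suc i)) (\<theta> (Suc (Suc i))) = 0"
    using assms by (auto intro!: on_conic)
  hence "(\<theta> i - \<theta> (Suc (Suc i))) * (\<theta> i + \<theta> (Suc (Suc i)) - (\<beta> * \<theta> (Suc i) + \<gamma>)) = 0"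
    unfolding conic_def by algebra
  moreover have "\<theta> i \<noteq> \<theta> (Suc (Suc i))" using distinct[of i "Suc (Suc i)"] assms by auto
  ultimately show ?thesis by simp
qed

text \<open>By Vieta both sides equal \<open>conic \<beta> \<gamma> \<rho> x t\<close>, read once as
  a quadratic in \<open>t\<close> and once as a quadratic in \<open>x\<close>.\<close>

lemma parallel_chords:
  fixes x x0 x1 t t0 t1 :: 'a
  assumes "conic \<beta> \<gamma> \<rho> x x0 = 0" "x0 + x1 = \<beta> * x + \<gamma>"
    and "conic \<beta> \<gamma> \<rho> t t0 = 0" "t0 + t1 = \<beta> * t + \<gamma>"
  shows "(x0 - t) * (x1 - t) = (x - t0) * (x - t1)"
  using assms unfolding conic_def by algebra

text \<open>A line meeting the conic in three points is contained in it, which forces the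
  sequence to move along that line.\<close>

lemma geometric_of_collinear:
  assumes w: "0 < w" "w < d" and \<beta>: "\<beta> \<noteq> - 2"
    and y: "conic \<beta> \<gamma> \<rho> (\<theta> d) y = 0"
    and line: "\<theta> (Suc w) = \<theta> 1 + \<kappa> * (\<theta> w - \<theta> 0)" "y = \<theta> 1 + \<kappa> * (\<theta> d - \<theta> 0)"
    and i: "i < d"
  shows "\<theta> (Suc i) = \<theta> 1 + \<kappa> * (\<theta> i - \<theta> 0)" "\<kappa> \<noteq> 0"
proof -
  \<comment> \<open>\<open>A\<close>, \<open>B\<close>, \<open>C\<close> below are the coefficients
    of the conic restricted to the line; three distinct roots make all of them vanish.\<close>
  define g0 where "g0 = \<theta> 1 - \<kappa> * \<theta> 0"
  define A where "A = 1 + \<kappa>\<^sup>2 - \<beta> * \<kappa>"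
  define B where "B = 2 * \<kappa> * g0 - \<beta> * g0 - \<gamma> * (1 + \<kappa>)"
  define C where "C = g0\<^sup>2 - \<gamma> * g0 - \<rho>"
  have cc: "conic \<beta> \<gamma> \<rho> t (\<theta> 1 + \<kappa> * (t - \<theta> 0)) = A * t\<^sup>2 + B * t + C" for t
    unfolding A_def B_def C_def g0_def conic_def by (simp add: algebra_simps power2_eq_square)
  have z: "A * (\<theta> 0)\<^sup>2 + B * \<theta> 0 + C = 0" "A * (\<theta> w)\<^sup>2 + B * \<theta> w + C = 0"
    "A * (\<theta> d)\<^sup>2 + B * \<theta> d + C = 0"
    using cc[of "\<theta> 0"] cc[of "\<theta> w"] cc[of "\<theta> d"] on_conic[of 0] on_conic[of w] y line w by auto
  have ne: "\<theta> 0 - \<theta> w \<noteq> 0" "\<theta> 0 - \<theta> d \<noteq> 0" "\<theta> w - \<theta> d \<noteq> 0"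
    using distinct[of 0 w] distinct[of 0 d] distinct[of w d] w by auto
  have "(\<theta> 0 - \<theta> w) * (A * (\<theta> 0 + \<theta> w) + B) = 0" "(\<theta> 0 - \<theta> d) * (A * (\<theta> 0 + \<theta> d) + B) = 0"
    using z by algebra+
  hence 1: "A * (\<theta> 0 + \<theta> w) + B = 0" "A * (\<theta> 0 + \<theta> d) + B = 0" using ne by auto
  hence "A * (\<theta> w - \<theta> d) = 0" by algebra
  hence A0: "A = 0" using ne by simp
  hence B0: "B = 0" using 1 by simp
  have C0: "C = 0" using z A0 B0 by simp
  show k0: "\<kappa> \<noteq> 0" using A0 unfolding A_def by auto
  have k1: "\<kappa> \<noteq> -1" 
  proof
    assume "\<kappa> = -1"
    hence "\<beta> + 2 = 0" using A0 unfolding A_def by (simp add: algebra_simps)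
    thus False using \<beta> by (simp add: eq_neg_iff_add_eq_0)
  qed
  have on: "conic \<beta> \<gamma> \<rho> t (\<theta> 1 + \<kappa> * (t - \<theta> 0)) = 0" for t using cc A0 B0 C0 by simp
  show "\<theta> (Suc i) = \<theta> 1 + \<kappa> * (\<theta> i - \<theta> 0)" using i
  proof (induction i)
    case 0 thus ?case by simp
  next
    case (Suc i)
    \<comment> \<open>\<open>?l\<close> is where the line continues the sequence. It is a neighbour
      of \<open>\<theta> (Suc i)\<close> on the conic, hence \<open>\<theta> i\<close> or
      \<open>\<theta> (Suc (Suc i))\<close>; the former would need
      \<open>\<kappa> = - 1\<close>.\<close>
    let ?l = "\<theta> 1 + \<kappa> * (\<theta> (Suc i) - \<theta> 0)"
    have IH: "\<theta> (Suc i) = \<theta> 1 + \<kappa> * (\<theta> i - \<theta> 0)" using Suc by simp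
    have rec: "\<theta> i + \<theta> (Suc (Suc i)) = \<beta> * \<theta> (Suc i) + \<gamma>" using recurrence Suc.prems by simp
    have "conic \<beta> \<gamma> \<rho> (\<theta> (Suc i)) ?l = 0" "conic \<beta> \<gamma> \<rho> (\<theta> i) (\<theta> (Suc i)) = 0"
      using on on_conic Suc.prems by auto
    hence "(?l - \<theta> i) * (?l - \<theta> (Suc (Suc i))) = 0"
      using rec unfolding conic_def by algebra
    moreover have "?l \<noteq> \<theta> i"
    proof
      assume "?l = \<theta> i"
      hence "\<theta> i - \<theta> (Suc i) = ?l - (\<theta> 1 + \<kappa> * (\<theta> i - \<theta> 0))" using IH by metis
      hence "(\<kappa> + 1) * (\<theta> i - \<theta> (Suc i)) = 0" by algebra
      thus False using k1 distinct[of i "Suc i"] Suc.prems by (auto simp: add_eq_0_iff2)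
    qed
    ultimately show ?case by simp
  qed
qed

text \<open>Removing the node \<open>\<theta> e\<close> from the system: division by \<open>\<theta> i - \<theta> e\<close> keeps the relations polynomial
  because the new numerators vanish at \<open>\<theta> e\<close>. The parameter \<open>a\<close> is \<open>1\<close> when the last index drops
  by one and \<open>0\<close> when it drops by two.\<close>

lemma system_step:
  assumes sys: "quadratic_system e \<theta> B C" and e: "e' < e" "e \<le> d"
    and a: "a * \<theta> e' + \<theta> (Suc e') = a * \<theta> e + \<theta> (e - 1)"
  defines "B' \<equiv> \<lambda>i. B i * ((a * \<theta> i + \<theta> (Suc i) - a * \<theta> e - \<theta> (e - 1)) / (\<theta> i - \<theta> e))"
    and "C' \<equiv> \<lambda>i. C i * ((a * \<theta> i + \<theta> (i - 1) - a * \<theta> e - \<theta> (e - 1)) / (\<theta> i - \<theta> e))"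
  shows "quadratic_system e' \<theta> B' C'"
proof -
  obtain p1 where p1: "degree p1 \<le> 1" "\<And>i. i \<le> e \<Longrightarrow> C i - B i = poly p1 (\<theta> i)"
    and C0: "C 0 = 0" and Be: "B e = 0"
    using sys unfolding quadratic_system_def affine_system_def by blast
  obtain p2 where p2: "degree p2 \<le> 2"
    "\<And>i. i \<le> e \<Longrightarrow> C i * (\<theta> (i - 1) - \<theta> i) + B i * (\<theta> i - \<theta> (Suc i)) = poly p2 (\<theta> i)"
    using sys unfolding quadratic_system_def by blast
  define c where "c = a * \<theta> e + \<theta> (e - 1)"
  \<comment> \<open>On the conic the square of a gap is an affine function of the gap, with
    coefficients that are polynomials in the node. So a relation for squared gaps follows from the
    two given ones, with degree at most 3.\<close>
  define p3 where "p3 = [:\<gamma>, \<beta> - 2:] * p2 + [:\<rho>, 2 * \<gamma>, \<beta> - 2:] * p1"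
  have dp3: "degree p3 \<le> 3"
    unfolding p3_def using p1(1) p2(1)
    by (intro degree_add_le order_trans[OF degree_mult_le]) (auto intro: order_trans[OF add_mono])
  have p3: "C i * (\<theta> (i - 1) - \<theta> i)\<^sup>2 - B i * (\<theta> i - \<theta> (Suc i))\<^sup>2 = poly p3 (\<theta> i)" if i: "i \<le> e" for i
  proof -
    have 1: "C i * (\<theta> (i - 1) - \<theta> i)\<^sup>2 = ((\<beta> - 2) * \<theta> i + \<gamma>) * (C i * (\<theta> (i - 1) - \<theta> i))
        + ((\<beta> - 2) * (\<theta> i)\<^sup>2 + 2 * \<gamma> * \<theta> i + \<rho>) * C i"
    proof (cases i)
      case 0 thus ?thesis using C0 by simp
    next
      case (Suc j)
      have "conic \<beta> \<gamma> \<rho> (\<theta> j) (\<theta> (Suc j)) = 0" using on_conic[of j] i e Suc by simp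
      moreover have "i - 1 = j" using Suc by simp
      ultimately show ?thesis unfolding conic_def Suc[symmetric] \<open>i - 1 = j\<close> by algebra
    qed
    have 2: "B i * (\<theta> i - \<theta> (Suc i))\<^sup>2 = - ((\<beta> - 2) * \<theta> i + \<gamma>) * (B i * (\<theta> i - \<theta> (Suc i)))
        + ((\<beta> - 2) * (\<theta> i)\<^sup>2 + 2 * \<gamma> * \<theta> i + \<rho>) * B i"
    proof (cases "i = e")
      case True thus ?thesis using Be by simp
    next
      case False
      hence "conic \<beta> \<gamma> \<rho> (\<theta> i) (\<theta> (Suc i)) = 0" using on_conic[of i] i e by simp
      thus ?thesis unfolding conic_def by algebra
    qed
    have "poly p3 (\<theta> i) = ((\<beta> - 2) * \<theta> i + \<gamma>) * poly p2 (\<theta> i) + ((\<beta> - 2) * (\<theta> i)\<^sup>2 + 2 * \<gamma> * \<theta> i + \<rho>) * poly p1 (\<theta> i)"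
      unfolding p3_def by (simp add: algebra_simps power2_eq_square)
    thus ?thesis unfolding p1(2)[OF i, symmetric] p2(2)[OF i, symmetric] 1 2
      by (simp add: algebra_simps)
  qed
  \<comment> \<open>\<open>c\<close> makes the numerator of \<open>C'\<close> vanish at
    \<open>e\<close>; with \<open>B e = 0\<close>, both \<open>q1\<close> and \<open>q2\<close>
    below vanish at \<open>\<theta> e\<close>, and the division lowers their degrees again.\<close>
  have ce: "C e * (a * \<theta> e + \<theta> (e - 1) - c) = 0" by (simp add: c_def)
  define q1 where "q1 = [:- c, a + 1:] * p1 + p2"
  have q1: "C i * (a * \<theta> i + \<theta> (i - 1) - c) - B i * (a * \<theta> i + \<theta> (Suc i) - c) = poly q1 (\<theta> i)" if "i \<le> e" for i
    unfolding q1_def by (simp add: p1(2)[OF that, symmetric] p2(2)[OF that, symmetric] algebra_simps)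
  define q2 where "q2 = [:- c, a + 1:] * p2 + p3"
  have q2: "C i * (a * \<theta> i + \<theta> (i - 1) - c) * (\<theta> (i - 1) - \<theta> i)
      + B i * (a * \<theta> i + \<theta> (Suc i) - c) * (\<theta> i - \<theta> (Suc i)) = poly q2 (\<theta> i)" if "i \<le> e" for i
    unfolding q2_def
    by (simp add: p2(2)[OF that, symmetric] p3[OF that, symmetric] algebra_simps power2_eq_square)
  have dq1: "degree q1 \<le> Suc 1"
    unfolding q1_def using p1(1) p2(1)
    by (intro degree_add_le order_trans[OF degree_mult_le]) (auto intro: order_trans[OF add_mono])
  have dq2: "degree q2 \<le> Suc 2"
    unfolding q2_def using dp3 p2(1)
    by (intro degree_add_le order_trans[OF degree_mult_le]) (auto intro: order_trans[OF add_mono])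
  have z: "poly q1 (\<theta> e) = 0" "poly q2 (\<theta> e) = 0"
    using q1[of e] q2[of e] ce Be by (simp_all add: c_def)
  obtain r1 where r1: "degree r1 \<le> 1" "\<And>x. poly q1 x = (x - \<theta> e) * poly r1 x"
    using linear_factor_bounded_degree[OF dq1 z(1)] by blast
  obtain r2 where r2: "degree r2 \<le> 2" "\<And>x. poly q2 x = (x - \<theta> e) * poly r2 x"
    using linear_factor_bounded_degree[OF dq2 z(2)] by blast
  have ne: "\<theta> i - \<theta> e \<noteq> 0" if "i \<le> e'" for i using distinct[of i e] that e by auto
  have B': "B' i = B i * (a * \<theta> i + \<theta> (Suc i) - c) / (\<theta> i - \<theta> e)"
    and C': "C' i = C i * (a * \<theta> i + \<theta> (i - 1) - c) / (\<theta> i - \<theta> e)" for i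
    unfolding B'_def C'_def c_def by (simp_all add: algebra_simps)
  have "C' i - B' i = poly r1 (\<theta> i)" if "i \<le> e'" for i
  proof -
    have "C' i - B' i = poly q1 (\<theta> i) / (\<theta> i - \<theta> e)"
      unfolding B' C' using q1[of i] that e by (simp add: diff_divide_distrib[symmetric])
    thus ?thesis using r1(2) ne[OF that] by simp
  qed
  moreover have "C' i * (\<theta> (i - 1) - \<theta> i) + B' i * (\<theta> i - \<theta> (Suc i)) = poly r2 (\<theta> i)" if "i \<le> e'" for i
  proof -
    have "C' i * (\<theta> (i - 1) - \<theta> i) + B' i * (\<theta> i - \<theta> (Suc i)) = poly q2 (\<theta> i) / (\<theta> i - \<theta> e)"
      unfolding B' C' using q2[of i] that e by (simp add: add_divide_distrib[symmetric])
    thus ?thesis using r2(2) ne[OF that] by simp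
  qed
  \<comment> \<open>The hypothesis on \<open>a\<close> says exactly that the numerator of
    \<open>B'\<close> vanishes at \<open>e'\<close>, which makes \<open>e'\<close> the new last
    index.\<close>
  moreover have "C' 0 = 0" "B' e' = 0" using C0 a by (simp_all add: C'_def B'_def)
  ultimately show ?thesis
    unfolding quadratic_system_def affine_system_def using r1(1) r2(1) by blast
qed

text \<open>Iterates \<open>system_step\<close> with \<open>a = 1\<close>. The numerator for
  \<open>B\<close> at \<open>i\<close> is the one for \<open>C\<close> at \<open>Suc i\<close>, so
  balance persists once the weights are multiplied by
  \<open>\<theta> i - \<theta> l\<close>.\<close>

lemma single_steps:
  assumes sys: "quadratic_system d \<theta> B C" "detailed_balance d wt B C" and e: "e \<le> d"
  shows "quadratic_system e \<theta>
      (\<lambda>i. B i * (\<Prod>l\<in>{e<..d}. (\<theta> i + \<theta> (Suc i) - \<theta> l - \<theta> (l - 1)) / (\<theta> i - \<theta> l)))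
      (\<lambda>i. C i * (\<Prod>l\<in>{e<..d}. (\<theta> i + \<theta> (i - 1) - \<theta> l - \<theta> (l - 1)) / (\<theta> i - \<theta> l)))
    \<and> detailed_balance e (\<lambda>i. wt i * (\<Prod>l\<in>{e<..d}. \<theta> i - \<theta> l))
      (\<lambda>i. B i * (\<Prod>l\<in>{e<..d}. (\<theta> i + \<theta> (Suc i) - \<theta> l - \<theta> (l - 1)) / (\<theta> i - \<theta> l)))
      (\<lambda>i. C i * (\<Prod>l\<in>{e<..d}. (\<theta> i + \<theta> (i - 1) - \<theta> l - \<theta> (l - 1)) / (\<theta> i - \<theta> l)))"
  using e
proof (induction e rule: inc_induct)
  case base thus ?case using sys by simp
next
  case (step e)
  have ins: "{e<..d} = insert (Suc e) {Suc e<..d}" using step.hyps by auto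
  let ?B = "\<lambda>i. B i * (\<Prod>l\<in>{Suc e<..d}. (\<theta> i + \<theta> (Suc i) - \<theta> l - \<theta> (l - 1)) / (\<theta> i - \<theta> l))"
  let ?C = "\<lambda>i. C i * (\<Prod>l\<in>{Suc e<..d}. (\<theta> i + \<theta> (i - 1) - \<theta> l - \<theta> (l - 1)) / (\<theta> i - \<theta> l))"
  let ?w = "\<lambda>i. wt i * (\<Prod>l\<in>{Suc e<..d}. \<theta> i - \<theta> l)"
  have q: "quadratic_system (Suc e) \<theta> ?B ?C" and b: "detailed_balance (Suc e) ?w ?B ?C"
    using step.IH by auto
  let ?N = "\<lambda>i. \<theta> i + \<theta> (Suc i) - \<theta> (Suc e) - \<theta> (Suc e - 1)"
  let ?N' = "\<lambda>i. \<theta> i + \<theta> (i - 1) - \<theta> (Suc e) - \<theta> (Suc e - 1)"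
  have 1: "quadratic_system e \<theta> (\<lambda>i. ?B i * (?N i / (\<theta> i - \<theta> (Suc e))))
     (\<lambda>i. ?C i * (?N' i / (\<theta> i - \<theta> (Suc e))))"
    using system_step[OF q, of e 1] step.hyps by simp
  have 2: "detailed_balance e (\<lambda>i. ?w i * (\<theta> i - \<theta> (Suc e)))
     (\<lambda>i. ?B i * (?N i / (\<theta> i - \<theta> (Suc e)))) (\<lambda>i. ?C i * (?N' i / (\<theta> i - \<theta> (Suc e))))"
    unfolding detailed_balance_def
  proof (intro allI impI)
    fix i assume i: "i < e"
    have ne: "\<theta> i - \<theta> (Suc e) \<noteq> 0" "\<theta> (Suc i) - \<theta> (Suc e) \<noteq> 0"
      using distinct[of i "Suc e"] distinct[of "Suc i" "Suc e"] i step.hyps by auto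
    have wb: "?w i * ?B i = ?w (Suc i) * ?C (Suc i)"
      using b i unfolding detailed_balance_def by simp
    have N: "?N i = ?N' (Suc i)" by simp
    show "?w i * (\<theta> i - \<theta> (Suc e)) * (?B i * (?N i / (\<theta> i - \<theta> (Suc e))))
      = ?w (Suc i) * (\<theta> (Suc i) - \<theta> (Suc e)) * (?C (Suc i) * (?N' (Suc i) / (\<theta> (Suc i) - \<theta> (Suc e))))"
      unfolding cancel_denominator[OF ne(1)] cancel_denominator[OF ne(2)] wb N ..
  qed
  have prod: "prod g {e<..d} = prod g {Suc e<..d} * g (Suc e)" for g :: "nat \<Rightarrow> 'a"
    unfolding ins by (simp add: mult.commute)
  show ?case unfolding prod using 1 2 by (simp only: mult.assoc)
qed

text \<open>Iterates \<open>system_step\<close> with \<open>a = 0\<close>; step \<open>j\<close>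
  removes \<open>\<theta> (s - 2 * j)\<close> and the node before it. The numerators of
  \<open>B i\<close> and \<open>C (Suc i)\<close> now differ, and the weight factors of the second
  removed node compensate for this crosswise.\<close>

lemma double_steps:
  assumes sys: "quadratic_system s \<theta> B C" "detailed_balance s wt B C" and s: "s \<le> d" "2 * m \<le> s"
  shows "quadratic_system (s - 2 * m) \<theta>
      (\<lambda>i. B i * (\<Prod>j<m. (\<theta> (Suc i) - \<theta> (s - 2 * j - 1)) / (\<theta> i - \<theta> (s - 2 * j))))
      (\<lambda>i. C i * (\<Prod>j<m. (\<theta> (i - 1) - \<theta> (s - 2 * j - 1)) / (\<theta> i - \<theta> (s - 2 * j))))
    \<and> detailed_balance (s - 2 * m) (\<lambda>i. wt i * (\<Prod>l\<in>{s - 2 * m<..s}. \<theta> i - \<theta> l))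
      (\<lambda>i. B i * (\<Prod>j<m. (\<theta> (Suc i) - \<theta> (s - 2 * j - 1)) / (\<theta> i - \<theta> (s - 2 * j))))
      (\<lambda>i. C i * (\<Prod>j<m. (\<theta> (i - 1) - \<theta> (s - 2 * j - 1)) / (\<theta> i - \<theta> (s - 2 * j))))"
  using s(2)
proof (induction m)
  case 0 thus ?case using sys by simp
next
  case (Suc m)
  define e where "e = s - 2 * m"
  define e' where "e' = s - 2 * Suc m"
  have e: "e = Suc (Suc e')" "e \<le> d" using Suc.prems s(1) by (auto simp: e_def e'_def)
  have ins: "{e'<..s} = insert e (insert (Suc e') {e<..s})" using e Suc.prems by (auto simp: e_def e'_def)
  let ?B = "\<lambda>i. B i * (\<Prod>j<m. (\<theta> (Suc i) - \<theta> (s - 2 * j - 1)) / (\<theta> i - \<theta> (s - 2 * j)))"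
  let ?C = "\<lambda>i. C i * (\<Prod>j<m. (\<theta> (i - 1) - \<theta> (s - 2 * j - 1)) / (\<theta> i - \<theta> (s - 2 * j)))"
  let ?w = "\<lambda>i. wt i * (\<Prod>l\<in>{e<..s}. \<theta> i - \<theta> l)"
  have q: "quadratic_system e \<theta> ?B ?C" and b: "detailed_balance e ?w ?B ?C"
    using Suc.IH Suc.prems unfolding e_def by auto
  have 1: "quadratic_system e' \<theta> (\<lambda>i. ?B i * ((\<theta> (Suc i) - \<theta> (Suc e')) / (\<theta> i - \<theta> e)))
     (\<lambda>i. ?C i * ((\<theta> (i - 1) - \<theta> (Suc e')) / (\<theta> i - \<theta> e)))"
    using system_step[OF q, of e' 0] e by simp
  have 2: "detailed_balance e' (\<lambda>i. ?w i * (\<theta> i - \<theta> (Suc e')) * (\<theta> i - \<theta> e))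
     (\<lambda>i. ?B i * ((\<theta> (Suc i) - \<theta> (Suc e')) / (\<theta> i - \<theta> e)))
     (\<lambda>i. ?C i * ((\<theta> (i - 1) - \<theta> (Suc e')) / (\<theta> i - \<theta> e)))"
    unfolding detailed_balance_def
  proof (intro allI impI)
    fix i assume i: "i < e'"
    have ne: "\<theta> i - \<theta> e \<noteq> 0" "\<theta> (Suc i) - \<theta> e \<noteq> 0"
      using distinct[of i e] distinct[of "Suc i" e] i e by auto
    have wb: "?w i * ?B i = ?w (Suc i) * ?C (Suc i)"
      using b i e unfolding detailed_balance_def by simp
    show "?w i * (\<theta> i - \<theta> (Suc e')) * (\<theta> i - \<theta> e) * (?B i * ((\<theta> (Suc i) - \<theta> (Suc e')) / (\<theta> i - \<theta> e)))
      = ?w (Suc i) * (\<theta> (Suc i) - \<theta> (Suc e')) * (\<theta> (Suc i) - \<theta> e) * (?C (Suc i) * ((\<theta> (Suc i - 1) - \<theta> (Suc e')) / (\<theta> (Suc i) - \<theta> e)))"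
      unfolding cancel_denominator[OF ne(1)] cancel_denominator[OF ne(2)]
      unfolding diff_Suc_1 by (rule exchange_in_balance[OF wb[unfolded diff_Suc_1]])
  qed
  have prod: "prod g {e'<..s} = prod g {e<..s} * (g (Suc e') * g e)" for g :: "nat \<Rightarrow> 'a"
    unfolding ins using e(1) by (simp add: mult_ac)
  have idx: "s - 2 * m = e" "e - 1 = Suc e'" using e by (auto simp: e_def)
  show ?case unfolding e'_def[symmetric] prod prod.lessThan_Suc idx using 1 2 by (simp only: mult.assoc)
qed

end

section \<open>Comparison of a system with one on fewer nodes\<close>

locale nested_systems = conic_sequence +
  fixes w :: nat and wt wt' B C B' C' :: "nat \<Rightarrow> 'a::field" and s :: 'a
  assumes w: "2 \<le> w" "w < d"
    and system: "quadratic_system d \<theta> B C" "detailed_balance d wt B C"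
    and subsystem: "affine_system w \<theta> B' C'" "detailed_balance w wt' B' C'"
    and weights: "\<And>i. i \<le> w \<Longrightarrow> wt' i = s * (wt i * (\<Prod>l\<in>{w<..d}. \<theta> i - \<theta> l))"
    and weights_nonzero: "\<And>i. i \<le> w \<Longrightarrow> wt' i \<noteq> 0" "(\<Sum>i\<le>w. wt' i) \<noteq> 0"
    and C1: "C' 1 = C 1"
    and C_nonzero: "\<And>i. 1 \<le> i \<Longrightarrow> i \<le> w \<Longrightarrow> C i \<noteq> 0"
begin

text \<open>\<open>\<Phi>\<close> is the accumulated factor of some chain of removals ending at
  \<open>w\<close>. The functions \<open>C * \<Phi>\<close> and \<open>C'\<close> belong to affine
  systems in balance with the same weights, so they are proportional; \<open>C' 1 = C 1\<close>
  eliminates the scalar.\<close>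

lemma scaled_factors:
  assumes "quadratic_system w \<theta> B'' (\<lambda>i. C i * \<Phi> i)"
    and "detailed_balance w (\<lambda>i. wt i * (\<Prod>l\<in>{w<..d}. \<theta> i - \<theta> l)) B'' (\<lambda>i. C i * \<Phi> i)"
    and h: "1 \<le> h" "h \<le> w"
  shows "C h * \<Phi> h = C' h * \<Phi> 1"
proof -
  have "detailed_balance w wt' B'' (\<lambda>i. C i * \<Phi> i)"
    using assms(2) unfolding detailed_balance_def by (auto simp: weights mult.assoc)
  moreover have "affine_system w \<theta> B'' (\<lambda>i. C i * \<Phi> i)"
    using assms(1) unfolding quadratic_system_def by simp
  ultimately have "(C h * \<Phi> h) * C' 1 = C' h * (C 1 * \<Phi> 1)"
    using affine_system_unique[OF _ _ subsystem weights_nonzero h] by blast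
  hence "C 1 * (C h * \<Phi> h - C' h * \<Phi> 1) = 0" using C1 by algebra
  thus ?thesis using C_nonzero[of 1] w by simp
qed

text \<open>When the gaps form a geometric progression, every single-step factor is
  \<open>1 + q\<close>, so the accumulated factor does not depend on the height.\<close>

lemma subsystem_agrees_if_geometric:
  assumes geo: "\<And>i. i < d \<Longrightarrow> \<theta> i = q * \<theta> (Suc i) + c" and h: "1 \<le> h" "h \<le> w"
  shows "C' h = C h"
proof -
  have q1: "1 + q \<noteq> 0"
  proof
    assume "1 + q = 0"
    hence "\<theta> 0 = \<theta> 2" using geo[of 0] geo[of 1] w 
      by (simp add: numeral_2_eq_2) algebra
    thus False using distinct[of 0 2] w by simp
  qed
  have f: "(\<Prod>l\<in>{w<..d}. (\<theta> i + \<theta> (i - 1) - \<theta> l - \<theta> (l - 1)) / (\<theta> i - \<theta> l)) = (1 + q) ^ (d - w)"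
    if i: "1 \<le> i" "i \<le> w" for i
  proof -
    have "(\<theta> i + \<theta> (i - 1) - \<theta> l - \<theta> (l - 1)) / (\<theta> i - \<theta> l) = 1 + q" if l: "l \<in> {w<..d}" for l
    proof -
      have "\<theta> (i - 1) = q * \<theta> i + c" "\<theta> (l - 1) = q * \<theta> l + c"
        using geo[of "i - 1"] geo[of "l - 1"] i l w by auto
      hence "\<theta> i + \<theta> (i - 1) - \<theta> l - \<theta> (l - 1) = (1 + q) * (\<theta> i - \<theta> l)" by algebra
      moreover have "\<theta> i - \<theta> l \<noteq> 0" using distinct[of i l] i l w by auto
      ultimately show ?thesis by simp
    qed
    thus ?thesis by simp
  qed
  have "C h * (1 + q) ^ (d - w) = C' h * (1 + q) ^ (d - w)"
    using scaled_factors[OF conjunct1 conjunct2, OF single_steps single_steps, OF system _ system _ h] f[of h] f[of 1] h w by simp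
  thus ?thesis using q1 by simp
qed

text \<open>For \<open>\<beta> = - 2\<close> (the Bannai--Ito case) the factors of the single steps can vanish, so the nodes are
  removed two at a time, with one single step first if \<open>d - w\<close> is odd. Otherwise the factors \<open>f i l\<close>
  depend only on \<open>i + l\<close>, and their products telescope.\<close>

lemma geometric_if_subsystem_agrees:
  assumes agree: "\<And>h. 1 \<le> h \<Longrightarrow> h \<le> w \<Longrightarrow> C' h = C h"
  obtains q c where "q \<noteq> 0" "\<And>i. i < d \<Longrightarrow> \<theta> i = q * \<theta> (Suc i) + c"
proof -
  have \<Phi>: "\<Phi> 2 = \<Phi> 1"
    if "quadratic_system w \<theta> B'' (\<lambda>i. C i * \<Phi> i)"
    "detailed_balance w (\<lambda>i. wt i * (\<Prod>l\<in>{w<..d}. \<theta> i - \<theta> l)) B'' (\<lambda>i. C i * \<Phi> i)" for B'' \<Phi>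
    using scaled_factors[OF that, of 2] agree[of 2] C_nonzero[of 2] w by simp
  have ne: "\<theta> i - \<theta> l \<noteq> 0" if "i \<le> d" "l \<le> d" "i \<noteq> l" for i l
    using distinct[OF that(1,2)] that(3) by auto
  show ?thesis
  proof (cases "\<beta> = - 2")
    case True
    \<comment> \<open>For \<open>\<beta> = - 2\<close> the recurrence reads
      \<open>\<sigma> i + \<sigma> (Suc i) = \<gamma>\<close>. So sums of adjacent nodes alternate
      between two values, which differ because \<open>\<theta> i\<close> and
      \<open>\<theta> (Suc (Suc i))\<close> do.\<close>
    define \<sigma> where "\<sigma> i = \<theta> i + \<theta> (Suc i)" for i
    have pred: "\<sigma> (i - 1) = \<theta> (i - 1) + \<theta> i" if "1 \<le> i" for i
      using that by (simp add: \<sigma>_def)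
    have rec: "\<sigma> i + \<sigma> (Suc i) = \<gamma>" if "Suc i < d" for i
      using recurrence[OF that] True unfolding \<sigma>_def by algebra
    have \<sigma>2: "\<sigma> (Suc (Suc i)) = \<sigma> i" if "Suc (Suc i) < d" for i
    proof -
      have "\<sigma> i + \<sigma> (Suc i) = \<sigma> (Suc i) + \<sigma> (Suc (Suc i))" using rec[of i] rec[of "Suc i"] that by simp
      thus ?thesis by algebra
    qed
    have even: "\<sigma> (i + 2 * j) = \<sigma> i" if "i + 2 * j < d" for i j
      using that by (induction j) (auto simp: \<sigma>2)
    have same: "\<sigma> i = \<sigma> j" if "even (i + j)" "i < d" "j < d" for i j
      using that
    proof (induction i j rule: linorder_wlog)
      case (le i j)
      hence "j = i + 2 * ((j - i) div 2)" by auto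
      thus ?case using even[of i "(j - i) div 2"] le by simp
    qed (simp add: add.commute)
    have diff: "\<sigma> i \<noteq> \<sigma> j" if "odd (i + j)" "i < d" "j < d" for i j
    proof -
      have succ: "\<sigma> i \<noteq> \<sigma> (Suc i)" if "Suc i < d" for i
        using ne[of i "Suc (Suc i)"] that unfolding \<sigma>_def by auto
      have "\<sigma> 0 \<noteq> \<sigma> 1" using succ[of 0] w by simp
      moreover have par: "\<sigma> k = (if even k then \<sigma> 0 else \<sigma> 1)" if "k < d" for k
      proof (cases "even k")
        case True thus ?thesis using same[of k 0] that by simp
      next
        case False thus ?thesis using same[of k 1] that w by simp
      qed
      ultimately show ?thesis using that(1) unfolding par[OF that(2)] par[OF that(3)] by auto
    qed
    have False
    proof (cases "even (d - w)")
      case ev: True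
      define m where "m = (d - w) div 2"
      have dw: "d - 2 * m = w" "2 * m \<le> d" using ev w by (auto simp: m_def)
      define \<Phi> where "\<Phi> i = (\<Prod>j<m. (\<theta> (i - 1) - \<theta> (d - 2 * j - 1)) / (\<theta> i - \<theta> (d - 2 * j)))" for i
      have "\<Phi> 2 = \<Phi> 1"
        by (rule \<Phi>) (use double_steps[OF system, of m] dw in \<open>auto simp: \<Phi>_def\<close>)
      \<comment> \<open>Here \<open>i - 1\<close> and \<open>d - 2 * j - 1\<close> have equal
        parity, so their values of \<open>\<sigma>\<close> agree and each numerator is minus its
        denominator.\<close>
      have 1: "\<Phi> i = (-1) ^ m" if i: "even (i + d)" "1 \<le> i" "i \<le> 2" for i
      proof -
        have "(\<theta> (i - 1) - \<theta> (d - 2 * j - 1)) / (\<theta> i - \<theta> (d - 2 * j)) = -1" if j: "j < m" for j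
        proof -
          have dj: "2 * j < d - 2" using dw w j by linarith
          hence "even (i - 1 + (d - 2 * j - 1))" "i - 1 < d" "d - 2 * j - 1 < d" using i w by auto
          from same[OF this] have "\<theta> (i - 1) + \<theta> i = \<theta> (d - 2 * j - 1) + \<theta> (d - 2 * j)"
            using pred[of i] pred[of "d - 2 * j"] i dj by simp
          hence "\<theta> (i - 1) - \<theta> (d - 2 * j - 1) = - (\<theta> i - \<theta> (d - 2 * j))" by algebra
          moreover have "\<theta> i - \<theta> (d - 2 * j) \<noteq> 0" using ne[of i "d - 2 * j"] i dj w dw j by auto
          ultimately show ?thesis by (simp add: divide_eq_eq)
        qed
        thus ?thesis unfolding \<Phi>_def by simp
      qed
      \<comment> \<open>In the other parity each numerator is minus the denominator of the next
        factor, so the product telescopes.\<close>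
      have 2: "\<Phi> i * (\<theta> i - \<theta> d) = (-1) ^ m * (\<theta> i - \<theta> w)" if i: "odd (i + d)" "1 \<le> i" "i \<le> 2" for i
      proof -
        have "(\<Prod>j<n. (\<theta> (i - 1) - \<theta> (d - 2 * j - 1)) / (\<theta> i - \<theta> (d - 2 * j))) * (\<theta> i - \<theta> d)
          = (-1) ^ n * (\<theta> i - \<theta> (d - 2 * n))" if "n \<le> m" for n
          using that
        proof (induction n)
          case (Suc n)
          have dn: "2 * n < d - 2" using dw w Suc.prems by linarith
          hence "even (i - 1 + (d - 2 * n - 1 - 1))" "i - 1 < d" "d - 2 * n - 1 - 1 < d" using i w by auto
          from same[OF this] have "\<theta> (i - 1) + \<theta> i = \<theta> (d - 2 * Suc n) + \<theta> (d - 2 * n - 1)"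
            using pred[of i] pred[of "d - 2 * n - 1"] i dn by simp
          hence "\<theta> (i - 1) - \<theta> (d - 2 * n - 1) = - (\<theta> i - \<theta> (d - 2 * Suc n))" by algebra
          moreover have "\<theta> i - \<theta> (d - 2 * n) \<noteq> 0" using ne[of i "d - 2 * n"] i dn w dw Suc.prems by auto
          moreover have "p * (y / x) * a = - (t * z)" if "p * a = t * x" "y = - z" "x \<noteq> 0" for p a t x y z :: 'a
          proof -
            have "p * (y / x) * a = (p * a) * y / x" by simp
            thus ?thesis using that by simp
          qed
          ultimately show ?case using Suc by (simp, simp add: right_diff_distrib)
        qed simp
        from this[of m] show ?thesis unfolding \<Phi>_def dw by simp
      qed
      \<comment> \<open>One of 1 and 2 falls under each case; comparing the two products identifies
        \<open>\<theta> d\<close> with \<open>\<theta> w\<close>.\<close>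
      have "\<exists>i. odd (i + d) \<and> 1 \<le> i \<and> i \<le> 2 \<and> even (3 - i + d) \<and> 1 \<le> 3 - i \<and> 3 - i \<le> 2"
        by (rule exI[of _ "if even d then 1 else 2"]) auto
      then obtain i where i: "odd (i + d)" "1 \<le> i" "i \<le> 2" "even (3 - i + d)" "1 \<le> 3 - i" "3 - i \<le> 2" by blast
      hence "i = 1 \<or> i = 2" by auto
      hence "\<Phi> i = \<Phi> (3 - i)" using \<open>\<Phi> 2 = \<Phi> 1\<close> by auto
      hence "(-1) ^ m * (\<theta> i - \<theta> d) = (-1) ^ m * (\<theta> i - \<theta> w)" using 2[OF i(1-3)] 1[OF i(4-6)] by simp
      hence "\<theta> d = \<theta> w" by simp
      thus False using ne[of d w] w by simp
    next
      case od: False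
      \<comment> \<open>Node \<open>d\<close> goes by a single step, then pairs go from
        \<open>d - 1\<close> down. The factors \<open>\<Psi>\<close> of the pairs are nonzero,
        whereas the numerator of the single step is
        \<open>\<sigma> (i - 1) - \<sigma> (d - 1)\<close>, which vanishes for exactly one of
        \<open>i = 1\<close> and \<open>i = 2\<close>.\<close>
      define m where "m = (d - 1 - w) div 2"
      have dw: "d - 1 - 2 * m = w" "2 * m \<le> d - 1" using od w by (auto simp: m_def elim: oddE)
      define \<Psi> where "\<Psi> i = (\<Prod>j<m. (\<theta> (i - 1) - \<theta> (d - 1 - 2 * j - 1)) / (\<theta> i - \<theta> (d - 1 - 2 * j)))" for i
      have d1: "{d - 1<..d} = {d}" "insert d {w<..d - 1} = {w<..d}" using w by auto
      have pr: "(\<Prod>l\<in>{w<..d}. \<theta> i - \<theta> l) = (\<theta> i - \<theta> d) * (\<Prod>l\<in>{w<..d - 1}. \<theta> i - \<theta> l)" for i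
        unfolding d1(2)[symmetric] using w by simp
      have "d - 1 \<le> d" by simp
      note single = single_steps[OF system this, unfolded d1(1), simplified prod.insert finite.emptyI prod.empty empty_iff not_False_eq_True mult_1_right]
      note double = double_steps[OF conjunct1[OF single] conjunct2[OF single] \<open>d - 1 \<le> d\<close> dw(2), unfolded dw(1)]
      let ?g = "\<lambda>i. (\<theta> i + \<theta> (i - 1) - \<theta> d - \<theta> (d - 1)) / (\<theta> i - \<theta> d)"
      have "?g 2 * \<Psi> 2 = ?g 1 * \<Psi> 1"
        by (rule \<Phi>[OF double[THEN conjunct1, unfolded mult.assoc, folded \<Psi>_def] double[THEN conjunct2, unfolded mult.assoc, folded pr \<Psi>_def]])
      moreover have "\<Psi> i \<noteq> 0" if i: "1 \<le> i" "i \<le> 2" for i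
        unfolding \<Psi>_def using ne i dw w by auto
      moreover have "\<theta> 2 + \<theta> (2 - 1) - \<theta> d - \<theta> (d - 1) = \<sigma> 1 - \<sigma> (d - 1)"
        "\<theta> 1 + \<theta> (1 - 1) - \<theta> d - \<theta> (d - 1) = \<sigma> 0 - \<sigma> (d - 1)"
        using w by (simp_all add: \<sigma>_def numeral_2_eq_2)
      moreover have "\<theta> 2 - \<theta> d \<noteq> 0" "\<theta> 1 - \<theta> d \<noteq> 0" using ne w by auto
      ultimately have "\<sigma> 1 - \<sigma> (d - 1) = 0 \<longleftrightarrow> \<sigma> 0 - \<sigma> (d - 1) = 0" by auto
      hence iff: "\<sigma> 1 = \<sigma> (d - 1) \<longleftrightarrow> \<sigma> 0 = \<sigma> (d - 1)" by simp
      show False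
      proof (cases "even d")
        case True
        have "\<sigma> 1 = \<sigma> (d - 1)" by (rule same) (use True w in auto)
        moreover have "\<sigma> 0 \<noteq> \<sigma> (d - 1)" by (rule diff) (use True w in auto)
        ultimately show False using iff by simp
      next
        case False
        have "\<sigma> 0 = \<sigma> (d - 1)" by (rule same) (use False w in auto)
        moreover have "\<sigma> 1 \<noteq> \<sigma> (d - 1)" by (rule diff) (use False w in auto)
        ultimately show False using iff by simp
      qed
    qed
    thus ?thesis ..
  next
    case False
    define f where "f i l = (\<theta> i + \<theta> (i - 1) - \<theta> l - \<theta> (l - 1)) / (\<theta> i - \<theta> l)" for i l
    \<comment> \<open>\<open>f i l\<close> is 1 plus the quotient of
      \<open>\<theta> (i - 1) - \<theta> (l - 1)\<close> by \<open>\<theta> i - \<theta> l\<close>,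
      so \<open>parallel_chords\<close> at \<open>\<theta> 1\<close> and \<open>\<theta> l\<close>
      is the required identity.\<close>
    have shift: "f 1 (Suc l) = f 2 l" if l: "w < l" "l < d" for l
    proof -
      have "(\<theta> 0 - \<theta> l) * (\<theta> 2 - \<theta> l) = (\<theta> 1 - \<theta> (l - 1)) * (\<theta> 1 - \<theta> (Suc l))"
      proof (rule parallel_chords)
        show "conic \<beta> \<gamma> \<rho> (\<theta> 1) (\<theta> 0) = 0" "conic \<beta> \<gamma> \<rho> (\<theta> l) (\<theta> (l - 1)) = 0"
          using on_conic[of 0] on_conic[of "l - 1"] l w unfolding conic_def by (simp_all add: algebra_simps)
        show "\<theta> 0 + \<theta> 2 = \<beta> * \<theta> 1 + \<gamma>" "\<theta> (l - 1) + \<theta> (Suc l) = \<beta> * \<theta> l + \<gamma>"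
          using recurrence[of 0] recurrence[of "l - 1"] l w by (simp_all add: numeral_2_eq_2)
      qed
      moreover have "\<theta> 1 - \<theta> (Suc l) \<noteq> 0" "\<theta> 2 - \<theta> l \<noteq> 0" using ne l w by auto
      ultimately show ?thesis unfolding f_def by (simp add: field_simps)
    qed
    \<comment> \<open>On the conic the sum \<open>s\<close> and product \<open>p\<close> of adjacent
      nodes satisfy \<open>s\<^sup>2 - (\<beta> + 2) * p = \<gamma> * s + \<rho>\<close>. So equal
      sums force equal products, hence a common node.\<close>
    have nz: "f 1 l \<noteq> 0" if l: "w < l" "l \<le> d" for l
    proof
      assume "f 1 l = 0"
      hence sum: "\<theta> 1 + \<theta> 0 = \<theta> l + \<theta> (l - 1)" unfolding f_def using ne[of 1 l] l w by (simp add: algebra_simps)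
      have "conic \<beta> \<gamma> \<rho> (\<theta> 0) (\<theta> 1) = 0" "conic \<beta> \<gamma> \<rho> (\<theta> (l - 1)) (\<theta> l) = 0"
        using on_conic[of 0] on_conic[of "l - 1"] l w by auto
      hence "(\<beta> + 2) * ((\<theta> 0 - \<theta> l) * (\<theta> 0 - \<theta> (l - 1))) = 0"
        using sum unfolding conic_def by algebra
      moreover have "\<beta> + 2 \<noteq> 0" using False by (simp add: eq_neg_iff_add_eq_0)
      ultimately show False using ne[of 0 l] ne[of 0 "l - 1"] l w by auto
    qed
    have "(\<Prod>l\<in>{w<..d}. f 2 l) = (\<Prod>l\<in>{w<..d}. f 1 l)"
      unfolding f_def by (rule \<Phi>) (use single_steps[OF system, of w] w in auto)
    moreover have "(\<Prod>l\<in>{w<..d}. f 2 l) = (\<Prod>l\<in>{Suc w<..d}. f 1 l) * f 2 d"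
    proof -
      have "{w<..d} = insert d {w<..<d}" using w by auto
      hence "(\<Prod>l\<in>{w<..d}. f 2 l) = (\<Prod>l\<in>{w<..<d}. f 1 (Suc l)) * f 2 d"
        using shift by simp
      also have "(\<Prod>l\<in>{w<..<d}. f 1 (Suc l)) = (\<Prod>l\<in>Suc ` {w<..<d}. f 1 l)"
        by (subst prod.reindex) auto
      also have "Suc ` {w<..<d} = {Suc w<..d}"
      proof (intro equalityI subsetI)
        fix x assume "x \<in> {Suc w<..d}"
        hence "x = Suc (x - 1)" "x - 1 \<in> {w<..<d}" by auto
        thus "x \<in> Suc ` {w<..<d}" by (rule image_eqI)
      qed auto
      finally show ?thesis .
    qed
    moreover have "(\<Prod>l\<in>{w<..d}. f 1 l) = f 1 (Suc w) * (\<Prod>l\<in>{Suc w<..d}. f 1 l)"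
    proof -
      have "{w<..d} = insert (Suc w) {Suc w<..d}" using w by auto
      thus ?thesis by simp
    qed
    moreover have "(\<Prod>l\<in>{Suc w<..d}. f 1 l) \<noteq> 0" using nz by auto
    ultimately have f: "f 2 d = f 1 (Suc w)" by simp
    define \<kappa> where "\<kappa> = (\<theta> 1 - \<theta> (Suc w)) / (\<theta> 0 - \<theta> w)"
    \<comment> \<open>\<open>y\<close> continues the sequence beyond \<open>\<theta> d\<close> on
      the conic. With it, \<open>f 2 d = f 1 (Suc w)\<close> says that
      \<open>(\<theta> 0, \<theta> 1)\<close>, \<open>(\<theta> w, \<theta> (Suc w))\<close> and
      \<open>(\<theta> d, y)\<close> lie on a line of slope \<open>\<kappa>\<close>.\<close>
    define y where "y = \<beta> * \<theta> d + \<gamma> - \<theta> (d - 1)"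
    have nes: "\<theta> 2 - \<theta> d \<noteq> 0" "\<theta> 1 - \<theta> (Suc w) \<noteq> 0" "\<theta> 0 - \<theta> w \<noteq> 0" "\<theta> 1 - \<theta> (d - 1) \<noteq> 0"
      using ne w by auto
    have con: "conic \<beta> \<gamma> \<rho> (\<theta> d) (\<theta> (d - 1)) = 0"
      using on_conic[of "d - 1"] w unfolding conic_def by (simp add: algebra_simps)
    hence y: "conic \<beta> \<gamma> \<rho> (\<theta> d) y = 0" unfolding conic_def y_def by algebra
    have "(\<theta> 0 - \<theta> d) * (\<theta> 2 - \<theta> d) = (\<theta> 1 - \<theta> (d - 1)) * (\<theta> 1 - y)"
    proof (rule parallel_chords)
      show "conic \<beta> \<gamma> \<rho> (\<theta> 1) (\<theta> 0) = 0"
        using on_conic[of 0] w unfolding conic_def by (simp add: algebra_simps)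
      show "\<theta> 0 + \<theta> 2 = \<beta> * \<theta> 1 + \<gamma>" using recurrence[of 0] w by (simp add: numeral_2_eq_2)
      show "conic \<beta> \<gamma> \<rho> (\<theta> d) (\<theta> (d - 1)) = 0" by (rule con)
      show "\<theta> (d - 1) + y = \<beta> * \<theta> d + \<gamma>" by (simp add: y_def)
    qed
    moreover have "(\<theta> 1 - \<theta> (d - 1)) * (\<theta> 1 - \<theta> (Suc w)) = (\<theta> 0 - \<theta> w) * (\<theta> 2 - \<theta> d)"
      using f nes unfolding f_def by (simp add: field_simps)
    ultimately have "(\<theta> 2 - \<theta> d) * ((\<theta> 0 - \<theta> d) * (\<theta> 1 - \<theta> (Suc w)) - (\<theta> 0 - \<theta> w) * (\<theta> 1 - y)) = 0"
      by algebra
    hence "(\<theta> 0 - \<theta> d) * (\<theta> 1 - \<theta> (Suc w)) = (\<theta> 0 - \<theta> w) * (\<theta> 1 - y)"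
      using nes by simp
    hence line: "y = \<theta> 1 + \<kappa> * (\<theta> d - \<theta> 0)" "\<theta> (Suc w) = \<theta> 1 + \<kappa> * (\<theta> w - \<theta> 0)"
      unfolding \<kappa>_def using nes by (simp_all add: field_simps)
    have "0 < w" "w < d" using w by auto
    note geo = geometric_of_collinear[OF this False y line(2,1)]
    have "\<theta> i = (1 / \<kappa>) * \<theta> (Suc i) + (\<theta> 0 - \<theta> 1 / \<kappa>)" if "i < d" for i
      using geo(1)[OF that] geo(2)[OF that] by (simp add: field_simps)
    moreover have "1 / \<kappa> \<noteq> 0" using geo(2)[of 0] w by simp
    ultimately show ?thesis using that by blast
  qed
qed

end

section \<open>Classical parameters from a geometric progression\<close>

lemma quadratic_poly:
  fixes p :: "'a::field poly"
  assumes "degree p \<le> 2"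
  shows "p = [:coeff p 0, coeff p 1, coeff p 2:]"
proof (rule poly_eqI)
  fix n :: nat
  have "n = 0 \<or> n = 1 \<or> n = 2 \<or> n > 2" by auto
  thus "coeff p n = coeff [:coeff p 0, coeff p 1, coeff p 2:] n"
    using assms by (auto simp: numeral_2_eq_2 coeff_eq_0)
qed

lemma q_number_Suc: "q_number q (Suc i) = 1 + q * q_number q i"
  unfolding q_number_def sum.lessThan_Suc_shift by (simp add: sum_distrib_left)

lemma power_eq_q_number: "q ^ i = 1 + (q - 1) * q_number q i"
proof (induction i)
  case (Suc i)
  show ?case unfolding power_Suc q_number_Suc Suc.IH by (simp add: algebra_simps)
qed (simp add: q_number_def)

lemma power_mult_q_number:
  assumes "i \<le> d"
  shows "q ^ i * q_number q (d - i) = q_number q d - q_number q i"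
proof -
  have "q_number q (i + j) = q_number q i + q ^ i * q_number q j" for j
    by (induction j) (simp_all add: q_number_def algebra_simps power_add)
  from this[of "d - i"] show ?thesis using assms by (simp add: algebra_simps)
qed

lemma geometric_eq_q_number:
  assumes geo: "\<And>i. i < d \<Longrightarrow> \<theta> i = q * \<theta> (Suc i) + r" and i: "i \<le> d"
  shows "\<theta> i = (\<theta> (d - 1) - \<theta> d) * q_number q (d - i) + \<theta> d"
  using i
proof (induction i rule: inc_induct)
  case base thus ?case by (simp add: q_number_def)
next
  case (step n)
  have r: "r = \<theta> (d - 1) - q * \<theta> d" using geo[of "d - 1"] step.hyps by simp
  have "d - n = Suc (d - Suc n)" using step.hyps by simp
  moreover have "\<theta> n = q * ((\<theta> (d - 1) - \<theta> d) * q_number q (d - Suc n) + \<theta> d) + r"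
    using geo[OF step.hyps(2)] unfolding step.IH .
  ultimately show ?case unfolding r by (simp add: q_number_Suc algebra_simps)
qed

text \<open>Multiplication by \<open>q ^ i\<close> turns the gaps into constants and
  \<open>\<theta> i\<close> into an affine function of \<open>q_number q i\<close>. So
  \<open>c i - b i / q\<close> is affine and \<open>c i + b i / q\<^sup>2\<close> is quadratic in
  that number. As \<open>q \<noteq> - 1\<close>, these can be solved for \<open>c i\<close>; then
  \<open>b i\<close> follows, and the boundary values fix the shape.\<close>

lemma classical_form_of_geometric:
  fixes \<theta> b c :: "nat \<Rightarrow> complex"
  assumes geo: "\<And>i. i < d \<Longrightarrow> \<theta> i = q * \<theta> (Suc i) + r" and d: "1 \<le> d"
    and q: "q \<noteq> 0" "q \<noteq> - 1" and ne: "\<theta> (d - 1) \<noteq> \<theta> d"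
    and sys: "quadratic_system d \<theta> (\<lambda>i. b i * (\<theta> i - \<theta> (Suc i))) (\<lambda>i. c i * (\<theta> (i - 1) - \<theta> i))"
    and bc: "b d = 0" "c 0 = 0" "c 1 = 1"
  obtains \<alpha> \<beta> where
    "\<And>i. i \<le> d \<Longrightarrow> b i = (q_number q d - q_number q i) * (\<beta> - \<alpha> * q_number q i)"
    "\<And>i. i \<le> d \<Longrightarrow> c i = q_number q i * (1 + \<alpha> * q_number q (i - 1))"
proof -
  define N where "N = q_number q"
  define \<xi> where "\<xi> = \<theta> (d - 1) - \<theta> d"
  have \<xi>: "\<xi> \<noteq> 0" using ne by (simp add: \<xi>_def)
  define \<zeta> where "\<zeta> = \<theta> d"
  have \<theta>: "\<theta> i = \<xi> * N (d - i) + \<zeta>" if "i \<le> d" for i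
    unfolding \<xi>_def N_def \<zeta>_def by (rule geometric_eq_q_number[where \<theta> = \<theta> and q = q and r = r, OF geo that])
  have up: "\<theta> i - \<theta> (Suc i) = \<xi> * q ^ (d - Suc i)" if "i < d" for i
  proof -
    have "d - i = Suc (d - Suc i)" using that by simp
    thus ?thesis using \<theta>[of i] \<theta>[of "Suc i"] that by (simp add: N_def q_number_def algebra_simps)
  qed
  define K where "K = \<xi> * q ^ d"
  have C: "c i * (\<theta> (i - 1) - \<theta> i) * q ^ i = c i * K" if "i \<le> d" for i
  proof (cases "i = 0")
    case False
    hence "\<theta> (i - 1) - \<theta> i = \<xi> * q ^ (d - i)" using up[of "i - 1"] that by simp
    moreover have "q ^ (d - i) * q ^ i = q ^ d" using that by (simp add: power_add[symmetric])
    ultimately show ?thesis by (simp add: K_def)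
  qed (simp add: bc)
  have B: "b i * (\<theta> i - \<theta> (Suc i)) * q ^ i = b i / q * K" if "i \<le> d" for i
  proof (cases "i = d")
    case False
    hence "q ^ d = q * (q ^ (d - Suc i) * q ^ i)" using that
      by (simp add: power_add[symmetric] power_Suc[symmetric] del: power_Suc)
    thus ?thesis using up[of i] that False q by (simp add: K_def)
  qed (simp add: bc)
  have R: "q ^ i * \<theta> i = \<xi> * (N d - N i) + \<zeta> * (1 + (q - 1) * N i)" if "i \<le> d" for i
  proof -
    have "q ^ i * \<theta> i = \<xi> * (q ^ i * N (d - i)) + \<zeta> * q ^ i" unfolding \<theta>[OF that] by (simp add: algebra_simps)
    also have "q ^ i * N (d - i) = N d - N i" unfolding N_def by (rule power_mult_q_number[OF that])
    finally show ?thesis unfolding N_def power_eq_q_number[of q i] .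
  qed
  have Q: "q ^ i = 1 + (q - 1) * N i" for i unfolding N_def by (rule power_eq_q_number)
  have nz: "K \<noteq> 0" using \<xi> q by (simp add: K_def)
  obtain p1 where p1: "degree p1 \<le> 1"
    "\<And>i. i \<le> d \<Longrightarrow> c i * (\<theta> (i - 1) - \<theta> i) - b i * (\<theta> i - \<theta> (Suc i)) = poly p1 (\<theta> i)"
    using sys unfolding quadratic_system_def affine_system_def by blast
  obtain p2 where p2: "degree p2 \<le> 2"
    "\<And>i. i \<le> d \<Longrightarrow> c i * (\<theta> (i - 1) - \<theta> i) * (\<theta> (i - 1) - \<theta> i)
      + b i * (\<theta> i - \<theta> (Suc i)) * (\<theta> i - \<theta> (Suc i)) = poly p2 (\<theta> i)"
    using sys unfolding quadratic_system_def by blast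
  define a0 a1 where "a0 = coeff p1 0" "a1 = coeff p1 1"
  define e0 e1 e2 where "e0 = coeff p2 0" "e1 = coeff p2 1" "e2 = coeff p2 2"
  have pp1: "p1 = [:a0, a1:]" unfolding a0_a1_def by (rule affine_poly[OF p1(1)])
  have pp2: "p2 = [:e0, e1, e2:]" unfolding e0_e1_e2_def by (rule quadratic_poly[OF p2(1)])
  define u v where "u = ((a0 + a1 * \<zeta>) + a1 * \<xi> * N d) / K"
    "v = ((a0 + a1 * \<zeta>) * (q - 1) - a1 * \<xi>) / K"
  have lin: "c i - b i / q = u + v * N i" if i: "i \<le> d" for i
  proof -
    have "(c i - b i / q) * K = poly p1 (\<theta> i) * q ^ i"
      unfolding p1(2)[OF i, symmetric] left_diff_distrib C[OF i] B[OF i] ..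
    also have "\<dots> = a0 * q ^ i + a1 * (q ^ i * \<theta> i)" by (simp add: pp1 algebra_simps)
    also have "\<dots> = (a0 + a1 * \<zeta>) + a1 * \<xi> * N d + ((a0 + a1 * \<zeta>) * (q - 1) - a1 * \<xi>) * N i"
      unfolding R[OF i] unfolding Q by (simp add: algebra_simps)
    also have "\<dots> = u * K + v * K * N i" using nz by (simp add: u_v_def)
    also have "\<dots> = (u + v * N i) * K" by (simp add: algebra_simps)
    finally show ?thesis using nz by simp
  qed
  \<comment> \<open>\<open>Pq\<close> and \<open>Pr\<close> express \<open>q ^ i\<close> and
    \<open>q ^ i * \<theta> i\<close> as polynomials in \<open>N i\<close>.\<close>
  define Pq Pr where "Pq = [:1, q - 1:]" "Pr = [:\<xi> * N d + \<zeta>, \<zeta> * (q - 1) - \<xi>:]"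
  define P where "P = smult e0 (Pq * Pq) + smult e1 (Pq * Pr) + smult e2 (Pr * Pr)"
  have P2: "degree P \<le> 2"
    unfolding P_def Pq_Pr_def
    by (intro degree_add_le order_trans[OF degree_smult_le] order_trans[OF degree_mult_le]) auto
  define x y z where "x = coeff P 0 / K\<^sup>2" "y = coeff P 1 / K\<^sup>2" "z = coeff P 2 / K\<^sup>2"
  have quad: "c i + b i / q\<^sup>2 = x + y * N i + z * (N i)\<^sup>2" if i: "i \<le> d" for i
  proof -
    let ?D = "\<theta> (i - 1) - \<theta> i" and ?D' = "\<theta> i - \<theta> (Suc i)"
    have "c i * ?D * ?D * (q ^ i)\<^sup>2 = c i * K\<^sup>2"
    proof (cases "c i = 0")
      case False
      hence "?D * q ^ i = K" using C[OF i] by simp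
      thus ?thesis by (metis (no_types, opaque_lifting) mult.assoc power2_eq_square power_mult_distrib)
    qed simp
    moreover have "b i * ?D' * ?D' * (q ^ i)\<^sup>2 = b i / q\<^sup>2 * K\<^sup>2"
    proof (cases "b i = 0")
      case False
      have "b i * (?D' * q ^ i) = b i * (K / q)" using B[OF i] by (simp add: mult.assoc)
      hence "?D' * q ^ i = K / q" using False by (simp only: mult_cancel_left) simp
      hence "(?D' * q ^ i)\<^sup>2 = K\<^sup>2 / q\<^sup>2" by (simp add: power_divide)
      thus ?thesis by (simp add: power2_eq_square mult_ac)
    qed simp
    ultimately have "(c i + b i / q\<^sup>2) * K\<^sup>2 = poly p2 (\<theta> i) * (q ^ i)\<^sup>2"
      unfolding p2(2)[OF i, symmetric] by (simp only: distrib_right)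
    also have "\<dots> = e0 * (q ^ i * q ^ i) + e1 * (q ^ i * (q ^ i * \<theta> i)) + e2 * ((q ^ i * \<theta> i) * (q ^ i * \<theta> i))"
      by (simp add: pp2 power2_eq_square algebra_simps)
    also have "\<dots> = poly P (N i)"
      unfolding R[OF i] unfolding Q P_def Pq_Pr_def by (simp add: algebra_simps)
    also have "\<dots> = coeff P 0 + coeff P 1 * N i + coeff P 2 * (N i)\<^sup>2"
      by (subst quadratic_poly[OF P2]) (simp add: algebra_simps power2_eq_square)
    also have "\<dots> = (x + y * N i + z * (N i)\<^sup>2) * K\<^sup>2"
      using nz by (simp add: x_y_z_def distrib_right)
    finally show ?thesis using nz by simp
  qed
  have q1: "q + 1 \<noteq> 0" using q(2) by (simp add: eq_neg_iff_add_eq_0)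
  \<comment> \<open>Coefficients of \<open>c i\<close>: in \<open>q\<close> times the quadratic
    relation plus the linear one, \<open>b i\<close> cancels.\<close>
  define g0 g1 g2 where "g0 = (q * x + u) / (q + 1)" "g1 = (q * y + v) / (q + 1)" "g2 = q * z / (q + 1)"
  have c: "c i = g0 + g1 * N i + g2 * (N i)\<^sup>2" if i: "i \<le> d" for i
  proof -
    have "q * (c i + b i / q\<^sup>2) + (c i - b i / q) = c i * (q + 1)"
      using q by (simp add: field_simps power2_eq_square)
    hence "c i * (q + 1) = q * (x + y * N i + z * (N i)\<^sup>2) + (u + v * N i)"
      unfolding lin[OF i] quad[OF i] by simp
    also have "\<dots> = (q * x + u) + (q * y + v) * N i + q * z * (N i)\<^sup>2" by (simp add: algebra_simps)
    also have "\<dots> = g0 * (q + 1) + g1 * (q + 1) * N i + g2 * (q + 1) * (N i)\<^sup>2"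
      using q1 by (simp add: g0_g1_g2_def)
    also have "\<dots> = (g0 + g1 * N i + g2 * (N i)\<^sup>2) * (q + 1)" by (simp add: algebra_simps)
    finally have "c i * (q + 1) = (g0 + g1 * N i + g2 * (N i)\<^sup>2) * (q + 1)" .
    thus ?thesis using q1 by simp
  qed
  have N01: "N 0 = 0" "N 1 = 1" by (simp_all add: N_def q_number_def)
  have g0: "g0 = 0" using c[of 0] bc N01 by simp
  have g1: "g1 = 1 - g2" using c[of 1] bc N01 d g0 by (simp add: algebra_simps)
  \<comment> \<open>\<open>N i = 1 + q * N (i - 1)\<close> turns the coefficient \<open>g2\<close>
    into \<open>\<alpha> = q * g2\<close>; \<open>\<beta>\<close> is read off from
    \<open>b i - b d\<close>, which has the factor \<open>N d - N i\<close>.\<close>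
  define \<alpha> where "\<alpha> = q * g2"
  define \<beta> where "\<beta> = q * v - q * g1 - \<alpha> * N d"
  have c': "c i = N i * (1 + \<alpha> * N (i - 1))" if i: "i \<le> d" for i
  proof (cases i)
    case 0 thus ?thesis using bc N01 by simp
  next
    case (Suc j)
    have "N i = 1 + q * N (i - 1)" using Suc by (simp add: N_def q_number_Suc)
    hence "q * N (i - 1) = N i - 1" by simp
    hence e: "\<alpha> * N (i - 1) = g2 * (N i - 1)" unfolding \<alpha>_def by (simp add: mult_ac)
    show ?thesis unfolding c[OF i] g0 g1 e by (simp add: algebra_simps power2_eq_square)
  qed
  have b: "b i = q * c i - q * u - q * v * N i" if i: "i \<le> d" for i
    using lin[OF i] q by (simp add: field_simps)
  have "b i = (N d - N i) * (\<beta> - \<alpha> * N i)" if i: "i \<le> d" for i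
  proof -
    have "b i = b i - b d" using bc by simp
    also have "\<dots> = (N d - N i) * (\<beta> - \<alpha> * N i)"
      unfolding b[OF i] b[OF order_refl] c[OF i] c[OF order_refl] \<beta>_def \<alpha>_def
      by (simp add: algebra_simps power2_eq_square)
    finally show ?thesis .
  qed
  thus ?thesis using that c' unfolding N_def by blast
qed

section \<open>Distances in a distance-regular graph\<close>

locale distance_regular_graph =
  fixes adj :: "'a::finite \<Rightarrow> 'a \<Rightarrow> bool" and b c :: "nat \<Rightarrow> nat"
  assumes simple: "simple_graph adj" and connected: "connected_graph adj"
    and array: "intersection_array adj b c"
begin

abbreviation dst where "dst \<equiv> graph_dist adj"
abbreviation D where "D \<equiv> graph_diameter adj"

lemma adj_sym: "adj x y \<longleftrightarrow> adj y x"
  using simple unfolding simple_graph_def by (auto dest: sympD)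

lemma adj_irrefl: "\<not> adj x x"
  using simple unfolding simple_graph_def irreflp_def by auto

lemma walk_dist: "(adj ^^ dst x y) x y"
proof -
  have "\<exists>n. (adj ^^ n) x y" using connected unfolding connected_graph_def rtranclp_power by auto
  thus ?thesis unfolding graph_dist_def by (rule LeastI_ex)
qed

lemma dist_le_walk: "(adj ^^ n) x y \<Longrightarrow> dst x y \<le> n"
  unfolding graph_dist_def by (rule Least_le)

lemma walk_rev: "(adj ^^ n) x y \<Longrightarrow> (adj ^^ n) y x"
proof (induction n arbitrary: y)
  case (Suc n)
  then obtain z where z: "(adj ^^ n) x z" "adj z y" by auto
  show ?case by (rule relpowp_Suc_I2[OF iffD1[OF adj_sym z(2)] Suc.IH[OF z(1)]])
qed simp

lemma dist_sym: "dst x y = dst y x"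
  by (rule antisym; rule dist_le_walk[OF walk_rev[OF walk_dist]])

lemma dist_triangle: "dst x z \<le> dst x y + dst y z"
proof (rule dist_le_walk)
  show "(adj ^^ (dst x y + dst y z)) x z"
    unfolding relpowp_add using walk_dist[of x y] walk_dist[of y z] by auto
qed

lemma dist_0_iff: "dst x y = 0 \<longleftrightarrow> x = y"
  using walk_dist[of x y] dist_le_walk[of 0 x y] by auto

lemma dist_1_iff: "dst x y = 1 \<longleftrightarrow> adj x y"
proof
  assume "dst x y = 1" thus "adj x y" using walk_dist[of x y] by auto
next
  assume a: "adj x y"
  hence "dst x y \<le> 1" by (intro dist_le_walk) auto
  moreover have "dst x y \<noteq> 0" using a adj_irrefl by (auto simp: dist_0_iff)
  ultimately show "dst x y = 1" by simp
qed

lemma dist_adj: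
  assumes "adj y z"
  shows "dst x z \<le> Suc (dst x y)" "dst x y \<le> Suc (dst x z)"
proof -
  have "dst y z = 1" "dst z y = 1" using assms dist_1_iff dist_sym by auto
  thus "dst x z \<le> Suc (dst x y)" "dst x y \<le> Suc (dst x z)"
    using dist_triangle[of x z y] dist_triangle[of x y z] by simp_all
qed

lemma finite_distances: "finite {dst x y | x y. True}"
proof -
  have "{dst x y | x y. True} = (\<Union>x. range (dst x))" by auto
  thus ?thesis by simp
qed

lemma dist_le_diameter: "dst x y \<le> D"
  unfolding graph_diameter_def by (rule Max_ge[OF finite_distances]) auto

lemma diameter_attained: obtains x y where "dst x y = D"
proof -
  have "Max {dst x y | x y. True} \<in> {dst x y | x y. True}" by (rule Max_in[OF finite_distances]) auto
  thus ?thesis using that unfolding graph_diameter_def by auto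
qed

lemma geodesic_step:
  assumes "dst x y = Suc n" obtains z where "dst x z = n" "adj z y"
proof -
  obtain z where z: "(adj ^^ n) x z" "adj z y" using walk_dist[of x y] unfolding assms by auto
  have "dst x z \<le> n" by (rule dist_le_walk[OF z(1)])
  moreover have "Suc n \<le> Suc (dst x z)" using dist_adj(1)[OF z(2), of x] assms by simp
  ultimately show ?thesis using that z by auto
qed

lemma intermediate_point:
  assumes "n \<le> dst x y"
  obtains z where "dst x z = n" "dst z y = dst x y - n"
proof -
  have "\<exists>z. dst x z = n \<and> dst z y = dst x y - n" using assms
  proof (induction "dst x y" arbitrary: y)
    case 0 thus ?case using dist_0_iff[of y y] by (intro exI[of _ y]) simp
  next
    case (Suc m)
    show ?case
    proof (cases "n = Suc m")
      case True thus ?thesis using Suc dist_0_iff[of y y] by (intro exI[of _ y]) simp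
    next
      case False
      obtain u where u: "dst x u = m" "adj u y" using geodesic_step Suc.hyps(2)[symmetric] by blast
      then obtain z where z: "dst x z = n" "dst z u = m - n" using Suc.hyps(1)[of u] Suc False by auto
      have "dst z y \<le> Suc (m - n)" using dist_adj(1)[OF u(2), of z] z by simp
      moreover have "Suc m \<le> n + dst z y" using dist_triangle[of x y z] z Suc.hyps(2) by simp
      ultimately have "dst z y = Suc m - n" using False Suc.prems Suc.hyps(2) by simp
      thus ?thesis using z Suc.hyps(2) by auto
    qed
  qed
  thus ?thesis using that by auto
qed

lemma distance_attained: assumes "i \<le> D" obtains x y where "dst x y = i"
proof -
  obtain x y where "dst x y = D" by (rule diameter_attained)
  moreover from this obtain z where "dst x z = i" using intermediate_point[of i x y] assms by auto
  ultimately show ?thesis using that by blast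
qed

lemma card_up: "card {z. dst x z = Suc (dst x y) \<and> adj y z} = b (dst x y)"
  and card_down: "card {z. Suc (dst x z) = dst x y \<and> adj y z} = c (dst x y)"
  using array unfolding intersection_array_def by auto

lemma c_0: "c 0 = 0"
  using card_down[of undefined undefined] dist_0_iff[of undefined undefined] by simp

lemma b_diameter: "b D = 0"
proof -
  obtain x y where xy: "dst x y = D" by (rule diameter_attained)
  have e: "{z. dst x z = Suc (dst x y) \<and> adj y z} = {}"
    unfolding xy by (metis (mono_tags, lifting) Collect_empty_eq Suc_n_not_le_n dist_le_diameter)
  show ?thesis using card_up[of x y] unfolding e unfolding xy by simp
qed

lemma exists_up_pair: assumes "i < D" obtains x y z where "dst x y = i" "dst x z = Suc i" "adj y z"
proof -
  obtain x z where xz: "dst x z = Suc i" using distance_attained[of "Suc i"] assms by auto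
  thus ?thesis using geodesic_step that by blast
qed

lemma b_pos: assumes "i < D" shows "b i > 0"
proof -
  obtain x y z where "dst x y = i" "dst x z = Suc i" "adj y z" using exists_up_pair[OF assms] .
  moreover from this have "{z. dst x z = Suc (dst x y) \<and> adj y z} \<noteq> {}" by auto
  hence "card {z. dst x z = Suc (dst x y) \<and> adj y z} > 0" by (simp add: card_gt_0_iff)
  ultimately show ?thesis using card_up[of x y] by simp
qed

lemma c_pos: assumes "i < D" shows "c (Suc i) > 0"
proof -
  obtain x y z where "dst x y = i" "dst x z = Suc i" "adj y z" using exists_up_pair[OF assms] .
  moreover from this have "{u. Suc (dst x u) = dst x z \<and> adj z u} \<noteq> {}" using adj_sym[of y z] by auto
  hence "card {u. Suc (dst x u) = dst x z \<and> adj z u} > 0" by (simp add: card_gt_0_iff)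
  ultimately show ?thesis using card_down[of x z] by simp
qed

lemma c_1: assumes "1 \<le> D" shows "c 1 = 1"
proof -
  obtain x y where xy: "dst x y = 1" using distance_attained assms by blast
  have "{z. Suc (dst x z) = dst x y \<and> adj y z} = {x}"
    using xy dist_0_iff dist_1_iff[of x y] by (auto simp: adj_sym)
  thus ?thesis using card_down[of x y] unfolding xy by simp
qed

lemma degree: "card {z. adj y z} = b 0"
  using card_up[of y y] dist_0_iff[of y y] dist_1_iff[of y] by (simp flip: One_nat_def)

text \<open>Differences are used so that neighbours at the same distance need no separate count, and
  the truncated \<open>i - 1\<close> at \<open>i = 0\<close> meets an empty set. \<open>Z\<close> is
  later both the whole vertex set and a descendent.\<close>

lemma sum_neighbours:
  fixes f :: "nat \<Rightarrow> 'b::comm_ring_1" and x y :: 'a and Z :: "'a set"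
  defines "i \<equiv> dst x y"
  shows "(\<Sum>z | adj y z \<and> z \<in> Z. f (dst x z))
    = of_nat (card {z \<in> Z. Suc (dst x z) = i \<and> adj y z}) * (f (i - 1) - f i)
    + of_nat (card {z \<in> Z. dst x z = Suc i \<and> adj y z}) * (f (Suc i) - f i)
    + of_nat (card {z \<in> Z. adj y z}) * f i"
proof -
  have "(\<Sum>z | adj y z \<and> z \<in> Z. f (dst x z)) = (\<Sum>z | adj y z \<and> z \<in> Z.
      (if Suc (dst x z) = i then f (i - 1) - f i else 0) + (if dst x z = Suc i then f (Suc i) - f i else 0) + f i)"
  proof (rule sum.cong)
    fix z assume "z \<in> {z. adj y z \<and> z \<in> Z}"
    hence "dst x z \<le> Suc i" "i \<le> Suc (dst x z)" using dist_adj[of y z x] unfolding i_def by auto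
    then consider "i = Suc (dst x z)" | "i = dst x z" | "dst x z = Suc i" by linarith
    thus "f (dst x z) = (if Suc (dst x z) = i then f (i - 1) - f i else 0)
        + (if dst x z = Suc i then f (Suc i) - f i else 0) + f i"
      by cases simp_all
  qed simp
  also have "\<dots> = (\<Sum>z \<in> {z \<in> Z. Suc (dst x z) = i \<and> adj y z}. f (i - 1) - f i)
     + (\<Sum>z \<in> {z \<in> Z. dst x z = Suc i \<and> adj y z}. f (Suc i) - f i) + (\<Sum>z \<in> {z \<in> Z. adj y z}. f i)"
  proof -
    have sets: "{z. adj y z \<and> z \<in> Z} \<inter> {z. Suc (dst x z) = i} = {z \<in> Z. Suc (dst x z) = i \<and> adj y z}"
      "{z. adj y z \<and> z \<in> Z} \<inter> {z. dst x z = Suc i} = {z \<in> Z. dst x z = Suc i \<and> adj y z}"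
      "{z. adj y z \<and> z \<in> Z} = {z \<in> Z. adj y z}" by auto
    show ?thesis unfolding sum.distrib by (simp add: sum.If_cases sets(1,2)) (simp add: sets(3))
  qed
  finally show ?thesis by simp
qed

text \<open>Counts the edges of \<open>Z\<close> between two consecutive spheres about
  \<open>x\<close> from either end.\<close>

lemma down_up_balance:
  "(\<Sum>y | y \<in> Z \<and> dst x y = i. card {z \<in> Z. dst x z = Suc i \<and> adj y z})
  = (\<Sum>y | y \<in> Z \<and> dst x y = Suc i. card {z \<in> Z. Suc (dst x z) = Suc i \<and> adj y z})"
proof -
  have "(\<Sum>y | y \<in> Z \<and> dst x y = i. card {z \<in> Z. dst x z = Suc i \<and> adj y z})
    = card (SIGMA y:{y. y \<in> Z \<and> dst x y = i}. {z \<in> Z. dst x z = Suc i \<and> adj y z})"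
    by (subst card_SigmaI) auto
  also have "\<dots> = card (SIGMA y:{y. y \<in> Z \<and> dst x y = Suc i}. {z \<in> Z. Suc (dst x z) = Suc i \<and> adj y z})"
  proof (rule bij_betw_same_card, rule bij_betw_byWitness[where f = prod.swap and f' = prod.swap])
    show "prod.swap ` (SIGMA y:{y. y \<in> Z \<and> dst x y = i}. {z \<in> Z. dst x z = Suc i \<and> adj y z})
      \<subseteq> (SIGMA y:{y. y \<in> Z \<and> dst x y = Suc i}. {z \<in> Z. Suc (dst x z) = Suc i \<and> adj y z})"
      using adj_sym by auto
    show "prod.swap ` (SIGMA y:{y. y \<in> Z \<and> dst x y = Suc i}. {z \<in> Z. Suc (dst x z) = Suc i \<and> adj y z})
      \<subseteq> (SIGMA y:{y. y \<in> Z \<and> dst x y = i}. {z \<in> Z. dst x z = Suc i \<and> adj y z})"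
      using adj_sym by auto
  qed auto
  also have "\<dots> = (\<Sum>y | y \<in> Z \<and> dst x y = Suc i. card {z \<in> Z. Suc (dst x z) = Suc i \<and> adj y z})"
    by (subst card_SigmaI) auto
  finally show ?thesis .
qed

end

section \<open>The Bose--Mesner algebra\<close>

interpretation matrix_space: vector_space "smult_mat :: complex \<Rightarrow> complex^'n^'m \<Rightarrow> complex^'n^'m"
  by unfold_locales (simp_all add: smult_mat_def vec_eq_iff algebra_simps)

lemma smult_mat_mult_left: "smult_mat k M ** N = smult_mat k (M ** N)"
  by (simp add: smult_mat_def matrix_matrix_mult_def vec_eq_iff sum_distrib_left mult_ac)

lemma matrix_mult_sum_left: "(\<Sum>i\<in>S. f i) ** N = (\<Sum>i\<in>S. f i ** (N :: complex^'n^'k))"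
proof -
  have add: "(M + M') ** N = M ** N + M' ** N" for M M' :: "complex^'k^'m"
    by (simp add: matrix_matrix_mult_def vec_eq_iff distrib_right sum.distrib)
  show ?thesis by (induction S rule: infinite_finite_induct) (simp_all add: add)
qed

lemma matrix_diff_rdistrib: "(M - N) ** P = M ** P - N ** (P :: complex^'n^'k)"
  by (simp add: matrix_matrix_mult_def vec_eq_iff left_diff_distrib sum_subtractf)

lemma matrix_diff_ldistrib: "P ** (M - N) = P ** M - P ** (N :: complex^'n^'k)"
  by (simp add: matrix_matrix_mult_def vec_eq_iff right_diff_distrib sum_subtractf)

context distance_regular_graph
begin

text \<open>Identifies the Bose--Mesner algebra with the functions on the distances; values of
  \<open>f\<close> above the diameter are never seen.\<close>

definition dmat :: "(nat \<Rightarrow> complex) \<Rightarrow> complex^'a^'a" where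
  "dmat f = (\<chi> x y. f (dst x y))"

lemma dmat_nth [simp]: "dmat f $ x $ y = f (dst x y)"
  by (simp add: dmat_def)

lemma dmat_eq_iff: "dmat f = dmat g \<longleftrightarrow> (\<forall>i\<le>D. f i = g i)"
proof
  assume eq: "dmat f = dmat g"
  show "\<forall>i\<le>D. f i = g i"
  proof (intro allI impI)
    fix i assume "i \<le> D"
    then obtain x y where "dst x y = i" by (rule distance_attained)
    moreover have "dmat f $ x $ y = dmat g $ x $ y" using eq by simp
    ultimately show "f i = g i" by simp
  qed
qed (auto simp: vec_eq_iff dist_le_diameter)

lemma bose_mesner_eq: "bose_mesner adj = range dmat"
proof -
  have "(\<Sum>i\<le>D. smult_mat (k i) (dist_mat adj i)) = dmat k" for k
    using dist_le_diameter by (auto simp: vec_eq_iff smult_mat_def dist_mat_def sum_component if_distrib cong: if_cong)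
  thus ?thesis unfolding bose_mesner_def by auto
qed

lemma dmat_add: "dmat f + dmat g = dmat (\<lambda>i. f i + g i)"
  and dmat_diff: "dmat f - dmat g = dmat (\<lambda>i. f i - g i)"
  and smult_dmat: "smult_mat k (dmat f) = dmat (\<lambda>i. k * f i)"
  by (simp_all add: vec_eq_iff smult_mat_def)

text \<open>The action of the adjacency matrix, with the number of neighbours at equal distance
  eliminated through the valency \<open>b 0\<close>. Values of \<open>f\<close> beyond the range are
  killed by \<open>c 0 = 0\<close> and \<open>b D = 0\<close>.\<close>

definition adj_op :: "(nat \<Rightarrow> complex) \<Rightarrow> nat \<Rightarrow> complex" where
  "adj_op f i = of_nat (c i) * (f (i - 1) - f i) + of_nat (b i) * (f (Suc i) - f i) + of_nat (b 0) * f i"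

abbreviation adj_mat where "adj_mat \<equiv> dist_mat adj 1"

lemma adj_mat_mult: "adj_mat ** dmat f = dmat (adj_op f)"
proof -
  have "(\<Sum>z\<in>UNIV. adj_mat $ y $ z * f (dst z x)) = adj_op f (dst y x)" for x y
  proof -
    have "(\<Sum>z\<in>UNIV. adj_mat $ y $ z * f (dst z x)) = (\<Sum>z | adj y z \<and> z \<in> UNIV. f (dst x z))"
      unfolding dist_mat_def by (rule sum.mono_neutral_cong_right) (auto simp: dist_1_iff dist_sym simp del: One_nat_def)
    also have "\<dots> = adj_op f (dst x y)"
      unfolding sum_neighbours using card_up[of x y] card_down[of x y] degree[of y]
      by (simp add: adj_op_def)
    finally show ?thesis by (simp add: dist_sym)
  qed
  thus ?thesis by (simp add: matrix_matrix_mult_def vec_eq_iff)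
qed

text \<open>The adjacency matrix times a distance matrix is a combination of three consecutive ones,
  and \<open>c (Suc j) \<noteq> 0\<close> solves for the last. So induction reduces closure to
  \<open>adj_mat_mult\<close>.\<close>

lemma dist_mat_mult_dmat:
  assumes "i \<le> D" shows "\<exists>g. dist_mat adj i ** dmat f = dmat g"
  using assms
proof (induction i rule: less_induct)
  case (less i)
  show ?case
  proof (cases i)
    case 0
    have "dist_mat adj 0 = mat 1" by (simp add: dist_mat_def mat_def vec_eq_iff dist_0_iff)
    thus ?thesis using 0 by auto
  next
    case (Suc j)
    define k where "k = complex_of_nat (c (Suc j))"
    have k: "k \<noteq> 0" using c_pos[of j] less.prems Suc by (simp add: k_def)
    define l where "l = of_nat (b 0) - complex_of_nat (c j) - of_nat (b j)"
    define m where "m = (if j = 0 then 0 else complex_of_nat (b (j - 1)))"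
    have dm: "dist_mat adj n = dmat (\<lambda>t. if t = n then 1 else 0)" for n
      by (simp add: dist_mat_def vec_eq_iff)
    have "adj_mat ** dist_mat adj j = smult_mat k (dist_mat adj (Suc j)) + smult_mat l (dist_mat adj j)
        + smult_mat m (dist_mat adj (j - 1))"
      unfolding dm[of j] adj_mat_mult unfolding dm smult_dmat dmat_add dmat_eq_iff
      by (auto simp: adj_op_def k_def l_def m_def c_0 algebra_simps)
    hence "smult_mat k (dist_mat adj (Suc j)) = adj_mat ** dist_mat adj j - smult_mat l (dist_mat adj j)
        - smult_mat m (dist_mat adj (j - 1))" by simp
    hence "smult_mat k (dist_mat adj (Suc j)) ** dmat f = adj_mat ** (dist_mat adj j ** dmat f)
        - smult_mat l (dist_mat adj j ** dmat f) - smult_mat m (dist_mat adj (j - 1) ** dmat f)"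
      by (simp add: matrix_diff_rdistrib smult_mat_mult_left matrix_mul_assoc)
    moreover obtain g where "dist_mat adj j ** dmat f = dmat g"
      using less.IH[of j] less.prems Suc by auto
    moreover obtain h where "dist_mat adj (j - 1) ** dmat f = dmat h"
    proof -
      have "j - 1 < i" "j - 1 \<le> D" using less.prems Suc by auto
      thus ?thesis using less.IH that by blast
    qed
    ultimately have "smult_mat k (dist_mat adj (Suc j) ** dmat f)
        = dmat (\<lambda>i. adj_op g i - l * g i - m * h i)"
      by (simp add: adj_mat_mult smult_dmat dmat_diff smult_mat_mult_left del: One_nat_def)
    hence "smult_mat (1 / k) (smult_mat k (dist_mat adj (Suc j) ** dmat f))
        = dmat (\<lambda>i. 1 / k * (adj_op g i - l * g i - m * h i))"
      by (simp add: smult_dmat)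
    hence "dist_mat adj (Suc j) ** dmat f = dmat (\<lambda>i. 1 / k * (adj_op g i - l * g i - m * h i))"
      using k by (simp add: matrix_space.scale_scale)
    thus ?thesis unfolding Suc by blast
  qed
qed

lemma dmat_mult_closed: "\<exists>h. dmat f ** dmat g = dmat h"
proof -
  have "dmat f \<in> bose_mesner adj" unfolding bose_mesner_eq by simp
  then obtain k where k: "dmat f = (\<Sum>i\<le>D. smult_mat (k i) (dist_mat adj i))"
    unfolding bose_mesner_def by auto
  have "\<forall>i. \<exists>h. i \<le> D \<longrightarrow> dist_mat adj i ** dmat g = dmat h" using dist_mat_mult_dmat by blast
  then obtain h where h: "\<And>i. i \<le> D \<Longrightarrow> dist_mat adj i ** dmat g = dmat (h i)" by metis
  have "dmat f ** dmat g = (\<Sum>i\<le>D. smult_mat (k i) (dmat (h i)))"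
    unfolding k matrix_mult_sum_left smult_mat_mult_left by (intro sum.cong) (auto simp: h)
  also have "\<dots> = dmat (\<lambda>t. \<Sum>i\<le>D. k i * h i t)"
    by (simp add: vec_eq_iff smult_mat_def sum_component)
  finally show ?thesis by blast
qed

lemma transpose_dmat: "transpose (dmat f) = dmat f"
  by (simp add: transpose_def vec_eq_iff dist_sym)

text \<open>A product of elements is again an element, hence symmetric, while transposition reverses
  the factors.\<close>

lemma dmat_mult_commute: "dmat f ** dmat g = dmat g ** dmat f"
  by (metis dmat_mult_closed matrix_transpose_mul transpose_dmat)

end

section \<open>Primitive idempotents: orthogonality, spanning and reality\<close>

locale ordered_idempotents = distance_regular_graph +
  fixes E :: "nat \<Rightarrow> complex^'a^'a"
  assumes ordering: "primitive_idempotent_ordering adj E"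
begin

lemma E_primitive: "j \<le> D \<Longrightarrow> E j \<in> primitive_idempotents (bose_mesner adj)"
  using ordering unfolding primitive_idempotent_ordering_def bij_betw_def by auto

lemma E_surj: "F \<in> primitive_idempotents (bose_mesner adj) \<Longrightarrow> \<exists>j\<le>D. F = E j"
  using ordering unfolding primitive_idempotent_ordering_def bij_betw_def by auto

lemma E_inj: "i \<le> D \<Longrightarrow> j \<le> D \<Longrightarrow> E i = E j \<Longrightarrow> i = j"
  using ordering unfolding primitive_idempotent_ordering_def bij_betw_def inj_on_def by auto

text \<open>The second eigenmatrix divided by \<open>CARD('a)\<close>, with the index of the
  idempotent written first.\<close>

definition Q :: "nat \<Rightarrow> nat \<Rightarrow> complex" where
  "Q j = (SOME f. E j = dmat f)"

lemma E_eq: assumes "j \<le> D" shows "E j = dmat (Q j)"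
proof -
  have "E j \<in> bose_mesner adj"
    using E_primitive[OF assms] unfolding primitive_idempotents_def idempotents_def by auto
  hence "\<exists>f. E j = dmat f" unfolding bose_mesner_eq by auto
  thus ?thesis unfolding Q_def by (rule someI_ex)
qed

lemma E_idem: "j \<le> D \<Longrightarrow> E j ** E j = E j" and E_nonzero: "j \<le> D \<Longrightarrow> E j \<noteq> 0"
  using E_primitive unfolding primitive_idempotents_def idempotents_def by auto

text \<open>Otherwise \<open>F ** E j\<close> and \<open>E j - F ** E j\<close> would split
  \<open>E j\<close> into nonzero orthogonal idempotents of the algebra.\<close>

lemma idempotent_mult_primitive:
  assumes F: "F \<in> idempotents (bose_mesner adj)" and j: "j \<le> D"
  shows "F ** E j = 0 \<or> F ** E j = E j"
proof (rule ccontr)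
  assume n: "\<not> (F ** E j = 0 \<or> F ** E j = E j)"
  obtain f where f: "F = dmat f" "F ** F = F" using F unfolding idempotents_def bose_mesner_eq by auto
  define e where "e = E j"
  have e: "e = dmat (Q j)" "e ** e = e" using E_eq E_idem j by (auto simp: e_def)
  have comm: "F ** e = e ** F" unfolding f e by (rule dmat_mult_commute)
  have Fe: "(F ** e) ** (F ** e) = F ** e"
  proof -
    have "(F ** e) ** (F ** e) = F ** (e ** F) ** e" by (simp add: matrix_mul_assoc)
    also have "\<dots> = (F ** F) ** (e ** e)" unfolding comm[symmetric] by (simp add: matrix_mul_assoc)
    finally show ?thesis unfolding f(2) e(2) .
  qed
  obtain h where h: "F ** e = dmat h" unfolding f e using dmat_mult_closed by blast
  have 1: "F ** e \<in> idempotents (bose_mesner adj)"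
    unfolding idempotents_def bose_mesner_eq using h Fe by auto
  have eFe: "e ** (F ** e) = F ** e" "(F ** e) ** e = F ** e"
  proof -
    have "e ** (F ** e) = (e ** e) ** F" unfolding comm by (simp add: matrix_mul_assoc)
    thus "e ** (F ** e) = F ** e" unfolding e(2) comm .
    have "(F ** e) ** e = F ** (e ** e)" by (simp add: matrix_mul_assoc)
    thus "(F ** e) ** e = F ** e" unfolding e(2) .
  qed
  have 2: "e - F ** e \<in> idempotents (bose_mesner adj)"
  proof -
    have "e - F ** e = dmat (\<lambda>i. Q j i - h i)" by (metis dmat_diff e(1) h)
    moreover have "(e - F ** e) ** (e - F ** e) = e - F ** e"
      by (simp add: matrix_diff_rdistrib matrix_diff_ldistrib eFe Fe e(2))
    ultimately show ?thesis unfolding idempotents_def bose_mesner_eq by auto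
  qed
  have 3: "(F ** e) ** (e - F ** e) = 0" "(e - F ** e) ** (F ** e) = 0"
    by (simp_all add: matrix_diff_rdistrib matrix_diff_ldistrib eFe Fe)
  have "e = F ** e + (e - F ** e)" "F ** e \<noteq> 0" "e - F ** e \<noteq> 0" using n unfolding e_def by auto
  thus False using E_primitive[OF j] 1 2 3 unfolding primitive_idempotents_def e_def[symmetric] by blast
qed

lemma E_orth: assumes "i \<le> D" "j \<le> D" "i \<noteq> j" shows "E i ** E j = 0"
proof (rule ccontr)
  assume n: "E i ** E j \<noteq> 0"
  have id: "E k \<in> idempotents (bose_mesner adj)" if "k \<le> D" for k
    using E_primitive[OF that] unfolding primitive_idempotents_def by auto
  have comm: "E i ** E j = E j ** E i" unfolding E_eq[OF assms(1)] E_eq[OF assms(2)] by (rule dmat_mult_commute)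
  have "E i ** E j = E j" using idempotent_mult_primitive[OF id assms(2)] assms n by blast
  moreover have "E i ** E j = E i" using idempotent_mult_primitive[OF id assms(1), of j] assms n comm by simp
  ultimately show False using E_inj[OF assms(1,2)] assms(3) by simp
qed

lemma E_independent:
  assumes "(\<Sum>j\<le>D. smult_mat (x j) (E j)) = 0" "k \<le> D" shows "x k = 0"
proof -
  have "(\<Sum>j\<le>D. smult_mat (x j) (E j)) ** E k = (\<Sum>j\<le>D. if j = k then smult_mat (x k) (E k) else 0)"
    unfolding matrix_mult_sum_left smult_mat_mult_left
    by (intro sum.cong) (use assms(2) in \<open>auto simp: E_orth E_idem\<close>)
  also have "\<dots> = smult_mat (x k) (E k)" using assms(2) by simp
  finally have "smult_mat (x k) (E k) = 0" unfolding assms(1) by simp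
  thus ?thesis using E_nonzero[OF assms(2)] by simp
qed

lemma Q_independent:
  assumes "\<And>i. i \<le> D \<Longrightarrow> (\<Sum>j\<le>D. x j * Q j i) = 0" "k \<le> D" shows "x k = 0"
proof (rule E_independent[OF _ assms(2)])
  have "(\<Sum>j\<le>D. smult_mat (x j) (E j)) = (\<Sum>j\<le>D. smult_mat (x j) (dmat (Q j)))"
    by (intro sum.cong) (auto simp: E_eq)
  also have "\<dots> = 0" by (simp add: vec_eq_iff smult_mat_def assms(1) dist_le_diameter)
  finally show "(\<Sum>j\<le>D. smult_mat (x j) (E j)) = 0" .
qed

text \<open>A dimension count: the \<open>Suc D\<close> independent matrices \<open>E j\<close> lie
  in the span of \<open>Suc D\<close> distance matrices, so a further independent element
  \<open>dmat f\<close> would be one too many.\<close>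

lemma Q_spanning: "\<exists>x. \<forall>i\<le>D. f i = (\<Sum>j\<le>D. x j * Q j i)"
proof -
  let ?A = "dist_mat adj ` {..D}" and ?B = "E ` {..D}"
  have inj: "inj_on E {..D}" by (rule inj_onI, rule E_inj) auto
  have ind: "matrix_space.independent ?B"
  proof (rule matrix_space.independent_if_scalars_zero)
    fix g F assume s: "(\<Sum>F\<in>?B. smult_mat (g F) F) = 0" and F: "F \<in> ?B"
    have "(\<Sum>j\<le>D. smult_mat (g (E j)) (E j)) = 0" using s by (simp add: sum.reindex[OF inj])
    moreover obtain k where "k \<le> D" "F = E k" using F by blast
    ultimately show "g F = 0" using E_independent[of "\<lambda>j. g (E j)" k] by simp
  qed simp
  have BM: "dmat h \<in> matrix_space.span ?A" for h
  proof -
    have "dmat h \<in> bose_mesner adj" unfolding bose_mesner_eq by simp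
    then obtain k where k: "dmat h = (\<Sum>i\<le>D. smult_mat (k i) (dist_mat adj i))"
      unfolding bose_mesner_def by auto
    show ?thesis unfolding k
      by (rule matrix_space.span_sum, rule matrix_space.span_scale, rule matrix_space.span_base) simp
  qed
  have "dmat f \<in> matrix_space.span ?B"
  proof (rule ccontr)
    assume n: "dmat f \<notin> matrix_space.span ?B"
    have ind': "matrix_space.independent (insert (dmat f) ?B)" by (rule matrix_space.independent_insertI[OF n ind])
    have "E j \<in> matrix_space.span ?A" if "j \<le> D" for j unfolding E_eq[OF that] by (rule BM)
    hence "insert (dmat f) ?B \<subseteq> matrix_space.span ?A" using BM[of f] by (simp add: image_subset_iff)
    hence "card (insert (dmat f) ?B) \<le> card ?A"
      using matrix_space.independent_span_bound[OF finite_imageI[OF finite_atMost] ind'] by blast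
    moreover have "dmat f \<notin> ?B" using n by (rule contrapos_nn) (rule matrix_space.span_base)
    hence "card (insert (dmat f) ?B) = Suc (Suc D)" using inj by (simp add: card_image)
    moreover have "card ?A \<le> Suc D" using card_image_le[of "{..D}"] by simp
    ultimately show False by simp
  qed
  then obtain u where "dmat f = (\<Sum>F\<in>?B. smult_mat (u F) F)"
    unfolding matrix_space.span_finite[OF finite_imageI[OF finite_atMost]] by blast
  also have "\<dots> = (\<Sum>j\<le>D. smult_mat (u (E j)) (E j))" by (simp add: sum.reindex[OF inj])
  also have "\<dots> = (\<Sum>j\<le>D. smult_mat (u (E j)) (dmat (Q j)))" by (intro sum.cong) (auto simp: E_eq)
  also have "\<dots> = dmat (\<lambda>i. \<Sum>j\<le>D. u (E j) * Q j i)" by (simp add: vec_eq_iff smult_mat_def)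
  finally have "\<forall>i\<le>D. f i = (\<Sum>j\<le>D. u (E j) * Q j i)" unfolding dmat_eq_iff .
  thus ?thesis by (rule exI[of _ "\<lambda>j. u (E j)"])
qed

text \<open>Expand \<open>adj_mat ** E j\<close> in the idempotents and multiply by
  \<open>E j\<close>: only the term of \<open>E j\<close> survives.\<close>

lemma Q_eigen: assumes "j \<le> D" shows "\<exists>\<eta>. \<forall>i\<le>D. adj_op (Q j) i = \<eta> * Q j i"
proof -
  obtain x where x: "\<forall>i\<le>D. adj_op (Q j) i = (\<Sum>k\<le>D. x k * Q k i)" using Q_spanning by blast
  have "adj_mat ** E j = (\<Sum>k\<le>D. smult_mat (x k) (E k))"
  proof -
    have "(\<Sum>k\<le>D. smult_mat (x k) (E k)) = (\<Sum>k\<le>D. smult_mat (x k) (dmat (Q k)))"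
      by (intro sum.cong) (auto simp: E_eq)
    also have "\<dots> = dmat (\<lambda>i. \<Sum>k\<le>D. x k * Q k i)" by (simp add: vec_eq_iff smult_mat_def)
    finally show ?thesis unfolding E_eq[OF assms] adj_mat_mult using x by (simp add: dmat_eq_iff)
  qed
  hence "(adj_mat ** E j) ** E j = (\<Sum>k\<le>D. smult_mat (x k) (E k ** E j))"
    by (simp only: matrix_mult_sum_left smult_mat_mult_left)
  also have "\<dots> = (\<Sum>k\<le>D. if k = j then smult_mat (x j) (E j) else 0)"
    by (intro sum.cong) (use assms in \<open>auto simp: E_orth E_idem\<close>)
  finally have "adj_mat ** E j = smult_mat (x j) (E j)"
    using assms E_idem[OF assms] by (simp add: matrix_mul_assoc[symmetric])
  thus ?thesis unfolding E_eq[OF assms] adj_mat_mult smult_dmat dmat_eq_iff by blast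
qed

text \<open>Entrywise conjugation is a ring automorphism preserving the algebra, so it permutes the
  primitive idempotents; this leads to their reality.\<close>

definition conj_mat :: "complex^'a^'a \<Rightarrow> complex^'a^'a" where
  "conj_mat M = (\<chi> x y. cnj (M $ x $ y))"

lemma conj_conj: "conj_mat (conj_mat M) = M"
  by (simp add: conj_mat_def vec_eq_iff)

lemma conj_dmat: "conj_mat (dmat f) = dmat (\<lambda>i. cnj (f i))"
  by (simp add: conj_mat_def vec_eq_iff)

lemma conj_mult: "conj_mat (M ** N) = conj_mat M ** conj_mat N"
  by (simp add: conj_mat_def matrix_matrix_mult_def vec_eq_iff)

lemma conj_add: "conj_mat (M + N) = conj_mat M + conj_mat N"
  by (simp add: conj_mat_def vec_eq_iff)

lemma conj_0_iff: "conj_mat M = 0 \<longleftrightarrow> M = 0"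
  by (simp add: conj_mat_def vec_eq_iff)

lemma conj_idempotents:
  assumes "F \<in> idempotents (bose_mesner adj)" shows "conj_mat F \<in> idempotents (bose_mesner adj)"
proof -
  obtain f where f: "F = dmat f" "F ** F = F" using assms unfolding idempotents_def bose_mesner_eq by auto
  have "conj_mat F ** conj_mat F = conj_mat F" using f(2) by (simp flip: conj_mult)
  thus ?thesis unfolding idempotents_def bose_mesner_eq f(1) conj_dmat by simp
qed

lemma conj_primitive:
  assumes F: "F \<in> primitive_idempotents (bose_mesner adj)"
  shows "conj_mat F \<in> primitive_idempotents (bose_mesner adj)"
proof -
  have id: "F \<in> idempotents (bose_mesner adj)" and nz: "F \<noteq> 0"
    using F unfolding primitive_idempotents_def by auto
  have False if G: "G \<in> idempotents (bose_mesner adj)" "H \<in> idempotents (bose_mesner adj)"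
    "G \<noteq> 0" "H \<noteq> 0" "G ** H = 0" "H ** G = 0" "conj_mat F = G + H" for G H
  proof -
    have "F = conj_mat G + conj_mat H" using arg_cong[OF G(7), of conj_mat] by (simp add: conj_conj conj_add)
    moreover have "conj_mat G ** conj_mat H = 0" "conj_mat H ** conj_mat G = 0"
      using G(5,6) by (simp_all flip: conj_mult add: conj_0_iff)
    moreover have "conj_mat G \<noteq> 0" "conj_mat H \<noteq> 0" using G(3,4) by (simp_all add: conj_0_iff)
    ultimately show False
      using F conj_idempotents[OF G(1)] conj_idempotents[OF G(2)]
      unfolding primitive_idempotents_def by blast
  qed
  thus ?thesis unfolding primitive_idempotents_def using conj_idempotents[OF id] nz by (auto simp: conj_0_iff)
qed

lemma conv_idem: assumes "j \<le> D" shows "(\<Sum>z\<in>UNIV. Q j (dst x z) * Q j (dst z y)) = Q j (dst x y)"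
proof -
  have "(E j ** E j) $ x $ y = E j $ x $ y" using E_idem[OF assms] by simp
  thus ?thesis unfolding E_eq[OF assms] by (simp add: matrix_matrix_mult_def)
qed

lemma conv_orth:
  assumes "i \<le> D" "j \<le> D" "i \<noteq> j" shows "(\<Sum>z\<in>UNIV. Q i (dst x z) * Q j (dst z y)) = 0"
proof -
  have "(E i ** E j) $ x $ y = 0" using E_orth[OF assms] by simp
  thus ?thesis unfolding E_eq[OF assms(1)] E_eq[OF assms(2)] by (simp add: matrix_matrix_mult_def)
qed

text \<open>The conjugate of \<open>E j\<close> is some \<open>E k\<close>. If
  \<open>k \<noteq> j\<close>, the diagonal entries of \<open>E j ** E k = 0\<close> are sums of
  squared moduli of entries of \<open>E j\<close>, so \<open>E j = 0\<close>.\<close>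

lemma Q_real: assumes "j \<le> D" "i \<le> D" shows "cnj (Q j i) = Q j i"
proof -
  obtain k where k: "k \<le> D" "conj_mat (E j) = E k" using E_surj[OF conj_primitive[OF E_primitive[OF assms(1)]]] by blast
  have eq: "cnj (Q j t) = Q k t" if "t \<le> D" for t
    using k(2) that unfolding E_eq[OF k(1)] E_eq[OF assms(1)] conj_dmat dmat_eq_iff by simp
  have "k = j"
  proof (rule ccontr)
    assume "k \<noteq> j"
    have "Q j (dst x y) = 0" for x y
    proof -
      have "(\<Sum>z\<in>UNIV. Q j (dst x z) * Q k (dst z x)) = 0" using conv_orth assms(1) k \<open>k \<noteq> j\<close> by auto
      moreover have "Q j (dst x z) * Q k (dst z x) = complex_of_real ((cmod (Q j (dst x z)))\<^sup>2)" for z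
        using eq[OF dist_le_diameter, of z x] by (metis complex_norm_square dist_sym)
      ultimately have "complex_of_real (\<Sum>z\<in>UNIV. (cmod (Q j (dst x z)))\<^sup>2) = 0" by simp
      hence "(\<Sum>z\<in>UNIV. (cmod (Q j (dst x z)))\<^sup>2) = 0" by (simp only: of_real_eq_0_iff)
      hence "(cmod (Q j (dst x y)))\<^sup>2 = 0" by (subst (asm) sum_nonneg_eq_0_iff) auto
      thus ?thesis by simp
    qed
    hence "E j = 0" unfolding E_eq[OF assms(1)] by (simp add: vec_eq_iff)
    thus False using E_nonzero[OF assms(1)] by simp
  qed
  thus ?thesis using eq assms(2) by simp
qed

lemma Q_0: "i \<le> D \<Longrightarrow> Q 0 i = 1 / of_nat CARD('a)"
proof -
  assume i: "i \<le> D"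
  have "dmat (Q 0) = dmat (\<lambda>_. 1 / of_nat CARD('a))"
    using E_eq[of 0] ordering unfolding primitive_idempotent_ordering_def
    by (simp add: vec_eq_iff smult_mat_def all_ones_mat_def)
  thus ?thesis using i by (simp add: dmat_eq_iff)
qed

end

section \<open>Polynomials in the dual eigenvalues\<close>

locale q_polynomial_graph = ordered_idempotents +
  fixes as bs cs :: "nat \<Rightarrow> complex"
  assumes diameter: "3 \<le> D"
    and cs_nonzero: "i \<in> {1..D} \<Longrightarrow> cs i \<noteq> 0"
    and krein: "i \<le> D \<Longrightarrow> hadamard (E 1) (E i) =
           smult_mat (1 / of_nat CARD('a))
             ((if i = 0 then 0 else smult_mat (bs (i - 1)) (E (i - 1)))
              + smult_mat (as i) (E i)
              + (if i = D then 0 else smult_mat (cs (i + 1)) (E (i + 1))))"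
begin

definition \<theta> :: "nat \<Rightarrow> complex" where "\<theta> i = of_nat CARD('a) * Q 1 i"

lemma three_term:
  assumes "j \<le> D" "i \<le> D"
  shows "\<theta> i * Q j i = (if j = 0 then 0 else bs (j - 1) * Q (j - 1) i) + as j * Q j i
    + (if j = D then 0 else cs (Suc j) * Q (Suc j) i)"
proof -
  obtain x y where xy: "dst x y = i" using distance_attained assms(2) by blast
  have E: "E k $ x $ y = Q k i" if "k \<le> D" for k using E_eq[OF that] xy by simp
  have "hadamard (E 1) (E j) $ x $ y = Q 1 i * Q j i"
    using E[of 1] E[OF assms(1)] diameter by (simp add: hadamard_def)
  moreover have "(if j = 0 then 0 else smult_mat (bs (j - 1)) (E (j - 1))) $ x $ y
      = (if j = 0 then 0 else bs (j - 1) * Q (j - 1) i)"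
    using E[of "j - 1"] assms by (simp add: smult_mat_def)
  moreover have "(if j = D then 0 else smult_mat (cs (j + 1)) (E (j + 1))) $ x $ y
      = (if j = D then 0 else cs (Suc j) * Q (Suc j) i)"
    using E[of "Suc j"] assms by (simp add: smult_mat_def)
  moreover have "smult_mat (as j) (E j) $ x $ y = as j * Q j i"
    using E[OF assms(1)] by (simp add: smult_mat_def)
  moreover have "smult_mat k (A + B + C) $ x $ y = k * (A $ x $ y + B $ x $ y + C $ x $ y)"
    for k and A B C :: "complex^'a^'a" by (simp add: smult_mat_def)
  ultimately have "Q 1 i * Q j i = 1 / of_nat CARD('a) * ((if j = 0 then 0 else bs (j - 1) * Q (j - 1) i) + as j * Q j i
    + (if j = D then 0 else cs (Suc j) * Q (Suc j) i))"
    unfolding krein[OF assms(1)] by simp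
  thus ?thesis unfolding \<theta>_def by (simp add: field_simps)
qed

text \<open>\<open>S\<close> records which idempotents may occur in \<open>f\<close>. Initial
  segments will turn out to be the polynomials in \<open>\<theta>\<close> of bounded degree.\<close>

definition in_span :: "nat set \<Rightarrow> (nat \<Rightarrow> complex) \<Rightarrow> bool" where
  "in_span S f \<longleftrightarrow> (\<exists>x. (\<forall>j. j \<notin> S \<longrightarrow> x j = 0) \<and> (\<forall>i\<le>D. f i = (\<Sum>j\<le>D. x j * Q j i)))"

lemma in_span_cong:
  assumes "in_span S f" "\<And>i. i \<le> D \<Longrightarrow> f i = g i" shows "in_span S g"
  using assms unfolding in_span_def by auto

lemma in_span_mono: "in_span S f \<Longrightarrow> S \<subseteq> S' \<Longrightarrow> in_span S' f"
  unfolding in_span_def by blast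

lemma in_span_add:
  assumes "in_span S f" "in_span S g" shows "in_span S (\<lambda>i. f i + g i)"
proof -
  obtain x where "(\<forall>j. j \<notin> S \<longrightarrow> x j = 0) \<and> (\<forall>i\<le>D. f i = (\<Sum>j\<le>D. x j * Q j i))"
    using assms(1) unfolding in_span_def ..
  hence x: "\<And>j. j \<notin> S \<Longrightarrow> x j = 0" "\<And>i. i \<le> D \<Longrightarrow> f i = (\<Sum>j\<le>D. x j * Q j i)"
    by auto
  obtain y where "(\<forall>j. j \<notin> S \<longrightarrow> y j = 0) \<and> (\<forall>i\<le>D. g i = (\<Sum>j\<le>D. y j * Q j i))"
    using assms(2) unfolding in_span_def ..
  hence y: "\<And>j. j \<notin> S \<Longrightarrow> y j = 0" "\<And>i. i \<le> D \<Longrightarrow> g i = (\<Sum>j\<le>D. y j * Q j i)"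
    by auto
  show ?thesis unfolding in_span_def
    by (rule exI[of _ "\<lambda>j. x j + y j"]) (auto simp: x y distrib_right sum.distrib)
qed

lemma in_span_scale:
  assumes "in_span S f" shows "in_span S (\<lambda>i. k * f i)"
proof -
  obtain x where "(\<forall>j. j \<notin> S \<longrightarrow> x j = 0) \<and> (\<forall>i\<le>D. f i = (\<Sum>j\<le>D. x j * Q j i))"
    using assms unfolding in_span_def ..
  hence x: "\<And>j. j \<notin> S \<Longrightarrow> x j = 0" "\<And>i. i \<le> D \<Longrightarrow> f i = (\<Sum>j\<le>D. x j * Q j i)"
    by auto
  show ?thesis unfolding in_span_def
    by (rule exI[of _ "\<lambda>j. k * x j"]) (auto simp: x sum_distrib_left mult.assoc)
qed

lemma in_span_zero: "in_span S (\<lambda>i. 0)"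
  unfolding in_span_def by (rule exI[of _ "\<lambda>_. 0"]) simp

lemma in_span_sum: "(\<And>j. j \<in> A \<Longrightarrow> in_span S (f j)) \<Longrightarrow> in_span S (\<lambda>i. \<Sum>j\<in>A. f j i)"
  by (induction A rule: infinite_finite_induct) (simp_all add: in_span_zero in_span_add)

lemma in_span_base: assumes "j \<in> S" "j \<le> D" shows "in_span S (Q j)"
proof -
  have "(\<Sum>k\<le>D. (if k = j then 1 else 0) * Q k i) = (\<Sum>k\<le>D. if k = j then Q k i else 0)" for i
    by (intro sum.cong) auto
  thus ?thesis unfolding in_span_def
    by (intro exI[of _ "\<lambda>k. if k = j then 1 else 0"]) (use assms in auto)
qed

lemma in_span_induct:
  assumes f: "in_span S f" and base: "\<And>j. j \<in> S \<Longrightarrow> j \<le> D \<Longrightarrow> in_span S' (\<lambda>i. T (Q j) i)"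
    and lin: "\<And>x i. i \<le> D \<Longrightarrow> (\<And>i. i \<le> D \<Longrightarrow> f i = (\<Sum>j\<le>D. x j * Q j i)) \<Longrightarrow> T f i = (\<Sum>j\<le>D. x j * T (Q j) i)"
  shows "in_span S' (\<lambda>i. T f i)"
proof -
  obtain x where "(\<forall>j. j \<notin> S \<longrightarrow> x j = 0) \<and> (\<forall>i\<le>D. f i = (\<Sum>j\<le>D. x j * Q j i))"
    using f unfolding in_span_def ..
  hence x: "\<And>j. j \<notin> S \<Longrightarrow> x j = 0" "\<And>i. i \<le> D \<Longrightarrow> f i = (\<Sum>j\<le>D. x j * Q j i)"
    by auto
  have "in_span S' (\<lambda>i. \<Sum>j\<le>D. x j * T (Q j) i)"
  proof (rule in_span_sum)
    fix j assume "j \<in> {..D}"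
    thus "in_span S' (\<lambda>i. x j * T (Q j) i)"
      using base[of j] x(1)[of j] in_span_zero by (cases "j \<in> S") (auto intro: in_span_scale)
  qed
  thus ?thesis by (rule in_span_cong) (use lin x in simp)
qed

lemma in_span_theta:
  assumes f: "in_span S f" and S: "\<And>j. j \<in> S \<Longrightarrow> {j - 1, j, Suc j} \<subseteq> S'"
  shows "in_span S' (\<lambda>i. \<theta> i * f i)"
proof (rule in_span_induct[OF f, where T = "\<lambda>f i. \<theta> i * f i"])
  fix j assume j: "j \<in> S" "j \<le> D"
  have 1: "in_span S' (\<lambda>i. if j = 0 then 0 else bs (j - 1) * Q (j - 1) i)"
  proof (cases "j = 0")
    case False
    have "in_span S' (\<lambda>i. bs (j - 1) * Q (j - 1) i)"
      by (rule in_span_scale, rule in_span_base) (use S[OF j(1)] j in auto)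
    thus ?thesis using False by simp
  qed (simp add: in_span_zero)
  have 2: "in_span S' (\<lambda>i. as j * Q j i)" using S[OF j(1)] j by (auto intro: in_span_scale in_span_base)
  have 3: "in_span S' (\<lambda>i. if j = D then 0 else cs (Suc j) * Q (Suc j) i)"
  proof (cases "j = D")
    case False
    have "in_span S' (\<lambda>i. cs (Suc j) * Q (Suc j) i)"
      by (rule in_span_scale, rule in_span_base) (use S[OF j(1)] j False in auto)
    thus ?thesis using False by simp
  qed (simp add: in_span_zero)
  show "in_span S' (\<lambda>i. \<theta> i * Q j i)"
    by (rule in_span_cong[OF in_span_add[OF in_span_add[OF 1 2] 3]]) (simp add: three_term j)
qed (simp add: sum_distrib_left mult_ac)

text \<open>By the three-term recurrence each factor \<open>\<theta>\<close> spreads the indices by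
  at most one. The chain \<open>S\<close> is abstract so as to cover initial segments as well as the
  final segments \<open>{j - m..}\<close>.\<close>

lemma in_span_poly:
  assumes S: "\<And>k j. j \<in> S k \<Longrightarrow> {j - 1, j, Suc j} \<subseteq> S (Suc k)" and f: "in_span (S 0) f" and p: "degree p \<le> m"
  shows "in_span (S m) (\<lambda>i. poly p (\<theta> i) * f i)"
  using p
proof (induction m arbitrary: p)
  case 0
  then obtain a where "p = [:a:]" by (auto elim: degree_eq_zeroE)
  thus ?case using in_span_scale[OF f] by simp
next
  case (Suc m)
  obtain a q where p: "p = pCons a q" by (cases p)
  have "degree q \<le> m" using Suc.prems unfolding p by (cases "q = 0") auto
  hence 1: "in_span (S (Suc m)) (\<lambda>i. \<theta> i * (poly q (\<theta> i) * f i))"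
    using in_span_theta[OF Suc.IH] S by blast
  have "in_span (S m) (\<lambda>i. poly [:a:] (\<theta> i) * f i)" by (rule Suc.IH) simp
  hence "in_span (S (Suc m)) (\<lambda>i. poly [:a:] (\<theta> i) * f i)"
    by (rule in_span_mono) (use S in blast)
  from in_span_add[OF this 1] show ?case unfolding p by (rule in_span_cong) (simp add: algebra_simps)
qed

lemma in_span_const: "in_span {..m} (\<lambda>_. k)"
proof -
  have "in_span {..m} (\<lambda>i. (k * of_nat CARD('a)) * Q 0 i)" by (intro in_span_scale in_span_base) auto
  thus ?thesis by (rule in_span_cong) (simp add: Q_0)
qed

lemma poly_in_span: assumes "degree p \<le> m" shows "in_span {..m} (\<lambda>i. poly p (\<theta> i))"
proof -
  have "in_span {..m} (\<lambda>i. poly p (\<theta> i) * 1)"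
    by (rule in_span_poly[where S = atMost, OF _ in_span_const assms]) auto
  thus ?thesis by simp
qed

lemma poly_mult_in_span:
  assumes "degree p \<le> m" "j \<le> D" shows "in_span {j - m..} (\<lambda>i. poly p (\<theta> i) * Q j i)"
  by (rule in_span_poly[where S = "\<lambda>m. {j - m..}", OF _ _ assms(1)]) (auto intro: in_span_base assms(2))

text \<open>As \<open>cs j \<noteq> 0\<close>, the three-term recurrence can be solved for its top
  term \<open>Q j\<close>.\<close>

lemma Q_poly: "j \<le> D \<Longrightarrow> \<exists>p. degree p \<le> j \<and> (\<forall>i\<le>D. Q j i = poly p (\<theta> i))"
proof (induction j rule: less_induct)
  case (less j)
  show ?case
  proof (cases j)
    case 0
    thus ?thesis by (intro exI[of _ "[:1 / of_nat CARD('a):]"]) (simp add: Q_0)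
  next
    case (Suc k)
    obtain p where p: "degree p \<le> k" "\<And>i. i \<le> D \<Longrightarrow> Q k i = poly p (\<theta> i)" using less Suc by auto
    have "k - 1 < j" "k - 1 \<le> D" using Suc less.prems by auto
    then obtain r where r: "degree r \<le> k - 1" "\<And>i. i \<le> D \<Longrightarrow> Q (k - 1) i = poly r (\<theta> i)" using less.IH by blast
    define b' where "b' = (if k = 0 then 0 else bs (k - 1))"
    define s where "s = smult (1 / cs j) ([:- as k, 1:] * p - smult b' r)"
    have "degree s \<le> j"
      unfolding s_def using p(1) r(1) Suc
      by (intro order_trans[OF degree_smult_le] degree_diff_le order_trans[OF degree_mult_le]) auto
    moreover have "Q j i = poly s (\<theta> i)" if i: "i \<le> D" for i
    proof -
      have "\<theta> i * Q k i = b' * Q (k - 1) i + as k * Q k i + cs j * Q j i"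
        using three_term[of k i] i less.prems Suc unfolding b'_def by (auto split: if_splits)
      hence "Q j i = 1 / cs j * ((\<theta> i - as k) * Q k i - b' * Q (k - 1) i)"
        using cs_nonzero[of j] less.prems Suc by (simp add: field_simps)
      thus ?thesis unfolding s_def p(2)[OF i] r(2)[OF i] by (simp add: algebra_simps)
    qed
    ultimately show ?thesis by blast
  qed
qed

text \<open>With \<open>poly_in_span\<close> this identifies the span of
  \<open>E 0, ..., E m\<close> with the polynomials in \<open>\<theta>\<close> of degree at most
  \<open>m\<close>.\<close>

lemma in_span_imp_poly:
  assumes "in_span {..m} f" shows "\<exists>p. degree p \<le> m \<and> (\<forall>i\<le>D. f i = poly p (\<theta> i))"
proof -
  obtain x where "(\<forall>j. j \<notin> {..m} \<longrightarrow> x j = 0) \<and> (\<forall>i\<le>D. f i = (\<Sum>j\<le>D. x j * Q j i))"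
    using assms unfolding in_span_def ..
  hence x: "\<And>j. j \<notin> {..m} \<Longrightarrow> x j = 0" "\<And>i. i \<le> D \<Longrightarrow> f i = (\<Sum>j\<le>D. x j * Q j i)"
    by auto
  have "\<forall>j. \<exists>p. j \<le> D \<longrightarrow> degree p \<le> j \<and> (\<forall>i\<le>D. Q j i = poly p (\<theta> i))" using Q_poly by blast
  then obtain p where "\<forall>j. j \<le> D \<longrightarrow> degree (p j) \<le> j \<and> (\<forall>i\<le>D. Q j i = poly (p j) (\<theta> i))" by (rule exE[OF choice])
  hence p: "\<And>j. j \<le> D \<Longrightarrow> degree (p j) \<le> j"
    "\<And>j i. j \<le> D \<Longrightarrow> i \<le> D \<Longrightarrow> Q j i = poly (p j) (\<theta> i)" by auto
  have "degree (\<Sum>j\<le>D. smult (x j) (p j)) \<le> m"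
  proof (rule degree_sum_le)
    fix j assume "j \<in> {..D}"
    thus "degree (smult (x j) (p j)) \<le> m" using p(1)[of j] x(1)[of j] by (cases "j \<le> m") auto
  qed simp
  moreover have "f i = poly (\<Sum>j\<le>D. smult (x j) (p j)) (\<theta> i)" if "i \<le> D" for i
    using x(2)[OF that] p(2) that by (simp add: poly_sum)
  ultimately show ?thesis by blast
qed

text \<open>Even the indicator of one distance is a polynomial in \<open>\<theta>\<close>, so
  \<open>\<theta>\<close> separates the distances.\<close>

lemma theta_distinct: assumes "i \<le> D" "j \<le> D" "\<theta> i = \<theta> j" shows "i = j"
proof (rule ccontr)
  assume "i \<noteq> j"
  have "in_span {..D} (\<lambda>t. if t = i then 1 else 0)"
  proof -
    obtain x where "\<forall>t\<le>D. (if t = i then 1 else 0) = (\<Sum>j\<le>D. x j * Q j t)"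
      using Q_spanning[of "\<lambda>t. if t = i then 1 else 0"] by blast
    thus ?thesis unfolding in_span_def
      by (intro exI[of _ "\<lambda>j. if j \<le> D then x j else 0"]) auto
  qed
  then obtain p where p: "\<And>t. t \<le> D \<Longrightarrow> (if t = i then 1 else 0) = poly p (\<theta> t)"
    using in_span_imp_poly by blast
  have "(1::complex) = 0" using p[OF assms(1)] p[OF assms(2)] assms(3) \<open>i \<noteq> j\<close> by simp
  thus False by simp
qed

lemma adj_op_cong: assumes "\<And>i. i \<le> D \<Longrightarrow> f i = g i" "i \<le> D" shows "adj_op f i = adj_op g i"
  using assms(1)[of i] assms(1)[of "i - 1"] assms(1)[of "Suc i"] assms(2) b_diameter
  by (cases "i = D") (auto simp: adj_op_def)

lemma adj_op_sum: "adj_op (\<lambda>i. \<Sum>j\<in>A. x j * g j i) i = (\<Sum>j\<in>A. x j * adj_op (g j) i)"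
  unfolding adj_op_def by (simp add: sum_distrib_left sum.distrib sum_subtractf algebra_simps)

lemma in_span_adj_op:
  assumes f: "in_span S f" shows "in_span S (\<lambda>i. adj_op f i)"
proof (rule in_span_induct[OF f, where T = adj_op])
  fix j assume j: "j \<in> S" "j \<le> D"
  obtain \<eta> where \<eta>: "\<forall>i\<le>D. adj_op (Q j) i = \<eta> * Q j i" using Q_eigen[OF j(2)] by blast
  show "in_span S (\<lambda>i. adj_op (Q j) i)"
    by (rule in_span_cong[OF in_span_scale[OF in_span_base[OF j], of \<eta>]]) (simp add: \<eta>)
next
  fix x i assume i: "i \<le> D" and f: "\<And>i. i \<le> D \<Longrightarrow> f i = (\<Sum>j\<le>D. x j * Q j i)"
  have "adj_op f i = adj_op (\<lambda>i. \<Sum>j\<le>D. x j * Q j i) i" by (rule adj_op_cong[OF f i])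
  thus "adj_op f i = (\<Sum>j\<le>D. x j * adj_op (Q j) i)" by (simp add: adj_op_sum)
qed

section \<open>Polynomial relations among the intersection numbers, and the conic\<close>

definition up where "up i = of_nat (b i) * (\<theta> i - \<theta> (Suc i))"
definition down where "down i = of_nat (c i) * (\<theta> (i - 1) - \<theta> i)"

lemma linear_relation: "\<exists>p. degree p \<le> 1 \<and> (\<forall>i\<le>D. down i - up i = poly p (\<theta> i))"
proof -
  have "in_span {..1} \<theta>" using poly_in_span[of "[:0, 1:]" 1] by simp
  from in_span_imp_poly[OF in_span_adj_op[OF this]]
  obtain p where p: "degree p \<le> 1" "\<And>i. i \<le> D \<Longrightarrow> adj_op \<theta> i = poly p (\<theta> i)" by auto
  have "down i - up i = poly (p - [:0, of_nat (b 0):]) (\<theta> i)" if "i \<le> D" for i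
    using p(2)[OF that] by (simp add: adj_op_def up_def down_def algebra_simps)
  moreover have "degree (p - [:0, of_nat (b 0):]) \<le> 1" using p(1) by (intro degree_diff_le) auto
  ultimately show ?thesis by blast
qed

lemma quadratic_relation:
  "\<exists>p. degree p \<le> 2 \<and> (\<forall>i\<le>D. down i * (\<theta> (i - 1) - \<theta> i) + up i * (\<theta> i - \<theta> (Suc i)) = poly p (\<theta> i))"
proof -
  have "in_span {..2} (\<lambda>i. (\<theta> i)\<^sup>2)" using poly_in_span[of "[:0, 0, 1:]" 2] by (simp add: power2_eq_square)
  from in_span_imp_poly[OF in_span_adj_op[OF this]]
  obtain p where p: "degree p \<le> 2" "\<And>i. i \<le> D \<Longrightarrow> adj_op (\<lambda>i. (\<theta> i)\<^sup>2) i = poly p (\<theta> i)" by auto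
  obtain p1 where p1: "degree p1 \<le> 1" "\<And>i. i \<le> D \<Longrightarrow> down i - up i = poly p1 (\<theta> i)"
    using linear_relation by blast
  \<comment> \<open>Squares of adjacent nodes are expanded about \<open>\<theta> i\<close>; the
    cross terms \<open>2 * \<theta> i * (down i - up i)\<close> are removed with
    \<open>p1\<close>.\<close>
  define r where "r = p - [:0, 0, of_nat (b 0):] - [:0, 2:] * p1"
  have "down i * (\<theta> (i - 1) - \<theta> i) + up i * (\<theta> i - \<theta> (Suc i)) = poly r (\<theta> i)" if "i \<le> D" for i
    unfolding r_def
    by (simp add: p(2)[OF that, symmetric] p1(2)[OF that, symmetric] adj_op_def up_def down_def power2_eq_square algebra_simps)
  moreover have "degree r \<le> 2" unfolding r_def using p(1) p1(1)
    by (intro degree_diff_le order_trans[OF degree_mult_le]) auto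
  ultimately show ?thesis by blast
qed

lemma quadratic_system: "quadratic_system D \<theta> up down"
  unfolding quadratic_system_def affine_system_def using linear_relation quadratic_relation
  by (simp add: up_def down_def b_diameter c_0)

text \<open>With eigenvalue \<open>b 0\<close> the eigenvector equation becomes a recursion for
  consecutive differences starting at 0, and \<open>b i > 0\<close> makes \<open>Q j\<close>
  constant. Then \<open>E j\<close> would be a multiple of \<open>E 0\<close>.\<close>

lemma eigenvalue_ne_degree:
  assumes j: "1 \<le> j" "j \<le> D" and \<eta>: "\<And>i. i \<le> D \<Longrightarrow> adj_op (Q j) i = \<eta> * Q j i"
  shows "\<eta> \<noteq> of_nat (b 0)"
proof
  assume "\<eta> = of_nat (b 0)"
  hence eq: "of_nat (c i) * (Q j (i - 1) - Q j i) + of_nat (b i) * (Q j (Suc i) - Q j i) = 0" if "i \<le> D" for i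
    using \<eta>[OF that] unfolding adj_op_def by simp
  have step: "Q j (Suc i) = Q j i" if "Suc i \<le> D" for i
    using that
  proof (induction i)
    case 0 thus ?case using eq[of 0] b_pos[of 0] by (simp add: c_0)
  next
    case (Suc i) thus ?case using eq[of "Suc i"] b_pos[of "Suc i"] by simp
  qed
  have const: "Q j i = Q j 0" if "i \<le> D" for i
    using that by (induction i) (auto simp: step)
  define x where "x k = (if k = j then 1 else if k = 0 then - of_nat CARD('a) * Q j 0 else 0)" for k
  have "x j = 0"
  proof (rule Q_independent[OF _ j(2)])
    fix i assume i: "i \<le> D"
    have "(\<Sum>k\<le>D. x k * Q k i) = (\<Sum>k\<in>{0, j}. x k * Q k i)"
      by (rule sum.mono_neutral_right) (use j in \<open>auto simp: x_def\<close>)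
    also have "\<dots> = 0" using j Q_0[OF i] const[OF i] by (simp add: x_def)
    finally show "(\<Sum>k\<le>D. x k * Q k i) = 0" .
  qed
  thus False by (simp add: x_def)
qed

text \<open>The operator multiplies the coefficient of each \<open>Q j\<close> with
  \<open>j \<ge> 1\<close> by a nonzero number, so coefficients above \<open>m\<close> that vanish
  afterwards vanished before.\<close>

lemma in_span_if_adj_op:
  assumes "in_span {..m} (\<lambda>i. adj_op f i - of_nat (b 0) * f i)" shows "in_span {..m} f"
proof -
  obtain x where x: "\<And>i. i \<le> D \<Longrightarrow> f i = (\<Sum>j\<le>D. x j * Q j i)" using Q_spanning by blast
  obtain y where "(\<forall>j. j \<notin> {..m} \<longrightarrow> y j = 0) \<and> (\<forall>i\<le>D. adj_op f i - of_nat (b 0) * f i = (\<Sum>j\<le>D. y j * Q j i))"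
    using assms unfolding in_span_def ..
  hence y: "\<And>j. j \<notin> {..m} \<Longrightarrow> y j = 0" "\<And>i. i \<le> D \<Longrightarrow> adj_op f i - of_nat (b 0) * f i = (\<Sum>j\<le>D. y j * Q j i)"
    by auto
  have "\<forall>j. \<exists>\<eta>. j \<le> D \<longrightarrow> (\<forall>i\<le>D. adj_op (Q j) i = \<eta> * Q j i)" using Q_eigen by blast
  then obtain \<eta> where "\<forall>j. j \<le> D \<longrightarrow> (\<forall>i\<le>D. adj_op (Q j) i = \<eta> j * Q j i)" by (rule exE[OF choice])
  hence \<eta>: "\<And>j i. j \<le> D \<Longrightarrow> i \<le> D \<Longrightarrow> adj_op (Q j) i = \<eta> j * Q j i" by blast
  have "(\<eta> j - of_nat (b 0)) * x j - y j = 0" if j: "j \<le> D" for j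
  proof (rule Q_independent[OF _ j, of "\<lambda>j. (\<eta> j - of_nat (b 0)) * x j - y j"])
    fix i assume i: "i \<le> D"
    have "adj_op f i = adj_op (\<lambda>i. \<Sum>j\<le>D. x j * Q j i) i" by (rule adj_op_cong[OF x i])
    also have "\<dots> = (\<Sum>j\<le>D. x j * (\<eta> j * Q j i))" unfolding adj_op_sum using \<eta> i by simp
    finally have "(\<Sum>j\<le>D. x j * (\<eta> j * Q j i)) - of_nat (b 0) * (\<Sum>j\<le>D. x j * Q j i) = (\<Sum>j\<le>D. y j * Q j i)"
      using y(2)[OF i] x[OF i] by simp
    thus "(\<Sum>j\<le>D. ((\<eta> j - of_nat (b 0)) * x j - y j) * Q j i) = 0"
      by (simp add: sum_distrib_left sum_subtractf sum.distrib algebra_simps)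
  qed
  hence eq: "(\<eta> j - of_nat (b 0)) * x j = y j" if "j \<le> D" for j using that by simp
  have "x j = 0" if "j \<notin> {..m}" "j \<le> D" for j
  proof -
    have "\<eta> j \<noteq> of_nat (b 0)" by (rule eigenvalue_ne_degree[of j]) (use that \<eta> in auto)
    thus ?thesis using eq[OF that(2)] y(1)[OF that(1)] by simp
  qed
  thus ?thesis unfolding in_span_def
    by (intro exI[of _ "\<lambda>j. if j \<le> D then x j else 0"]) (auto simp: x)
qed

text \<open>The commutator identity behind Leonard's theorem: the function \<open>Z\<close> with
  \<open>Z i - Z (i + 1) = \<theta> i * \<theta> (i + 1) * (\<theta> i - \<theta> (i + 1))\<close> is a cubic polynomial in \<open>\<theta>\<close>.\<close>

lemma conic_sequence_theta: "\<exists>\<beta> \<gamma> \<rho>. conic_sequence D \<theta> \<beta> \<gamma> \<rho>"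
proof -
  define Z where "Z i = - (\<Sum>l<i. \<theta> l * \<theta> (Suc l) * (\<theta> l - \<theta> (Suc l)))" for i
  have Zd: "Z i - Z (Suc i) = \<theta> i * \<theta> (Suc i) * (\<theta> i - \<theta> (Suc i))" for i by (simp add: Z_def)
  obtain p1 where p1: "degree p1 \<le> 1" "\<And>i. i \<le> D \<Longrightarrow> down i - up i = poly p1 (\<theta> i)"
    using linear_relation by blast
  obtain p2 where p2: "degree p2 \<le> 2"
    "\<And>i. i \<le> D \<Longrightarrow> down i * (\<theta> (i - 1) - \<theta> i) + up i * (\<theta> i - \<theta> (Suc i)) = poly p2 (\<theta> i)"
    using quadratic_relation by blast
  \<comment> \<open>Writing the adjacent nodes as \<open>\<theta> i\<close> plus or minus a gap
    shows that the image of \<open>Z\<close> is \<open>\<theta>\<^sup>2\<close> times the linear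
    relation plus \<open>\<theta>\<close> times the quadratic one.\<close>
  define r where "r = [:0, 0, 1:] * p1 + [:0, 1:] * p2"
  have "degree r \<le> 3" unfolding r_def using p1(1) p2(1)
    by (intro degree_add_le order_trans[OF degree_mult_le]) auto
  hence "in_span {..3} (\<lambda>i. poly r (\<theta> i))" by (rule poly_in_span)
  hence "in_span {..3} (\<lambda>i. adj_op Z i - of_nat (b 0) * Z i)"
  proof (rule in_span_cong)
    fix i assume i: "i \<le> D"
    have "of_nat (c i) * (Z (i - 1) - Z i) = down i * \<theta> (i - 1) * \<theta> i"
    proof (cases i)
      case 0 thus ?thesis by (simp add: down_def c_0)
    next
      case (Suc k) thus ?thesis using Zd[of k] by (simp add: down_def)
    qed
    moreover have "of_nat (b i) * (Z i - Z (Suc i)) = up i * \<theta> i * \<theta> (Suc i)"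
      unfolding Zd by (simp add: up_def)
    moreover have "adj_op Z i - of_nat (b 0) * Z i = of_nat (c i) * (Z (i - 1) - Z i) - of_nat (b i) * (Z i - Z (Suc i))"
      by (simp add: adj_op_def algebra_simps)
    ultimately show "poly r (\<theta> i) = adj_op Z i - of_nat (b 0) * Z i"
      unfolding r_def by (simp add: p1(2)[OF i, symmetric] p2(2)[OF i, symmetric] algebra_simps)
  qed
  from in_span_imp_poly[OF in_span_if_adj_op[OF this]]
  obtain z where z: "degree z \<le> 3" "\<And>i. i \<le> D \<Longrightarrow> Z i = poly z (\<theta> i)" by auto
  define z0 z1 z2 z3 where "z0 = coeff z 0" "z1 = coeff z 1" "z2 = coeff z 2" "z3 = coeff z 3"
  have zz: "z = [:z0, z1, z2, z3:]"
  proof (rule poly_eqI)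
    fix n :: nat
    have "n = 0 \<or> n = 1 \<or> n = 2 \<or> n = 3 \<or> n > 3" by auto
    thus "coeff z n = coeff [:z0, z1, z2, z3:] n"
      using z(1) by (auto simp: z0_z1_z2_z3_def numeral_2_eq_2 numeral_3_eq_3 coeff_eq_0)
  qed
  \<comment> \<open>By the choice of \<open>Z\<close>, the difference quotient of the cubic
    \<open>z\<close> at adjacent nodes is their product.\<close>
  have rel: "z1 + z2 * (\<theta> i + \<theta> (Suc i)) + z3 * ((\<theta> i)\<^sup>2 + \<theta> i * \<theta> (Suc i) + (\<theta> (Suc i))\<^sup>2) = \<theta> i * \<theta> (Suc i)"
    if i: "i < D" for i
  proof -
    let ?x = "\<theta> i" and ?y = "\<theta> (Suc i)"
    have ne: "?x - ?y \<noteq> 0" using theta_distinct[of i "Suc i"] i by auto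
    have "poly z ?x - poly z ?y = ?x * ?y * (?x - ?y)" using Zd[of i] z(2)[of i] z(2)[of "Suc i"] i by simp
    hence "(?x - ?y) * (z1 + z2 * (?x + ?y) + z3 * (?x\<^sup>2 + ?x * ?y + ?y\<^sup>2)) = (?x - ?y) * (?x * ?y)"
      unfolding zz by (simp add: algebra_simps power2_eq_square)
    thus ?thesis using ne by simp
  qed
  \<comment> \<open>For \<open>z3 = 0\<close>, subtracting the relations of two adjacent pairs
    forces their common node to be \<open>z2\<close>. As \<open>D \<ge> 3\<close>, there are two
    such nodes, which are distinct.\<close>
  have z3: "z3 \<noteq> 0"
  proof
    assume z30: "z3 = 0"
    have "\<theta> (Suc i) = z2" if "Suc i < D" for i
    proof -
      have "(\<theta> i - \<theta> (Suc (Suc i))) * (\<theta> (Suc i) - z2) = 0"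
        using rel[of i] rel[of "Suc i"] that z30 by (simp add: algebra_simps) algebra
      moreover have "\<theta> i - \<theta> (Suc (Suc i)) \<noteq> 0" using theta_distinct[of i "Suc (Suc i)"] that by auto
      ultimately show ?thesis by simp
    qed
    from this[of 0] this[of 1] have "\<theta> 1 = \<theta> 2" using diameter by (simp add: numeral_2_eq_2)
    thus False using theta_distinct[of 1 2] diameter by simp
  qed
  have "conic_sequence D \<theta> ((1 - z3) / z3) (- z2 / z3) (- z1 / z3)"
  proof
    fix i assume "i < D"
    have "z3 * ((1 - z3) / z3) = 1 - z3" "z3 * (- z2 / z3) = - z2" "z3 * (- z1 / z3) = - z1" using z3 by simp_all
    hence "z3 * conic ((1 - z3) / z3) (- z2 / z3) (- z1 / z3) x y
      = z1 + z2 * (x + y) + z3 * (x\<^sup>2 + x * y + y\<^sup>2) - x * y" for x y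
      unfolding conic_def by algebra
    from this[of "\<theta> i" "\<theta> (Suc i)"]
    show "conic ((1 - z3) / z3) (- z2 / z3) (- z1 / z3) (\<theta> i) (\<theta> (Suc i)) = 0"
      using rel[OF \<open>i < D\<close>] z3 by simp
  qed (rule theta_distinct)
  thus ?thesis by blast
qed

section \<open>Reality and positivity\<close>

lemma theta_real: "i \<le> D \<Longrightarrow> \<theta> i = of_real (Re (\<theta> i))"
  using Q_real[of 1 i] diameter unfolding \<theta>_def by (simp add: complex_eq_iff)

lemma Q_square_sum: assumes "j \<le> D" shows "Q j 0 = of_real (\<Sum>z\<in>UNIV. (cmod (Q j (dst x z)))\<^sup>2)"
proof -
  have "Q j (dst x z) * Q j (dst z x) = of_real ((cmod (Q j (dst x z)))\<^sup>2)" for z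
    using Q_real[OF assms dist_le_diameter, of x z] by (metis complex_norm_square dist_sym)
  thus ?thesis using conv_idem[OF assms, of x x] dist_0_iff[of x x] by simp
qed

lemma Q_0_nonzero: assumes "j \<le> D" shows "Q j 0 \<noteq> 0"
proof
  assume 0: "Q j 0 = 0"
  have "Q j (dst x y) = 0" for x y
  proof -
    have "complex_of_real (\<Sum>z\<in>UNIV. (cmod (Q j (dst x z)))\<^sup>2) = 0"
      unfolding Q_square_sum[OF assms, of x, symmetric] by (rule 0)
    hence "(\<Sum>z\<in>UNIV. (cmod (Q j (dst x z)))\<^sup>2) = 0" by (simp only: of_real_eq_0_iff)
    hence "(cmod (Q j (dst x y)))\<^sup>2 = 0" by (subst (asm) sum_nonneg_eq_0_iff) auto
    thus ?thesis by simp
  qed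
  hence "E j = 0" unfolding E_eq[OF assms] by (simp add: vec_eq_iff)
  thus False using E_nonzero[OF assms] by simp
qed

text \<open>\<open>E 1\<close> is the Gram matrix of its rows: rows \<open>x\<close> and
  \<open>y\<close> have squared distance \<open>2 * (Q 1 0 - Q 1 i)\<close>. Strictness comes from
  \<open>theta_distinct\<close>.\<close>

lemma theta_less: assumes "1 \<le> i" "i \<le> D" shows "Re (\<theta> i) < Re (\<theta> 0)"
proof -
  obtain x y where xy: "dst x y = i" using distance_attained assms(2) by blast
  have 1: "1 \<le> D" using diameter by simp
  let ?q = "\<lambda>z. Re (Q 1 z)"
  have q: "Q 1 (dst u z) = of_real (?q (dst u z))" for u z
    using Q_real[OF 1 dist_le_diameter, of u z] by (simp add: complex_eq_iff)
  have conv: "(\<Sum>z\<in>UNIV. ?q (dst u z) * ?q (dst v z)) = ?q (dst u v)" for u v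
  proof -
    have "of_real (?q (dst u z) * ?q (dst v z)) = Q 1 (dst u z) * Q 1 (dst z v)" for z
      unfolding of_real_mult q[of u z, symmetric] q[of v z, symmetric] dist_sym[of z v] ..
    hence "of_real (\<Sum>z\<in>UNIV. ?q (dst u z) * ?q (dst v z)) = (\<Sum>z\<in>UNIV. Q 1 (dst u z) * Q 1 (dst z v))"
      by simp
    also have "\<dots> = of_real (?q (dst u v))" unfolding conv_idem[OF 1] by (rule q)
    finally show ?thesis by (simp only: of_real_eq_iff)
  qed
  have "0 \<le> (\<Sum>z\<in>UNIV. (?q (dst x z) - ?q (dst y z))\<^sup>2)" by (rule sum_nonneg) simp
  also have "\<dots> = (\<Sum>z\<in>UNIV. ?q (dst x z) * ?q (dst x z)) + (\<Sum>z\<in>UNIV. ?q (dst y z) * ?q (dst y z))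
      - 2 * (\<Sum>z\<in>UNIV. ?q (dst x z) * ?q (dst y z))"
    by (simp add: power2_eq_square algebra_simps sum.distrib sum_subtractf sum_distrib_left)
  also have "\<dots> = 2 * (?q 0 - ?q i)" unfolding conv using xy dist_0_iff[of x x] dist_0_iff[of y y] by simp
  finally have "?q i \<le> ?q 0" by simp
  hence "Re (\<theta> i) \<le> Re (\<theta> 0)" unfolding \<theta>_def by simp
  moreover have "Re (\<theta> i) \<noteq> Re (\<theta> 0)"
    using theta_distinct[of i 0] theta_real[of i] theta_real[of 0] assms by auto
  ultimately show ?thesis by simp
qed

end

section \<open>Vertex subsets of minimal width and dual width\<close>

lemma prod_linear_factors_degree:
  fixes \<theta> :: "nat \<Rightarrow> 'a::field"
  assumes "finite L" shows "degree (\<Prod>l\<in>L. [:- \<theta> l, 1:]) = card L"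
  using assms by (subst degree_prod_eq_sum_degree) auto

lemma poly_prod_linear_factors:
  fixes \<theta> :: "nat \<Rightarrow> 'a::field"
  shows "poly (\<Prod>l\<in>L. [:- \<theta> l, 1:]) x = (\<Prod>l\<in>L. x - \<theta> l)"
  unfolding poly_prod by (intro prod.cong refl) (simp add: algebra_simps)

text \<open>The test polynomial of degree \<open>w - 1\<close> vanishes at all nodes but those of
  indices 0 and \<open>i\<close>. For distinct nodes \<open>\<mu>\<close> is thus a multiple of the
  divided difference of order \<open>w\<close>.\<close>

lemma orthogonal_to_polynomials:
  fixes \<theta> \<mu> :: "nat \<Rightarrow> 'a::field"
  assumes orth: "\<And>p. degree p < w \<Longrightarrow> (\<Sum>i\<le>w. \<mu> i * poly p (\<theta> i)) = 0" and i: "i \<le> w"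
  shows "\<mu> i * (\<Prod>l\<in>{..w} - {i}. \<theta> i - \<theta> l) = \<mu> 0 * (\<Prod>l\<in>{..w} - {0}. \<theta> 0 - \<theta> l)"
proof (cases "i = 0")
  case False
  define L where "L = {..w} - {0, i}"
  define p where "p = (\<Prod>l\<in>L. [:- \<theta> l, 1:])"
  have pp: "poly p x = (\<Prod>l\<in>L. x - \<theta> l)" for x unfolding p_def by (rule poly_prod_linear_factors)
  have "degree p = card L" unfolding p_def by (rule prod_linear_factors_degree) (simp add: L_def)
  also have "\<dots> < w" using i False by (simp add: L_def card_Diff_subset)
  finally have "(\<Sum>j\<le>w. \<mu> j * poly p (\<theta> j)) = 0" by (rule orth)
  also have "(\<Sum>j\<le>w. \<mu> j * poly p (\<theta> j)) = (\<Sum>j\<in>{0, i}. \<mu> j * poly p (\<theta> j))"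
  proof (rule sum.mono_neutral_right)
    show "\<forall>j\<in>{..w} - {0, i}. \<mu> j * poly p (\<theta> j) = 0"
    proof
      fix j assume j: "j \<in> {..w} - {0, i}"
      have "finite L" by (simp add: L_def)
      thus "\<mu> j * poly p (\<theta> j) = 0" unfolding pp using j by (auto simp: L_def[symmetric])
    qed
  qed (use i in auto)
  finally have eq: "\<mu> 0 * poly p (\<theta> 0) + \<mu> i * poly p (\<theta> i) = 0" using False by simp
  have "{..w} - {i} = insert 0 L" "{..w} - {0} = insert i L" "0 \<notin> L" "i \<notin> L" "finite L"
    using i False by (auto simp: L_def)
  hence "(\<Prod>l\<in>{..w} - {i}. \<theta> i - \<theta> l) = (\<theta> i - \<theta> 0) * poly p (\<theta> i)"
    "(\<Prod>l\<in>{..w} - {0}. \<theta> 0 - \<theta> l) = (\<theta> 0 - \<theta> i) * poly p (\<theta> 0)"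
    unfolding pp by simp_all
  thus ?thesis using eq by algebra
qed simp

text \<open>Subtract from \<open>s\<close> its affine interpolant at the nodes 0 and 1. Times
  \<open>\<mu>\<close>, the remainder still annihilates degrees below \<open>w - 1\<close>, and a
  polynomial vanishing at all nodes but 0, 1 and \<open>i\<close> isolates its value at
  \<open>i\<close>.\<close>

lemma affine_if_orthogonal:
  fixes \<theta> \<mu> s :: "nat \<Rightarrow> 'a::field"
  assumes orth: "\<And>p. degree p < w \<Longrightarrow> (\<Sum>i\<le>w. \<mu> i * poly p (\<theta> i)) = 0"
    and orth': "\<And>p. degree p + 1 < w \<Longrightarrow> (\<Sum>i\<le>w. \<mu> i * s i * poly p (\<theta> i)) = 0"
    and dist: "\<And>i j. i \<le> w \<Longrightarrow> j \<le> w \<Longrightarrow> \<theta> i = \<theta> j \<Longrightarrow> i = j"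
    and \<mu>: "\<And>i. i \<le> w \<Longrightarrow> \<mu> i \<noteq> 0" and i: "i \<le> w" and w: "2 \<le> w"
  shows "s i = s 0 + (s 1 - s 0) / (\<theta> 1 - \<theta> 0) * (\<theta> i - \<theta> 0)"
proof -
  define m where "m = (s 1 - s 0) / (\<theta> 1 - \<theta> 0)"
  define t where "t i = s i - (s 0 + m * (\<theta> i - \<theta> 0))" for i
  have ne: "\<theta> 1 - \<theta> 0 \<noteq> 0" using dist[of 1 0] w by auto
  have t01: "t 0 = 0" "t 1 = 0" using ne by (simp_all add: t_def m_def)
  have "t i = 0"
  proof (cases "i = 0 \<or> i = 1")
    case False
    define L where "L = {..w} - {0, 1, i}"
    define p where "p = (\<Prod>l\<in>L. [:- \<theta> l, 1:])"
    have pp: "poly p x = (\<Prod>l\<in>L. x - \<theta> l)" for x unfolding p_def by (rule poly_prod_linear_factors)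
    have fin: "finite L" by (simp add: L_def)
    have "card {0, 1, i} = 3" using False by auto
    hence "card L = w + 1 - 3" using i w unfolding L_def by (subst card_Diff_subset) auto
    hence deg: "degree p + 1 < w" unfolding p_def using w by (simp add: prod_linear_factors_degree fin)
    define a where "a = [:s 0 - m * \<theta> 0, m:]"
    have "degree (a * p) < w" using deg degree_mult_le[of a p] by (auto simp: a_def split: if_splits)
    from orth[OF this] have "(\<Sum>j\<le>w. \<mu> j * (s 0 + m * (\<theta> j - \<theta> 0)) * poly p (\<theta> j)) = 0"
      by (simp add: a_def algebra_simps)
    hence "(\<Sum>j\<le>w. \<mu> j * t j * poly p (\<theta> j)) = 0"
      using orth'[OF deg] by (simp add: t_def right_diff_distrib left_diff_distrib sum_subtractf)
    also have "(\<Sum>j\<le>w. \<mu> j * t j * poly p (\<theta> j)) = (\<Sum>j\<in>{i}. \<mu> j * t j * poly p (\<theta> j))"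
    proof (rule sum.mono_neutral_right)
      show "\<forall>j\<in>{..w} - {i}. \<mu> j * t j * poly p (\<theta> j) = 0"
      proof
        fix j assume "j \<in> {..w} - {i}"
        hence "j = 0 \<or> j = 1 \<or> j \<in> L" by (auto simp: L_def)
        thus "\<mu> j * t j * poly p (\<theta> j) = 0" unfolding pp using t01 fin by auto
      qed
    qed (use i in auto)
    finally have "\<mu> i * t i * poly p (\<theta> i) = 0" by simp
    moreover have "poly p (\<theta> i) \<noteq> 0" unfolding pp using dist[OF i] fin by (auto simp: L_def)
    ultimately show ?thesis using \<mu>[OF i] by simp
  qed (use t01 in auto)
  thus ?thesis unfolding t_def m_def by simp
qed

text \<open>Stated through bounds rather than through \<open>width\<close> and
  \<open>dual_width\<close>, so that a descendent is an instance and so is the whole vertex set with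
  \<open>w = D\<close>.\<close>

locale minimal_width_set = q_polynomial_graph +
  fixes Y :: "'a set" and w :: nat
  assumes width_le: "x \<in> Y \<Longrightarrow> y \<in> Y \<Longrightarrow> dst x y \<le> w" and w_le: "w \<le> D"
    and dual_width_le: "D - w < h \<Longrightarrow> h \<le> D \<Longrightarrow> (\<Sum>x\<in>Y. \<Sum>y\<in>Y. Q h (dst x y)) = 0"
begin

text \<open>The squared norm of \<open>E j diag(Y) E h\<close> is the quadratic form at
  \<open>Y\<close> of the entrywise product of \<open>E j\<close> and \<open>E h\<close>, which
  involves only idempotents of index at least \<open>j - h > D - w\<close>. The entries are real, so
  all of them vanish.\<close>

lemma product_vanishes:
  assumes "j \<le> D" "h \<le> D" "h + (D - w) < j"
  shows "(\<Sum>z\<in>Y. Q j (dst x z) * Q h (dst y z)) = 0"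
proof -
  define s where "s x y = (\<Sum>z\<in>Y. Q j (dst x z) * Q h (dst y z))" for x y
  obtain p where p: "degree p \<le> h" "\<And>i. i \<le> D \<Longrightarrow> Q h i = poly p (\<theta> i)" using Q_poly[OF assms(2)] by blast
  obtain \<xi> where "(\<forall>t. t \<notin> {j - h..} \<longrightarrow> \<xi> t = 0) \<and> (\<forall>i\<le>D. poly p (\<theta> i) * Q j i = (\<Sum>t\<le>D. \<xi> t * Q t i))"
    using poly_mult_in_span[OF p(1) assms(1)] unfolding in_span_def ..
  hence \<xi>: "\<And>t. t \<notin> {j - h..} \<Longrightarrow> \<xi> t = 0" "\<And>i. i \<le> D \<Longrightarrow> poly p (\<theta> i) * Q j i = (\<Sum>t\<le>D. \<xi> t * Q t i)"
    by auto
  have "(\<Sum>x\<in>UNIV. \<Sum>y\<in>UNIV. s x y * s x y)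
    = (\<Sum>x\<in>UNIV. \<Sum>y\<in>UNIV. \<Sum>z\<in>Y. \<Sum>z'\<in>Y. (Q j (dst z x) * Q j (dst x z')) * (Q h (dst z y) * Q h (dst y z')))"
    unfolding s_def sum_product by (intro sum.cong refl) (simp add: dist_sym mult_ac)
  also have "\<dots> = (\<Sum>z\<in>Y. \<Sum>z'\<in>Y. \<Sum>x\<in>UNIV. \<Sum>y\<in>UNIV. (Q j (dst z x) * Q j (dst x z')) * (Q h (dst z y) * Q h (dst y z')))"
    unfolding sum.swap[of _ UNIV Y] ..
  also have "\<dots> = (\<Sum>z\<in>Y. \<Sum>z'\<in>Y. Q j (dst z z') * Q h (dst z z'))"
    unfolding sum_product[symmetric] conv_idem[OF assms(1)] conv_idem[OF assms(2)] ..
  also have "\<dots> = (\<Sum>z\<in>Y. \<Sum>z'\<in>Y. \<Sum>t\<le>D. \<xi> t * Q t (dst z z'))"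
    by (intro sum.cong refl) (simp add: p(2) \<xi>(2)[symmetric] dist_le_diameter mult.commute)
  also have "\<dots> = (\<Sum>t\<le>D. \<xi> t * (\<Sum>z\<in>Y. \<Sum>z'\<in>Y. Q t (dst z z')))"
    unfolding sum.swap[of _ "{..D}" Y] sum_distrib_left ..
  also have "\<dots> = 0"
  proof (rule sum.neutral, rule ballI)
    fix t assume "t \<in> {..D}"
    thus "\<xi> t * (\<Sum>z\<in>Y. \<Sum>z'\<in>Y. Q t (dst z z')) = 0"
      using \<xi>(1)[of t] dual_width_le[of t] assms by (cases "t \<in> {j - h..}") auto
  qed
  finally have z: "(\<Sum>x\<in>UNIV. \<Sum>y\<in>UNIV. s x y * s x y) = 0" .
  have "cnj (s x y) = s x y" for x y
    unfolding s_def using Q_real assms dist_le_diameter by simp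
  hence "s x y * s x y = of_real ((cmod (s x y))\<^sup>2)" for x y by (metis complex_norm_square)
  hence "of_real (\<Sum>x\<in>UNIV. \<Sum>y\<in>UNIV. (cmod (s x y))\<^sup>2) = (0::complex)" using z by simp
  hence "(\<Sum>x\<in>UNIV. \<Sum>y\<in>UNIV. (cmod (s x y))\<^sup>2) = 0" by (simp only: of_real_eq_0_iff)
  hence "(\<Sum>y\<in>UNIV. (cmod (s x y))\<^sup>2) = 0" by (subst (asm) sum_nonneg_eq_0_iff) (auto intro: sum_nonneg)
  hence "(cmod (s x y))\<^sup>2 = 0" by (subst (asm) sum_nonneg_eq_0_iff) auto
  thus ?thesis unfolding s_def by simp
qed

text \<open>The first two factors involve idempotents of index at least \<open>D - m\<close>, the
  last one those of index at most \<open>a\<close>; \<open>m + a < w\<close> keeps the ranges more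
  than \<open>D - w\<close> apart.\<close>

lemma polynomial_products_vanish:
  assumes p: "degree p \<le> m" and r: "degree r \<le> a" and ma: "m + a < w"
  shows "(\<Sum>z\<in>Y. Q D (dst x z) * poly p (\<theta> (dst x z)) * poly r (\<theta> (dst y z))) = 0"
proof -
  obtain \<xi> where "(\<forall>t. t \<notin> {D - m..} \<longrightarrow> \<xi> t = 0) \<and> (\<forall>i\<le>D. poly p (\<theta> i) * Q D i = (\<Sum>t\<le>D. \<xi> t * Q t i))"
    using poly_mult_in_span[OF p order_refl] unfolding in_span_def ..
  hence \<xi>: "\<And>t. t \<notin> {D - m..} \<Longrightarrow> \<xi> t = 0" "\<And>i. i \<le> D \<Longrightarrow> poly p (\<theta> i) * Q D i = (\<Sum>t\<le>D. \<xi> t * Q t i)"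
    by auto
  obtain \<eta> where "(\<forall>t. t \<notin> {..a} \<longrightarrow> \<eta> t = 0) \<and> (\<forall>i\<le>D. poly r (\<theta> i) = (\<Sum>t\<le>D. \<eta> t * Q t i))"
    using poly_in_span[OF r] unfolding in_span_def ..
  hence \<eta>: "\<And>t. t \<notin> {..a} \<Longrightarrow> \<eta> t = 0" "\<And>i. i \<le> D \<Longrightarrow> poly r (\<theta> i) = (\<Sum>t\<le>D. \<eta> t * Q t i)"
    by auto
  have "(\<Sum>z\<in>Y. Q D (dst x z) * poly p (\<theta> (dst x z)) * poly r (\<theta> (dst y z)))
    = (\<Sum>z\<in>Y. (\<Sum>j\<le>D. \<xi> j * Q j (dst x z)) * (\<Sum>h\<le>D. \<eta> h * Q h (dst y z)))"
    by (intro sum.cong refl) (simp add: \<xi>(2)[symmetric] \<eta>(2)[symmetric] dist_le_diameter mult.commute)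
  also have "\<dots> = (\<Sum>z\<in>Y. \<Sum>j\<le>D. \<Sum>h\<le>D. \<xi> j * \<eta> h * (Q j (dst x z) * Q h (dst y z)))"
    unfolding sum_product by (intro sum.cong refl) (simp add: mult_ac)
  also have "\<dots> = (\<Sum>j\<le>D. \<Sum>h\<le>D. \<xi> j * \<eta> h * (\<Sum>z\<in>Y. Q j (dst x z) * Q h (dst y z)))"
    unfolding sum.swap[of _ "{..D}" Y] sum_distrib_left ..
  also have "\<dots> = 0"
  proof (intro sum.neutral ballI)
    fix j h assume jh: "j \<in> {..D}" "h \<in> {..D}"
    show "\<xi> j * \<eta> h * (\<Sum>z\<in>Y. Q j (dst x z) * Q h (dst y z)) = 0"
    proof (cases "D - m \<le> j \<and> h \<le> a")
      case True
      hence "h + (D - w) < j" using ma w_le by linarith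
      thus ?thesis using product_vanishes jh by simp
    next
      case False
      thus ?thesis using \<xi>(1)[of j] \<eta>(1)[of h] by auto
    qed
  qed
  finally show ?thesis .
qed

lemma sum_by_distance:
  assumes x: "x \<in> Y"
  shows "(\<Sum>z\<in>Y. g z) = (\<Sum>i\<le>w. \<Sum>z | z \<in> Y \<and> dst x z = i. g z)"
proof -
  have "(\<Sum>z\<in>Y. g z) = (\<Sum>i\<in>{..w}. sum g {z \<in> Y. dst x z = i})"
    by (rule sum.group[symmetric]) (use width_le x in auto)
  thus ?thesis by simp
qed

definition level :: "'a \<Rightarrow> nat \<Rightarrow> nat" where "level x i = card {z. z \<in> Y \<and> dst x z = i}"

lemma sum_function_of_distance:
  assumes "x \<in> Y" shows "(\<Sum>z\<in>Y. f (dst x z)) = (\<Sum>i\<le>w. of_nat (level x i) * (f i :: complex))"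
  unfolding sum_by_distance[OF assms] level_def by (intro sum.cong refl) simp

lemma level_0: "x \<in> Y \<Longrightarrow> level x 0 = 1"
proof -
  assume "x \<in> Y"
  hence "{z. z \<in> Y \<and> dst x z = 0} = {x}" using dist_0_iff by auto
  thus ?thesis unfolding level_def by simp
qed

text \<open>The derivative at \<open>\<theta> i\<close> of the monic polynomial with roots
  \<open>\<theta> 0, ..., \<theta> w\<close>.\<close>

definition node_prod :: "nat \<Rightarrow> complex" where
  "node_prod i = (\<Prod>l\<in>{..w} - {i}. \<theta> i - \<theta> l)"

lemma node_prod_nonzero: "i \<le> w \<Longrightarrow> node_prod i \<noteq> 0"
proof -
  assume i: "i \<le> w"
  have "\<theta> i - \<theta> l \<noteq> 0" if "l \<in> {..w} - {i}" for l using theta_distinct[of i l] that i w_le by auto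
  thus ?thesis unfolding node_prod_def by simp
qed

lemma level_orthogonal:
  assumes "x \<in> Y" "degree p < w"
  shows "(\<Sum>i\<le>w. of_nat (level x i) * Q D i * poly p (\<theta> i)) = 0"
  using polynomial_products_vanish[of p "degree p" 1 0 x x] assms
    sum_function_of_distance[OF assms(1), of "\<lambda>i. Q D i * poly p (\<theta> i)"] by (simp add: mult.assoc)

text \<open>The numbers \<open>level x i * Q D i\<close> annihilate the degrees below
  \<open>w\<close>, so they are a multiple of \<open>1 / node_prod i\<close>;
  \<open>level x 0 = 1\<close> fixes the multiple, independently of \<open>x\<close>.\<close>

lemma level_eq:
  assumes "x \<in> Y" "i \<le> w"
  shows "of_nat (level x i) * Q D i * node_prod i = Q D 0 * node_prod 0"
  using orthogonal_to_polynomials[of w "\<lambda>i. of_nat (level x i) * Q D i" \<theta> i]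
    level_orthogonal[OF assms(1)] assms level_0[OF assms(1)] unfolding node_prod_def by simp

lemma level_nonzero: assumes "x \<in> Y" "i \<le> w" shows "level x i \<noteq> 0" "Q D i \<noteq> 0"
proof -
  have "of_nat (level x i) * Q D i * node_prod i \<noteq> 0"
    unfolding level_eq[OF assms] using node_prod_nonzero[of 0] Q_0_nonzero[of D] by simp
  thus "level x i \<noteq> 0" "Q D i \<noteq> 0" by auto
qed

lemma level_independent: assumes "x \<in> Y" "y \<in> Y" "i \<le> w" shows "level x i = level y i"
proof -
  have "of_nat (level x i) * (Q D i * node_prod i) = (of_nat (level y i) * (Q D i * node_prod i) :: complex)"
    using level_eq[OF assms(1,3)] level_eq[OF assms(2,3)] by (simp add: mult.assoc)
  thus ?thesis using level_nonzero(2)[OF assms(1,3)] node_prod_nonzero[OF assms(3)] by simp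
qed

lemma sum_level: assumes "x \<in> Y" shows "(\<Sum>i\<le>w. of_nat (level x i)) = (of_nat (card Y) :: complex)"
  using sum_function_of_distance[OF assms, of "\<lambda>_. 1"] by simp

end

text \<open>For \<open>h > 0\<close>, \<open>E h\<close> kills the all-ones vector. This instance
  gives the sphere sizes of the graph in the same form as those of \<open>Y\<close>.\<close>

sublocale q_polynomial_graph \<subseteq> whole: minimal_width_set adj b c E as bs cs UNIV D
proof
  fix h assume h: "D - D < h" "h \<le> D"
  have "(\<Sum>y\<in>UNIV. Q h (dst x y)) = 0" for x
  proof -
    have "(\<Sum>z\<in>UNIV. Q h (dst x z) * Q 0 (dst z x)) = 0" using conv_orth[of h 0] h by simp
    thus ?thesis by (simp add: Q_0 dist_le_diameter sum_divide_distrib[symmetric])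
  qed
  thus "(\<Sum>x\<in>UNIV. \<Sum>y\<in>UNIV. Q h (dst x y)) = 0" by simp
qed (auto simp: dist_le_diameter)

context minimal_width_set
begin

section \<open>Averaged intersection numbers of the subset\<close>

definition nbr_up :: "'a \<Rightarrow> 'a \<Rightarrow> nat" where
  "nbr_up y z = card {u \<in> Y. dst y u = Suc (dst y z) \<and> adj z u}"
definition nbr_down :: "'a \<Rightarrow> 'a \<Rightarrow> nat" where
  "nbr_down y z = card {u \<in> Y. Suc (dst y u) = dst y z \<and> adj z u}"

text \<open>The sum of \<open>\<theta>\<close> over the distances from one point of
  \<open>Y\<close>; the choice of the point is immaterial by
  \<open>level_independent\<close>.\<close>

definition total :: complex where "total = (\<Sum>i\<le>w. of_nat (level (SOME x. x \<in> Y) i) * \<theta> i)"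

lemma total_eq: assumes "x \<in> Y" shows "(\<Sum>u\<in>Y. \<theta> (dst x u)) = total"
proof -
  have "(SOME x. x \<in> Y) \<in> Y" using assms by (rule someI)
  hence "level x i = level (SOME x. x \<in> Y) i" if "i \<le> w" for i by (rule level_independent[OF assms _ that])
  thus ?thesis unfolding sum_function_of_distance[OF assms] total_def by simp
qed

text \<open>\<open>Re (\<theta> i)\<close> is largest only at \<open>i = 0\<close>. The number is a
  denominator in \<open>neighbour_sum\<close>.\<close>

lemma total_less:
  assumes "x \<in> Y" "1 \<le> w" shows "total - of_nat (card Y) * \<theta> 0 \<noteq> 0"
proof -
  have "(\<Sum>u\<in>Y. Re (\<theta> (dst x u))) < (\<Sum>u\<in>Y. Re (\<theta> 0))"
  proof (rule sum_strict_mono_ex1)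
    show "\<forall>u\<in>Y. Re (\<theta> (dst x u)) \<le> Re (\<theta> 0)"
    proof
      fix u show "Re (\<theta> (dst x u)) \<le> Re (\<theta> 0)"
        using theta_less[of "dst x u"] dist_le_diameter[of x u] by (cases "dst x u = 0") auto
    qed
    have "{z. z \<in> Y \<and> dst x z = 1} \<noteq> {}"
      using level_nonzero(1)[OF assms] unfolding level_def by auto
    then obtain u where "u \<in> Y" "dst x u = 1" by blast
    moreover have "Re (\<theta> 1) < Re (\<theta> 0)" by (rule theta_less) (use diameter in auto)
    ultimately show "\<exists>u\<in>Y. Re (\<theta> (dst x u)) < Re (\<theta> 0)" by metis
  qed simp
  hence "Re total < Re (of_nat (card Y) * \<theta> 0)" unfolding total_eq[OF assms(1), symmetric] by simp
  thus ?thesis by fastforce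
qed

text \<open>The mean of \<open>\<theta> (dst y u)\<close> over the \<open>u\<close> in
  \<open>Y\<close> at distance \<open>i\<close> from \<open>z\<close> is affine in
  \<open>\<theta> i\<close>, because including this factor in
  \<open>polynomial_products_vanish\<close> costs one degree. Its value at \<open>i = 0\<close> is
  known and the sum over \<open>Y\<close> determines the slope; \<open>i = 1\<close> gives the
  claim.\<close>

lemma neighbour_sum:
  assumes y: "y \<in> Y" and z: "z \<in> Y" and w: "2 \<le> w"
  defines "m \<equiv> (\<lambda>i. (total - of_nat (card Y) * \<theta> i) / (total - of_nat (card Y) * \<theta> 0))"
  shows "(\<Sum>u | u \<in> Y \<and> dst z u = 1. \<theta> (dst y u))
    = of_nat (level z 1) * (\<theta> (dst y z) + m (dst y z) * (\<theta> 1 - \<theta> 0))"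
proof -
  define S where "S i = (\<Sum>u | u \<in> Y \<and> dst z u = i. \<theta> (dst y u))" for i
  define s where "s i = S i / of_nat (level z i)" for i
  have S: "S i = of_nat (level z i) * s i" if "i \<le> w" for i
    using level_nonzero(1)[OF z that] by (simp add: s_def)
  have aff: "s i = s 0 + (s 1 - s 0) / (\<theta> 1 - \<theta> 0) * (\<theta> i - \<theta> 0)" if i: "i \<le> w" for i
  proof (rule affine_if_orthogonal[where w = w and \<mu> = "\<lambda>i. of_nat (level z i) * Q D i"])
    fix p :: "complex poly" assume p: "degree p + 1 < w"
    have "(\<Sum>u\<in>Y. Q D (dst z u) * poly p (\<theta> (dst z u)) * poly [:0, 1:] (\<theta> (dst y u))) = 0"
      by (rule polynomial_products_vanish[OF order_refl _ p]) simp
    hence "(\<Sum>i\<le>w. \<Sum>u | u \<in> Y \<and> dst z u = i. Q D (dst z u) * poly p (\<theta> (dst z u)) * \<theta> (dst y u)) = 0"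
      unfolding sum_by_distance[OF z] by simp
    moreover have "(\<Sum>u | u \<in> Y \<and> dst z u = i. Q D (dst z u) * poly p (\<theta> (dst z u)) * \<theta> (dst y u))
        = of_nat (level z i) * Q D i * s i * poly p (\<theta> i)" if "i \<le> w" for i
    proof -
      have "(\<Sum>u | u \<in> Y \<and> dst z u = i. Q D (dst z u) * poly p (\<theta> (dst z u)) * \<theta> (dst y u))
          = Q D i * poly p (\<theta> i) * S i" unfolding S_def sum_distrib_left by (intro sum.cong) auto
      thus ?thesis unfolding S[OF that] by (simp add: mult_ac)
    qed
    ultimately show "(\<Sum>i\<le>w. of_nat (level z i) * Q D i * s i * poly p (\<theta> i)) = 0" by simp
  next
    fix p :: "complex poly" assume "degree p < w"
    thus "(\<Sum>i\<le>w. of_nat (level z i) * Q D i * poly p (\<theta> i)) = 0" using level_orthogonal[OF z] by simp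
  next
    fix i j assume "i \<le> w" "j \<le> w" "\<theta> i = \<theta> j"
    thus "i = j" using theta_distinct w_le by auto
  next
    fix i assume "i \<le> w" thus "of_nat (level z i) * Q D i \<noteq> 0" using level_nonzero[OF z] by simp
  qed (use i w in auto)
  define k where "k = (s 1 - s 0) / (\<theta> 1 - \<theta> 0)"
  have s0: "s 0 = \<theta> (dst y z)"
  proof -
    have "{u. u \<in> Y \<and> dst z u = 0} = {z}" using z dist_0_iff by auto
    thus ?thesis unfolding s_def S_def using level_0[OF z] by simp
  qed
  have "total = (\<Sum>i\<le>w. S i)" unfolding total_eq[OF y, symmetric] sum_by_distance[OF z] S_def ..
  also have "\<dots> = (\<Sum>i\<le>w. of_nat (level z i) * (s 0 - k * \<theta> 0) + k * (of_nat (level z i) * \<theta> i))"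
  proof (intro sum.cong refl)
    fix i assume "i \<in> {..w}"
    hence i: "i \<le> w" by simp
    show "S i = of_nat (level z i) * (s 0 - k * \<theta> 0) + k * (of_nat (level z i) * \<theta> i)"
      unfolding S[OF i] aff[OF i] k_def[symmetric] by (simp add: algebra_simps)
  qed
  also have "\<dots> = of_nat (card Y) * (s 0 - k * \<theta> 0) + k * total"
    unfolding sum.distrib sum_distrib_right[symmetric] sum_distrib_left[symmetric] sum_level[OF z]
    using sum_function_of_distance[OF z, of \<theta>] total_eq[OF z] by simp
  finally have "k * (total - of_nat (card Y) * \<theta> 0) = total - of_nat (card Y) * s 0"
    by (simp add: algebra_simps)
  hence "k = m (dst y z)"
    using total_less[OF y] w unfolding m_def s0 by (simp add: field_simps)
  moreover have "s 1 = s 0 + k * (\<theta> 1 - \<theta> 0)" unfolding k_def using aff[of 1] w by simp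
  ultimately show ?thesis using S[of 1] w unfolding S_def[of 1] s0 by simp
qed

text \<open>The counts may vary over a sphere and are therefore averaged; the affine relation and
  the detailed balance survive this.\<close>

definition sub_up :: "'a \<Rightarrow> nat \<Rightarrow> complex" where
  "sub_up y h = of_nat (\<Sum>z | z \<in> Y \<and> dst y z = h. nbr_up y z) * (\<theta> h - \<theta> (Suc h)) / of_nat (level y h)"
definition sub_down :: "'a \<Rightarrow> nat \<Rightarrow> complex" where
  "sub_down y h = of_nat (\<Sum>z | z \<in> Y \<and> dst y z = h. nbr_down y z) * (\<theta> (h - 1) - \<theta> h) / of_nat (level y h)"

lemma sub_affine_system:
  assumes y: "y \<in> Y" and w: "2 \<le> w"
  shows "affine_system w \<theta> (sub_up y) (sub_down y)"
proof -
  define n where "n = (of_nat (card Y) :: complex)"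
  \<comment> \<open>The slope in \<open>neighbour_sum\<close> is affine in
    \<open>\<theta> h\<close>, so the relation holds at each \<open>z\<close> with the same
    \<open>p\<close>, before averaging.\<close>
  define K where "K = of_nat (level y 1) * (\<theta> 1 - \<theta> 0) / (total - n * \<theta> 0)"
  define p where "p = [:K * total, - K * n:]"
  have point: "of_nat (nbr_down y z) * (\<theta> (h - 1) - \<theta> h) - of_nat (nbr_up y z) * (\<theta> h - \<theta> (Suc h)) = poly p (\<theta> h)"
    if z: "z \<in> Y" "dst y z = h" for z h
  proof -
    have nb: "{u. u \<in> Y \<and> dst z u = 1} = {u \<in> Y. adj z u}" "{u. adj z u \<and> u \<in> Y} = {u \<in> Y. adj z u}"
      using dist_1_iff by auto
    have lv: "level z 1 = level y 1" by (rule level_independent) (use y z w in auto)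
    have "(\<Sum>u | u \<in> Y \<and> dst z u = 1. \<theta> (dst y u)) = of_nat (nbr_down y z) * (\<theta> (h - 1) - \<theta> h)
       + of_nat (nbr_up y z) * (\<theta> (Suc h) - \<theta> h) + of_nat (level z 1) * \<theta> h"
      using sum_neighbours[where f = \<theta> and x = y and y = z and Z = Y] z(2)
      unfolding nb level_def nbr_down_def nbr_up_def by simp
    moreover have "(\<Sum>u | u \<in> Y \<and> dst z u = 1. \<theta> (dst y u))
       = of_nat (level z 1) * \<theta> h + K * (total - n * \<theta> h)"
      unfolding neighbour_sum[OF y z(1) w] z(2) K_def n_def lv by (simp add: algebra_simps)
    ultimately have "of_nat (nbr_down y z) * (\<theta> (h - 1) - \<theta> h) - of_nat (nbr_up y z) * (\<theta> h - \<theta> (Suc h))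
       = K * (total - n * \<theta> h)" by algebra
    thus ?thesis unfolding p_def by (simp add: algebra_simps)
  qed
  have "sub_down y h - sub_up y h = poly p (\<theta> h)" if h: "h \<le> w" for h
  proof -
    have "of_nat (\<Sum>z | z \<in> Y \<and> dst y z = h. nbr_down y z) * (\<theta> (h - 1) - \<theta> h)
      - of_nat (\<Sum>z | z \<in> Y \<and> dst y z = h. nbr_up y z) * (\<theta> h - \<theta> (Suc h))
      = (\<Sum>z | z \<in> Y \<and> dst y z = h. poly p (\<theta> h))"
      unfolding of_nat_sum sum_distrib_right sum_subtractf[symmetric] by (intro sum.cong refl) (use point in auto)
    also have "\<dots> = of_nat (level y h) * poly p (\<theta> h)" unfolding level_def by simp
    finally show ?thesis unfolding sub_down_def sub_up_def diff_divide_distrib[symmetric]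
      using level_nonzero(1)[OF y h] by simp
  qed
  moreover have "sub_down y 0 = 0" by (simp add: sub_down_def)
  moreover have "sub_up y w = 0"
  proof -
    have "nbr_up y z = 0" if "z \<in> Y" "dst y z = w" for z
    proof -
      have "{u \<in> Y. dst y u = Suc w \<and> adj z u} = {}" using width_le[OF y] by force
      thus ?thesis unfolding nbr_up_def that(2) by simp
    qed
    thus ?thesis by (simp add: sub_up_def)
  qed
  moreover have "degree p \<le> 1" by (simp add: p_def)
  ultimately show ?thesis unfolding affine_system_def by blast
qed

lemma sub_detailed_balance:
  assumes y: "y \<in> Y"
  shows "detailed_balance w (\<lambda>i. of_nat (level y i)) (sub_up y) (sub_down y)"
  unfolding detailed_balance_def
proof (intro allI impI)
  fix i assume i: "i < w"
  have "(\<Sum>z | z \<in> Y \<and> dst y z = i. nbr_up y z) = (\<Sum>z | z \<in> Y \<and> dst y z = Suc i. nbr_down y z)"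
  proof -
    have "(\<Sum>z | z \<in> Y \<and> dst y z = i. nbr_up y z)
        = (\<Sum>z | z \<in> Y \<and> dst y z = i. card {u \<in> Y. dst y u = Suc i \<and> adj z u})"
      by (intro sum.cong refl) (simp add: nbr_up_def)
    also have "\<dots> = (\<Sum>z | z \<in> Y \<and> dst y z = Suc i. nbr_down y z)"
      unfolding down_up_balance by (intro sum.cong refl) (simp add: nbr_down_def)
    finally show ?thesis .
  qed
  thus "of_nat (level y i) * sub_up y i = of_nat (level y (Suc i)) * sub_down y (Suc i)"
    unfolding sub_up_def sub_down_def
    using level_nonzero(1)[OF y, of i] level_nonzero(1)[OF y, of "Suc i"] i by simp
qed

end

section \<open>Convexity\<close>

context minimal_width_set
begin

lemma whole_detailed_balance: "detailed_balance D (\<lambda>i. of_nat (whole.level y i)) up down"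
  unfolding detailed_balance_def
proof (intro allI impI)
  fix i assume i: "i < D"
  have "whole.level y i * b i = (\<Sum>z | z \<in> UNIV \<and> dst y z = i. card {u \<in> UNIV. dst y u = Suc i \<and> adj z u})"
  proof -
    have "(\<Sum>z | z \<in> UNIV \<and> dst y z = i. card {u \<in> UNIV. dst y u = Suc i \<and> adj z u}) = (\<Sum>z | z \<in> UNIV \<and> dst y z = i. b i)"
    proof (rule sum.cong[OF refl])
      fix z assume "z \<in> {z. z \<in> UNIV \<and> dst y z = i}"
      thus "card {u \<in> UNIV. dst y u = Suc i \<and> adj z u} = b i" using card_up[of y z] by simp
    qed
    thus ?thesis unfolding whole.level_def by simp
  qed
  also have "\<dots> = (\<Sum>z | z \<in> UNIV \<and> dst y z = Suc i. card {u \<in> UNIV. Suc (dst y u) = Suc i \<and> adj z u})"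
    by (rule down_up_balance)
  also have "\<dots> = (\<Sum>z | z \<in> UNIV \<and> dst y z = Suc i. c (Suc i))"
  proof (rule sum.cong[OF refl])
    fix z assume "z \<in> {z. z \<in> UNIV \<and> dst y z = Suc i}"
    thus "card {u \<in> UNIV. Suc (dst y u) = Suc i \<and> adj z u} = c (Suc i)" using card_down[of y z] by simp
  qed
  also have "\<dots> = whole.level y (Suc i) * c (Suc i)" unfolding whole.level_def by simp
  finally have "of_nat (whole.level y i) * of_nat (b i) = (of_nat (whole.level y (Suc i)) * of_nat (c (Suc i)) :: complex)"
    by (simp flip: of_nat_mult)
  thus "of_nat (whole.level y i) * up i = of_nat (whole.level y (Suc i)) * down (Suc i)"
    unfolding up_def down_def by (simp add: mult.assoc[symmetric])
qed

lemma whole_node_prod: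
  assumes "i \<le> w" shows "whole.node_prod i = node_prod i * (\<Prod>l\<in>{w<..D}. \<theta> i - \<theta> l)"
proof -
  have eq: "{..D} - {i} = ({..w} - {i}) \<union> {w<..D}" using assms w_le by auto
  show ?thesis unfolding whole.node_prod_def node_prod_def eq by (rule prod.union_disjoint) auto
qed

text \<open>Compare \<open>level_eq\<close> for \<open>Y\<close> and for the whole vertex set:
  \<open>Q D i\<close> cancels, and the node products differ by the factors of the nodes above
  \<open>w\<close>.\<close>

lemma level_weights:
  assumes y: "y \<in> Y" and i: "i \<le> w"
  shows "of_nat (level y i) = node_prod 0 / whole.node_prod 0 *
    (of_nat (whole.level y i) * (\<Prod>l\<in>{w<..D}. \<theta> i - \<theta> l))"
proof -
  define P where "P = (\<Prod>l\<in>{w<..D}. \<theta> i - \<theta> l)"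
  define k n :: complex where "k = of_nat (whole.level y i)" "n = of_nat (level y i)"
  have 1: "n * (Q D i * node_prod i) = Q D 0 * node_prod 0"
    using level_eq[OF y i] by (simp add: k_n_def mult.assoc)
  have "k * Q D i * whole.node_prod i = Q D 0 * whole.node_prod 0"
    unfolding k_n_def by (rule whole.level_eq) (use i w_le in auto)
  hence 2: "k * P * (Q D i * node_prod i) = Q D 0 * whole.node_prod 0"
    unfolding whole_node_prod[OF i] P_def[symmetric] by (simp only: mult_ac)
  have nz: "Q D i * node_prod i \<noteq> 0" "whole.node_prod 0 \<noteq> 0"
    using level_nonzero(2)[OF y i] node_prod_nonzero[OF i] whole.node_prod_nonzero[of 0] by auto
  have "(n * whole.node_prod 0 - node_prod 0 * (k * P)) * (Q D i * node_prod i) = 0"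
    using 1 2 by algebra
  hence "n * whole.node_prod 0 = node_prod 0 * (k * P)" using nz by simp
  hence "n = node_prod 0 / whole.node_prod 0 * (k * P)" using nz(2) by (simp add: field_simps)
  thus ?thesis unfolding k_n_def P_def .
qed

lemma theta_step_nonzero: assumes "1 \<le> i" "i \<le> D" shows "\<theta> (i - 1) - \<theta> i \<noteq> 0"
proof
  assume "\<theta> (i - 1) - \<theta> i = 0"
  hence "i - 1 = i" by (intro theta_distinct) (use assms in auto)
  thus False using assms by simp
qed

lemma down_nonzero: assumes "1 \<le> i" "i \<le> D" shows "down i \<noteq> 0"
proof -
  have "c (Suc (i - 1)) > 0" by (rule c_pos) (use assms in auto)
  thus ?thesis using theta_step_nonzero[OF assms] assms unfolding down_def by simp
qed

lemma sub_down_1: assumes y: "y \<in> Y" and w: "1 \<le> w" shows "sub_down y 1 = down 1"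
proof -
  have "nbr_down y z = 1" if "z \<in> Y" "dst y z = 1" for z
  proof -
    have "{u \<in> Y. Suc (dst y u) = dst y z \<and> adj z u} = {y}"
      using that y dist_0_iff dist_1_iff[of y z] adj_sym[of y z] by auto
    thus ?thesis unfolding nbr_down_def by simp
  qed
  hence "(\<Sum>z | z \<in> Y \<and> dst y z = 1. nbr_down y z) = level y 1" unfolding level_def by simp
  thus ?thesis using level_nonzero(1)[OF y w] c_1 diameter unfolding sub_down_def down_def by simp
qed

lemma nested_systems:
  assumes "conic_sequence D \<theta> \<beta> \<gamma> \<rho>" and y: "y \<in> Y" and w: "2 \<le> w" "w < D"
  shows "nested_systems D \<theta> \<beta> \<gamma> \<rho> w (\<lambda>i. of_nat (whole.level y i)) (\<lambda>i. of_nat (level y i))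
    up down (sub_up y) (sub_down y) (node_prod 0 / whole.node_prod 0)"
proof -
  interpret conic_sequence D \<theta> \<beta> \<gamma> \<rho> by fact
  show ?thesis
  proof
    show "quadratic_system D \<theta> up down" by (rule quadratic_system)
    show "detailed_balance D (\<lambda>i. of_nat (whole.level y i)) up down" by (rule whole_detailed_balance)
    show "affine_system w \<theta> (sub_up y) (sub_down y)" by (rule sub_affine_system[OF y w(1)])
    show "detailed_balance w (\<lambda>i. of_nat (level y i)) (sub_up y) (sub_down y)" by (rule sub_detailed_balance[OF y])
    show "sub_down y 1 = down 1" using sub_down_1[OF y] w by simp
    have "card Y \<noteq> 0" using y by auto
    thus "(\<Sum>i\<le>w. of_nat (level y i)) \<noteq> (0::complex)" unfolding sum_level[OF y] by simp
    fix i assume i: "i \<le> w"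
    show "of_nat (level y i) = node_prod 0 / whole.node_prod 0 *
        (of_nat (whole.level y i) * (\<Prod>l\<in>{w<..D}. \<theta> i - \<theta> l))" by (rule level_weights[OF y i])
    show "of_nat (level y i) \<noteq> (0::complex)" using level_nonzero(1)[OF y i] by simp
    assume "1 \<le> i" thus "down i \<noteq> 0" using down_nonzero i w by simp
  qed (use w in auto)
qed

lemma nbr_down_le: "nbr_down y z \<le> c (dst y z)"
  unfolding nbr_down_def card_down[symmetric] by (rule card_mono) auto

lemma nbr_down_eq_iff:
  "nbr_down y z = c (dst y z) \<longleftrightarrow> (\<forall>u. Suc (dst y u) = dst y z \<and> adj z u \<longrightarrow> u \<in> Y)"
proof -
  have "nbr_down y z = c (dst y z) \<longleftrightarrow>
    {u \<in> Y. Suc (dst y u) = dst y z \<and> adj z u} = {u. Suc (dst y u) = dst y z \<and> adj z u}"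
    unfolding nbr_down_def card_down[symmetric]
    using card_subset_eq[of "{u. Suc (dst y u) = dst y z \<and> adj z u}" "{u \<in> Y. Suc (dst y u) = dst y z \<and> adj z u}"]
    by auto
  thus ?thesis by auto
qed

text \<open>No count exceeds \<open>c h\<close>, so the average reaches \<open>c h\<close> only if
  every count does.\<close>

lemma sub_down_eq_iff:
  assumes y: "y \<in> Y" and h: "1 \<le> h" "h \<le> w"
  shows "sub_down y h = down h \<longleftrightarrow> (\<forall>z\<in>Y. dst y z = h \<longrightarrow> nbr_down y z = c h)"
proof -
  have ne: "\<theta> (h - 1) - \<theta> h \<noteq> 0" by (rule theta_step_nonzero) (use h w_le in auto)
  let ?N = "\<Sum>z | z \<in> Y \<and> dst y z = h. nbr_down y z"
  have "sub_down y h = down h \<longleftrightarrow> complex_of_nat ?N = of_nat (level y h) * of_nat (c h)"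
  proof -
    have "N * x / L = a * x \<longleftrightarrow> N = L * a" if "x \<noteq> 0" "L \<noteq> 0" for N x L a :: complex
    proof -
      have "N * x / L = a * x \<longleftrightarrow> (N / L) * x = a * x" by simp
      also have "\<dots> \<longleftrightarrow> N / L = a" using that by (simp only: mult_cancel_right) simp
      also have "\<dots> \<longleftrightarrow> N = L * a" using that by (simp add: nonzero_divide_eq_eq mult.commute)
      finally show ?thesis .
    qed
    from this[OF ne, of "of_nat (level y h)"] show ?thesis
      unfolding sub_down_def down_def using level_nonzero(1)[OF y h(2)] by (simp only: of_nat_eq_0_iff not_False_eq_True)
  qed
  also have "\<dots> \<longleftrightarrow> ?N = (\<Sum>z | z \<in> Y \<and> dst y z = h. c h)"
    unfolding level_def by (simp flip: of_nat_mult del: of_nat_sum)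
  also have "\<dots> \<longleftrightarrow> (\<forall>z\<in>Y. dst y z = h \<longrightarrow> nbr_down y z = c h)"
  proof
    assume eq: "?N = (\<Sum>z | z \<in> Y \<and> dst y z = h. c h)"
    show "\<forall>z\<in>Y. dst y z = h \<longrightarrow> nbr_down y z = c h"
    proof (rule ccontr)
      assume "\<not> (\<forall>z\<in>Y. dst y z = h \<longrightarrow> nbr_down y z = c h)"
      then obtain z where z: "z \<in> Y" "dst y z = h" "nbr_down y z \<noteq> c h" by blast
      have "?N < (\<Sum>z | z \<in> Y \<and> dst y z = h. c h)"
      proof (rule sum_strict_mono_ex1)
        show "\<forall>z\<in>{z \<in> Y. dst y z = h}. nbr_down y z \<le> c h" using nbr_down_le[of y] by auto
        have "nbr_down y z < c h" using z nbr_down_le[of y z] by simp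
        thus "\<exists>z\<in>{z \<in> Y. dst y z = h}. nbr_down y z < c h" using z by blast
      qed simp
      thus False using eq by simp
    qed
  qed simp
  finally show ?thesis .
qed

text \<open>Agreement of the numbers says that the last vertex before the end of a geodesic between
  points of \<open>Y\<close> lies in \<open>Y\<close>; removing the end repeatedly gives
  convexity.\<close>

lemma geodetically_closed_iff:
  "geodetically_closed adj Y \<longleftrightarrow> (\<forall>y\<in>Y. \<forall>h. 1 \<le> h \<longrightarrow> h \<le> w \<longrightarrow> sub_down y h = down h)"
proof
  assume cl: "geodetically_closed adj Y"
  show "\<forall>y\<in>Y. \<forall>h. 1 \<le> h \<longrightarrow> h \<le> w \<longrightarrow> sub_down y h = down h"
  proof (intro ballI allI impI)
    fix y h assume y: "y \<in> Y" and h: "1 \<le> h" "h \<le> w"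
    have "nbr_down y z = c h" if z: "z \<in> Y" "dst y z = h" for z
    proof -
      have "u \<in> Y" if u: "Suc (dst y u) = dst y z" "adj z u" for u
      proof -
        have "dst u z = 1" using u(2) dist_1_iff[of z u] dist_sym[of u z] by simp
        hence "dst y u + dst u z = dst y z" using u(1) by simp
        thus ?thesis using cl y z(1) unfolding geodetically_closed_def by blast
      qed
      thus ?thesis using nbr_down_eq_iff[of y z] z(2) by blast
    qed
    thus "sub_down y h = down h" using sub_down_eq_iff[OF y h] by blast
  qed
next
  assume eq: "\<forall>y\<in>Y. \<forall>h. 1 \<le> h \<longrightarrow> h \<le> w \<longrightarrow> sub_down y h = down h"
  have step: "u \<in> Y" if "y \<in> Y" "z \<in> Y" "Suc (dst y u) = dst y z" "adj z u" for y z u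
  proof -
    have "1 \<le> dst y z" "dst y z \<le> w" using that width_le by auto
    hence "nbr_down y z = c (dst y z)" using eq sub_down_eq_iff[of y "dst y z"] that by blast
    thus ?thesis using nbr_down_eq_iff that by blast
  qed
  have "z \<in> Y" if "x \<in> Y" "y \<in> Y" "dst x z + dst z y = dst x y" for x y z
    using that
  proof (induction "dst z y" arbitrary: y)
    case 0 thus ?case using dist_0_iff[of z y] by simp
  next
    case (Suc n)
    \<comment> \<open>\<open>u\<close> precedes \<open>y\<close> on a geodesic from
      \<open>z\<close>, hence on one from \<open>x\<close> through \<open>z\<close>. So
      \<open>step\<close> puts \<open>u\<close> in \<open>Y\<close>, and the induction hypothesis
      applies with \<open>u\<close> for \<open>y\<close>.\<close>
    obtain u where u: "dst z u = n" "adj u y" using geodesic_step Suc.hyps(2)[symmetric] by blast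
    have "dst x u \<le> dst x z + n" using dist_triangle[of x u z] u by simp
    moreover have "dst x y \<le> Suc (dst x u)" using dist_adj[OF u(2)] by simp
    ultimately have xu: "Suc (dst x u) = dst x y" "dst x z + dst z u = dst x u"
      using Suc.prems(3) Suc.hyps(2) u(1) by auto
    have "u \<in> Y" by (rule step[OF Suc.prems(1,2) xu(1)]) (use u(2) adj_sym in blast)
    thus ?case using Suc.hyps(1)[of u] u(1) xu(2) Suc.prems(1) by simp
  qed
  thus "geodetically_closed adj Y" unfolding geodetically_closed_def by blast
qed

lemma geodetically_closed_if_geometric:
  assumes "2 \<le> w" "w < D" and geo: "\<And>i. i < D \<Longrightarrow> \<theta> i = q * \<theta> (Suc i) + r"
  shows "geodetically_closed adj Y"
  unfolding geodetically_closed_iff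
proof (intro ballI allI impI)
  fix y h assume y: "y \<in> Y" and h: "1 \<le> h" "h \<le> w"
  obtain \<beta> \<gamma> \<rho> where "conic_sequence D \<theta> \<beta> \<gamma> \<rho>" using conic_sequence_theta by blast
  from nested_systems.subsystem_agrees_if_geometric[OF nested_systems[OF this y assms(1,2)] geo h]
  show "sub_down y h = down h" .
qed

lemma geometric_if_geodetically_closed:
  assumes "2 \<le> w" "w < D" "Y \<noteq> {}" "geodetically_closed adj Y"
  obtains q r where "q \<noteq> 0" "\<And>i. i < D \<Longrightarrow> \<theta> i = q * \<theta> (Suc i) + r"
proof -
  obtain y where y: "y \<in> Y" using assms(3) by blast
  obtain \<beta> \<gamma> \<rho> where "conic_sequence D \<theta> \<beta> \<gamma> \<rho>" using conic_sequence_theta by blast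
  note ns = nested_systems[OF this y assms(1,2)]
  have "\<And>h. 1 \<le> h \<Longrightarrow> h \<le> w \<Longrightarrow> sub_down y h = down h"
    using assms(4) y unfolding geodetically_closed_iff by blast
  from nested_systems.geometric_if_subsystem_agrees[OF ns this] show ?thesis using that by blast
qed

end

section \<open>Widths and dual eigenvalues in terms of distances\<close>

context distance_regular_graph
begin

lemma quad_form_dmat: "quad_form (dmat f) (char_vec Y) = (\<Sum>x\<in>Y. \<Sum>y\<in>Y. f (dst x y))"
proof -
  have ind: "(\<Sum>x\<in>UNIV. (if x \<in> Y then 1 else 0) * g x) = (\<Sum>x\<in>Y. g x)" for g :: "'a \<Rightarrow> complex"
    by (rule sum.mono_neutral_cong_right) auto
  have "(dmat f *v char_vec Y) $ x = (\<Sum>y\<in>Y. f (dst x y))" for x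
    unfolding matrix_vector_mult_def char_vec_def using ind[of "\<lambda>y. f (dst x y)"] by (simp add: mult.commute)
  thus ?thesis unfolding quad_form_def using ind by (simp add: char_vec_def)
qed

lemma dist_le_width:
  assumes "x \<in> Y" "y \<in> Y" shows "dst x y \<le> width adj Y"
proof -
  define i where "i = dst x y"
  have "dist_mat adj i = dmat (\<lambda>t. if t = i then 1 else 0)" by (simp add: dist_mat_def vec_eq_iff)
  hence "quad_form (dist_mat adj i) (char_vec Y) = (\<Sum>x\<in>Y. \<Sum>y\<in>Y. if dst x y = i then 1 else 0)"
    by (simp add: quad_form_dmat)
  moreover define S :: nat where "S = (\<Sum>x\<in>Y. \<Sum>y\<in>Y. if dst x y = i then 1 else 0)"
  ultimately have q: "quad_form (dist_mat adj i) (char_vec Y) = of_nat S" by (simp add: if_distrib cong: if_cong)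
  have "S \<noteq> 0"
  proof
    assume "S = 0"
    hence "\<forall>u\<in>Y. \<forall>v\<in>Y. (if dst u v = i then 1 else 0) = (0::nat)"
      unfolding S_def by (simp only: sum_eq_0_iff finite)
    hence "(if dst x y = i then 1 else 0) = (0::nat)" using assms by blast
    thus False by (simp add: i_def)
  qed
  hence "i \<in> {i. i \<le> D \<and> quad_form (dist_mat adj i) (char_vec Y) \<noteq> 0}"
    using dist_le_diameter[of x y] q by (simp add: i_def)
  thus ?thesis unfolding width_def i_def by (intro Max_ge) auto
qed

end

lemma (in q_polynomial_graph) dual_eigenvalues_iff:
  "dual_eigenvalues adj E \<phi> \<longleftrightarrow> (\<forall>i\<le>D. \<theta> i = \<phi> i)"
proof -
  have "(\<Sum>i\<le>D. smult_mat (\<phi> i) (dist_mat adj i)) = dmat \<phi>"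
    using dist_le_diameter by (auto simp: vec_eq_iff smult_mat_def dist_mat_def sum_component if_distrib cong: if_cong)
  moreover have "smult_mat (of_nat CARD('a)) (E 1) = dmat \<theta>"
    using E_eq[of 1] diameter by (simp add: vec_eq_iff smult_mat_def \<theta>_def)
  ultimately show ?thesis unfolding dual_eigenvalues_def by (simp add: dmat_eq_iff)
qed

theorem mainTheorem1:
  fixes adj :: "'a::finite \<Rightarrow> 'a \<Rightarrow> bool"
    and E :: "nat \<Rightarrow> complex^'a^'a"
    and Y :: "'a set"
  assumes "distance_regular adj"
    and "graph_diameter adj \<ge> 3"
    and "q_polynomial adj E"
    and "descendent adj E Y"
    and "1 < width adj Y" and "width adj Y < graph_diameter adj"
  shows "geodetically_closed adj Y \<longleftrightarrow>
    (\<exists>q \<alpha> \<beta> :: complex.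
       classical_parameters adj (graph_diameter adj) q \<alpha> \<beta> \<and> standard_ordering adj q E)"
proof -
  obtain b c where bc: "simple_graph adj" "connected_graph adj" "intersection_array adj b c"
    using assms(1) unfolding distance_regular_def by blast
  obtain as bs cs :: "nat \<Rightarrow> complex" where qp: "primitive_idempotent_ordering adj E"
    "\<And>i. i \<in> {1..graph_diameter adj} \<Longrightarrow> bs (i - 1) * cs i \<noteq> 0"
    "\<And>i. i \<le> graph_diameter adj \<Longrightarrow> hadamard (E 1) (E i) =
           smult_mat (1 / of_nat CARD('a))
             ((if i = 0 then 0 else smult_mat (bs (i - 1)) (E (i - 1)))
              + smult_mat (as i) (E i)
              + (if i = graph_diameter adj then 0 else smult_mat (cs (i + 1)) (E (i + 1))))"
    using assms(3) unfolding q_polynomial_def Let_def by blast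
  interpret distance_regular_graph adj b c by unfold_locales (fact bc)+
  interpret q_polynomial_graph adj b c E as bs cs
  proof
    show "cs i \<noteq> 0" if "i \<in> {1..D}" for i using qp(2)[OF that] by auto
  qed (fact qp(1) assms(2) qp(3))+
  define w where "w = width adj Y"
  have w: "2 \<le> w" "w < D" using assms(5,6) by (simp_all add: w_def)
  have Y: "Y \<noteq> {}" "w + dual_width adj E Y = D" using assms(4) unfolding descendent_def w_def by auto
  interpret minimal_width_set adj b c E as bs cs Y w
  proof
    show "dst x y \<le> w" if "x \<in> Y" "y \<in> Y" for x y using dist_le_width[OF that] by (simp add: w_def)
    show "w \<le> D" using w by simp
    fix h assume h: "D - w < h" "h \<le> D"
    have "quad_form (E h) (char_vec Y) = 0"
    proof (rule ccontr)
      assume "quad_form (E h) (char_vec Y) \<noteq> 0"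
      hence "h \<le> dual_width adj E Y" unfolding dual_width_def using h by (intro Max_ge) auto
      thus False using h Y(2) by simp
    qed
    thus "(\<Sum>x\<in>Y. \<Sum>y\<in>Y. Q h (dst x y)) = 0" unfolding E_eq[OF h(2)] quad_form_dmat .
  qed
  show ?thesis
  proof
    assume "geodetically_closed adj Y"
    then obtain q r where q: "q \<noteq> 0" and geo: "\<And>i. i < D \<Longrightarrow> \<theta> i = q * \<theta> (Suc i) + r"
      using geometric_if_geodetically_closed[OF w Y(1)] by blast
    \<comment> \<open>\<open>q = - 1\<close> would give the sequence period 2; excluding it permits
      solving for \<open>c i\<close> in \<open>classical_form_of_geometric\<close>.\<close>
    have q1: "q \<noteq> - 1"
    proof
      assume "q = - 1"
      hence "\<theta> 0 = \<theta> 2" using geo[of 0] geo[of 1] diameter by (simp add: numeral_2_eq_2)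
      thus False using theta_distinct[of 0 2] diameter by simp
    qed
    have ne: "\<theta> (D - 1) \<noteq> \<theta> D" using theta_step_nonzero[of D] diameter by simp
    have sys: "quadratic_system D \<theta> (\<lambda>i. of_nat (b i) * (\<theta> i - \<theta> (Suc i))) (\<lambda>i. of_nat (c i) * (\<theta> (i - 1) - \<theta> i))"
      using quadratic_system unfolding up_def[abs_def] down_def[abs_def] .
    obtain \<alpha> \<beta> where ab:
      "\<And>i. i \<le> D \<Longrightarrow> of_nat (b i) = (q_number q D - q_number q i) * (\<beta> - \<alpha> * q_number q i)"
      "\<And>i. i \<le> D \<Longrightarrow> of_nat (c i) = q_number q i * (1 + \<alpha> * q_number q (i - 1))"
      by (rule classical_form_of_geometric[OF geo _ q q1 ne sys]) (use diameter b_diameter c_0 c_1 in auto)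
    have "classical_parameters adj D q \<alpha> \<beta>"
      unfolding classical_parameters_def by (intro conjI refl exI[of _ b] exI[of _ c] allI impI bc(3) ab)
    moreover have "standard_ordering adj q E"
    proof -
      have "\<forall>i\<le>D. \<theta> i = (\<theta> (D - 1) - \<theta> D) * q_number q (D - i) + \<theta> D"
        by (intro allI impI geometric_eq_q_number[where r = r] geo)
      moreover have "\<theta> (D - 1) - \<theta> D \<noteq> 0" using ne by simp
      ultimately show ?thesis
        unfolding standard_ordering_def dual_eigenvalues_iff by (intro conjI exI assms(3))
    qed
    ultimately show "\<exists>q \<alpha> \<beta>. classical_parameters adj D q \<alpha> \<beta> \<and> standard_ordering adj q E" by blast
  next
    assume "\<exists>q \<alpha> \<beta>. classical_parameters adj D q \<alpha> \<beta> \<and> standard_ordering adj q E"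
    then obtain q where "standard_ordering adj q E" by blast
    then obtain \<xi> \<zeta> where "\<forall>i\<le>D. \<theta> i = \<xi> * q_number q (D - i) + \<zeta>"
      unfolding standard_ordering_def dual_eigenvalues_iff by blast
    hence \<theta>: "\<And>i. i \<le> D \<Longrightarrow> \<theta> i = \<xi> * q_number q (D - i) + \<zeta>" by blast
    \<comment> \<open>The intercept comes from
      \<open>q_number q (Suc n) = 1 + q * q_number q n\<close>.\<close>
    have "\<theta> i = q * \<theta> (Suc i) + (\<xi> + \<zeta> - q * \<zeta>)" if i: "i < D" for i
    proof -
      have "D - i = Suc (D - Suc i)" using i by simp
      thus ?thesis using \<theta>[of i] \<theta>[of "Suc i"] i by (simp add: q_number_Suc algebra_simps)
    qed
    thus "geodetically_closed adj Y" by (rule geodetically_closed_if_geometric[OF w])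
  qed
qed

end
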